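(* For each integer $n\ge 2$, let $X_0,\dots,X_{n-1}$ be independent random variables with $\mathbb{P}(X_k=1)=\mathbb{P}(X_k=-1)=\tfrac12$, and let $P(z)=\sum_{k=0}^{n-1}X_kz^k$. For $r>0$ let $\sigma(r)>0$ be given by $\sigma(r)^2=\sum_{k=0}^{n-1}r^{2k}$, and set $\widetilde P(re^{i\theta})=P(re^{i\theta})/\sigma(r)$ for $\theta\in[-\pi,\pi]$. Let $\ell\in\{1,2\}$. Then, as $n\to\infty$, for all $r\in[1-n^{-11/10},\,1+n^{-11/10}]$, $$\mathbb{E}\left[\left(\int_{-\pi}^{\pi}\log\left|\widetilde P(re^{i\theta})\right|\,d\mu(\theta)\right)^{\ell}\right]=\left(-\frac{\gamma}{2}\right)^{\ell}+\mathcal{O}\left(\frac{(\log n)^2}{\sqrt n}\right),$$ where $\gamma\approx 0.5772$ is Euler's constant and the implied constant is uniform in $r$; that is, there exist constants $C>0$ and $N$ such that for all $n\ge N$, all $\ell\in\{1,2\}$ and all $r\in[1-n^{-11/10},1+n^{-11/10}]$, the absolute value of the difference between the left-hand side and $(-\gamma/2)^\ell$ is at most $C(\log n)^2/\sqrt n$.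
   Context: $d\mu(x)=dx/(2\pi)$ is the normalized Lebesgue measure on $[-\pi,\pi]$. $\mathbb{E}$ denotes expectation with respect to the random coefficients of $P$. Note that $\sigma(r)^2=\mathbb{E}|P(re^{i\theta})|^2$, which does not depend on $\theta$, and $\sigma(1)^2=n$. *)

theory Defs
  imports "HOL-Probability.Probability"
begin

text \<open>Measurability of the \<^term>\<open>X k\<close>, \<open>k < n\<close>, is part of \<^const>\<open>prob_space.indep_vars\<close>.\<close>

definition rademacher_family :: "'a measure \<Rightarrow> nat \<Rightarrow> (nat \<Rightarrow> 'a \<Rightarrow> real) \<Rightarrow> bool" where
  "rademacher_family M n X \<longleftrightarrow>
     prob_space M \<and>
     prob_space.indep_vars M (\<lambda>_. borel) X {..<n} \<and>
     (\<forall>k<n. measure M {\<omega> \<in> space M. X k \<omega> = 1} = 1/2 \<and>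
            measure M {\<omega> \<in> space M. X k \<omega> = -1} = 1/2)"

definition littlewood_poly :: "nat \<Rightarrow> (nat \<Rightarrow> real) \<Rightarrow> complex \<Rightarrow> complex" where
  "littlewood_poly n x z = (\<Sum>k<n. of_real (x k) * z ^ k)"

definition sigma_norm :: "nat \<Rightarrow> real \<Rightarrow> real" where
  "sigma_norm n r = sqrt (\<Sum>k<n. r ^ (2 * k))"

definition normalized_poly :: "nat \<Rightarrow> (nat \<Rightarrow> real) \<Rightarrow> real \<Rightarrow> real \<Rightarrow> complex" where
  "normalized_poly n x r \<theta> =
     littlewood_poly n x (of_real r * exp (\<i> * of_real \<theta>)) / of_real (sigma_norm n r)"

definition circle_measure :: "real measure" where
  "circle_measure = uniform_measure lborel {-pi..pi}"

text \<open>
  For coefficients \<^term>\<open>x k\<close> in \<open>{1, -1}\<close> and \<open>n \<ge> 1\<close>, \<open>r > 0\<close>, the polynomial is nonzero, so it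
  has finitely many zeros on the circle of radius \<^term>\<open>r\<close> and the logarithmic singularities there
  are integrable; the convention \<open>ln 0 = 0\<close> only affects a null set of angles.
\<close>

definition log_integral :: "nat \<Rightarrow> (nat \<Rightarrow> real) \<Rightarrow> real \<Rightarrow> real" where
  "log_integral n x r = (LINT \<theta>|circle_measure. ln (cmod (normalized_poly n x r \<theta>)))"

end

theory Submission
  imports Defs "HOL-Computational_Algebra.Fundamental_Theorem_Algebra" "HOL-Real_Asymp.Real_Asymp"
begin

text \<open>
  Let \<open>S(\<theta>)\<close> be the normalised polynomial at the angle \<open>\<theta>\<close>, and let \<open>Z\<close> be a standard complex Gaussian, for
  which \<open>E log |Z| = - \<gamma> / 2\<close>. The statement holds because \<open>S(\<theta>)\<close> is close in law to \<open>Z\<close> for most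
  angles, and \<open>S(\<theta>)\<close>, \<open>S(\<phi>)\<close> are close to two independent copies of \<open>Z\<close> for most pairs of angles.
  The second moment of the integral is a double integral over such pairs.

  The logarithm enters through Frullani's formula: \<open>2 log |z|\<close> is the integral of
  \<open>(exp (- u) - exp (- u |z|\<^sup>2)) / u\<close> over \<open>u > 0\<close>. Restricting \<open>u\<close> to \<open>[a, U]\<close> with \<open>a = 1 / n\<close> and
  \<open>U = n powr (3/4)\<close> gives a bounded function of \<open>z\<close> (\<open>ln_frullani\<close> controls the loss), and its first
  two moments only involve the Laplace transforms \<open>E exp (- u |S(\<theta>)|\<^sup>2 - w |S(\<phi>)|\<^sup>2)\<close> with \<open>u, w \<le> U\<close>.
  Since \<open>exp (- |v|\<^sup>2)\<close> is the characteristic function of a Gaussian vector, such a transform is a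
  Gaussian average of a product of cosines (\<open>gaussian_linearisation\<close>). As \<open>U\<close> is much smaller than
  \<open>n\<close>, the arguments \<open>x k\<close> of the cosines are small outside an event of tiny probability, and the
  product is then close to \<open>exp (- (\<Sum>k<n. (x k)\<^sup>2) / 2)\<close>. The quadratic form in the exponent is
  diagonal up to the sums \<open>\<Sum>k<n. (c k)\<^sup>2 cis (k t)\<close> at \<open>t = 2 \<theta>, 2 \<phi>, \<theta> + \<phi>, \<theta> - \<phi>\<close>, where \<open>c k\<close> is the
  modulus of the \<open>k\<close>-th normalised coefficient. By Parseval these sums have mean square \<open>O(1/n)\<close>, so
  after integration over the angles the transform is \<open>1 / ((1 + u) (1 + w)) + O(1 / sqrt n)\<close>
  (\<open>laplace_mean_pair\<close>). Integrating \<open>du dw / (u w)\<close> over \<open>[a, U]\<^sup>2\<close> costs the factor \<open>(log n)\<^sup>2\<close>, and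
  the main term tends to \<open>- \<gamma> / 2\<close> or its square (\<open>gauss_frullani_limit\<close>).

  What remains is the loss in the truncation, that is, the mean of \<open>exp (- U |S|\<^sup>2) (log |S|)\<^sup>2\<close> near the
  zeros of \<open>S\<close>. Where \<open>|S|\<close> is at least \<open>exp (- C (log n)\<^sup>2)\<close> the logarithm costs only a power of
  \<open>log n\<close>, and the Laplace transform at \<open>U\<close> is \<open>O(1 / U)\<close>. Smaller values are rare: if two sign vectors
  that differ only in the first \<open>m\<close> signs both make the polynomial tiny at \<open>z\<close>, then so is a nonzero
  polynomial of degree less than \<open>m\<close> with coefficients in \<open>{-1, 0, 1}\<close> (\<open>anticoncentration\<close>), and
  there are few such polynomials, each tiny only very close to one of its roots
  (\<open>circle_poly_small\<close>). With \<open>m\<close> about \<open>12 log n\<close> this beats the moments of the logarithm, which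
  are at most polynomial in \<open>n\<close>.
\<close>

section \<open>Averages over sign vectors\<close>

definition signs :: "nat \<Rightarrow> (nat \<Rightarrow> real) set" where
  "signs n = PiE {..<n} (\<lambda>_. {1, -1})"

definition sign_mean :: "nat \<Rightarrow> ((nat \<Rightarrow> real) \<Rightarrow> real) \<Rightarrow> real" where
  "sign_mean n F = (\<Sum>x\<in>signs n. F x) / 2 ^ n"

lemma finite_signs [simp]: "finite (signs n)"
  unfolding signs_def by (intro finite_PiE) auto

lemma card_signs: "card (signs n) = 2 ^ n"
  unfolding signs_def by (subst card_PiE) (auto simp: numeral_2_eq_2)

lemma signs_values: "x \<in> signs n \<Longrightarrow> k < n \<Longrightarrow> x k = 1 \<or> x k = -1"
  unfolding signs_def by (auto dest: PiE_mem)

lemma signs_square [simp]: "x \<in> signs n \<Longrightarrow> k < n \<Longrightarrow> (x k)\<^sup>2 = 1"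
  using signs_values[of x n k] by auto

lemma sign_mean_const [simp]: "sign_mean n (\<lambda>_. c) = c"
  by (simp add: sign_mean_def card_signs)

lemma sign_mean_add: "sign_mean n (\<lambda>x. F x + G x) = sign_mean n F + sign_mean n G"
  by (simp add: sign_mean_def sum.distrib add_divide_distrib)

lemma sign_mean_diff: "sign_mean n (\<lambda>x. F x - G x) = sign_mean n F - sign_mean n G"
  by (simp add: sign_mean_def sum_subtractf diff_divide_distrib)

lemma sign_mean_cmult: "sign_mean n (\<lambda>x. c * F x) = c * sign_mean n F"
  by (simp add: sign_mean_def sum_distrib_left)

lemma sign_mean_cong: "(\<And>x. x \<in> signs n \<Longrightarrow> F x = G x) \<Longrightarrow> sign_mean n F = sign_mean n G"
  by (simp add: sign_mean_def)

lemma sign_mean_mono: "(\<And>x. x \<in> signs n \<Longrightarrow> F x \<le> G x) \<Longrightarrow> sign_mean n F \<le> sign_mean n G"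
  by (simp add: sign_mean_def divide_right_mono sum_mono)

lemma sign_mean_abs_le: "\<bar>sign_mean n F\<bar> \<le> sign_mean n (\<lambda>x. \<bar>F x\<bar>)"
  by (simp add: sign_mean_def divide_right_mono)

lemma integrable_sign_mean:
  "(\<And>x. x \<in> signs n \<Longrightarrow> integrable M (\<lambda>t. F x t)) \<Longrightarrow> integrable M (\<lambda>t. sign_mean n (\<lambda>x. F x t))"
  unfolding sign_mean_def by (intro Bochner_Integration.integrable_divide_zero Bochner_Integration.integrable_sum) auto

lemma integral_sign_mean:
  assumes "\<And>x. x \<in> signs n \<Longrightarrow> integrable M (\<lambda>t. F x t)"
  shows "(\<integral>t. sign_mean n (\<lambda>x. F x t) \<partial>M) = sign_mean n (\<lambda>x. \<integral>t. F x t \<partial>M)"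
  unfolding sign_mean_def using assms by (simp add: Bochner_Integration.integral_sum)

lemma sum_signs_prod_cis:
  "(\<Sum>x\<in>signs n. \<Prod>k<n. cis (x k * t k)) = 2 ^ n * of_real (\<Prod>k<n. cos (t k))"
proof -
  have "(\<Sum>x\<in>signs n. \<Prod>k<n. cis (x k * t k)) = (\<Prod>k<n. \<Sum>y\<in>{1,-1}. cis (y * t k))"
    unfolding signs_def by (rule prod_sum_PiE[symmetric]) auto
  also have "\<dots> = (\<Prod>k<n. 2 * of_real (cos (t k)))"
    by (intro prod.cong) (simp_all add: complex_eq_iff)
  finally show ?thesis by (simp add: prod.distrib)
qed

text \<open>
  The events \<open>X k = x k for all k < n\<close>, with \<open>x\<close> a sign vector, are disjoint and have probability
  \<open>2 ^ (- n)\<close> each, so they exhaust \<open>M\<close> up to a null set. From here on only finite averages occur.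
  Measurability has to be assumed because \<open>F\<close> is arbitrary off the sign vectors.
\<close>
lemma rademacher_expectation:
  fixes X :: "nat \<Rightarrow> 'a \<Rightarrow> real"
  assumes rad: "rademacher_family M n X" and n: "n > 0"
    and F: "\<And>x y. (\<And>k. k < n \<Longrightarrow> x k = y k) \<Longrightarrow> F x = F y"
    and meas: "(\<lambda>\<omega>. F (\<lambda>k. X k \<omega>)) \<in> borel_measurable M"
  shows "(LINT \<omega>|M. F (\<lambda>k. X k \<omega>)) = sign_mean n F"
proof -
  from rad interpret prob_space M by (simp add: rademacher_family_def)
  have indep: "indep_vars (\<lambda>_. borel) X {..<n}"
    and p: "\<And>k. k < n \<Longrightarrow> prob {\<omega> \<in> space M. X k \<omega> = 1} = 1/2"
           "\<And>k. k < n \<Longrightarrow> prob {\<omega> \<in> space M. X k \<omega> = -1} = 1/2"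
    using rad by (auto simp: rademacher_family_def)
  have [measurable]: "X k \<in> borel_measurable M" if "k < n" for k
    using indep that by (auto simp: indep_vars_def)
  define E where "E x = (\<Inter>k\<in>{..<n}. X k -` {x k} \<inter> space M)" for x
  have E_sets [measurable]: "E x \<in> sets M" for x
    unfolding E_def using n by (intro sets.finite_INT) auto
  have prob_E: "prob (E x) = 1 / 2 ^ n" if "x \<in> signs n" for x
  proof -
    have "prob (E x) = (\<Prod>k\<in>{..<n}. prob (X k -` {x k} \<inter> space M))"
      unfolding E_def using n by (intro indep_varsD_finite[OF indep]) auto
    also have "\<dots> = (\<Prod>k\<in>{..<n}. 1/2)"
    proof (rule prod.cong)
      fix k assume "k \<in> {..<n}"
      then have k: "k < n" by simp
      have "X k -` {x k} \<inter> space M = {\<omega> \<in> space M. X k \<omega> = x k}" by auto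
      then show "prob (X k -` {x k} \<inter> space M) = 1/2"
        using p[OF k] signs_values[OF that k] by auto
    qed simp
    finally show ?thesis by (simp add: power_one_over)
  qed
  have in_E: "\<omega> \<in> E x \<longleftrightarrow> \<omega> \<in> space M \<and> (\<forall>k<n. X k \<omega> = x k)" for \<omega> x
    unfolding E_def using n by auto
  have E_disj: "x = y" if "x \<in> signs n" "y \<in> signs n" "\<omega> \<in> E x" "\<omega> \<in> E y" for x y \<omega>
    using that unfolding in_E signs_def
    by (intro PiE_ext[of x "{..<n}" "\<lambda>_. {1,-1}"]) auto
  have "prob (\<Union>x\<in>signs n. E x) = (\<Sum>x\<in>signs n. prob (E x))"
    by (intro finite_measure_finite_Union) (auto simp: disjoint_family_on_def dest: E_disj)
  also have "\<dots> = 1" by (simp add: prob_E card_signs)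
  finally have AE: "AE \<omega> in M. \<omega> \<in> (\<Union>x\<in>signs n. E x)"
    by (subst AE_in_set_eq_1) auto
  have "(LINT \<omega>|M. F (\<lambda>k. X k \<omega>)) = (LINT \<omega>|M. (\<Sum>x\<in>signs n. F x * indicator (E x) \<omega>))"
  proof (rule integral_cong_AE)
    show "AE \<omega> in M. F (\<lambda>k. X k \<omega>) = (\<Sum>x\<in>signs n. F x * indicator (E x) \<omega>)"
      using AE
    proof eventually_elim
      case (elim \<omega>)
      then obtain x where x: "x \<in> signs n" "\<omega> \<in> E x" by auto
      have "(\<Sum>y\<in>signs n. F y * indicator (E y) \<omega>) = (\<Sum>y\<in>signs n. if y = x then F x else 0)"
        using x E_disj by (intro sum.cong) (auto simp: indicator_def)
      also have "\<dots> = F x" using x by simp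
      also have "F x = F (\<lambda>k. X k \<omega>)"
        using x by (intro F) (auto simp: in_E)
      finally show ?case by simp
    qed
    show "(\<lambda>\<omega>. \<Sum>x\<in>signs n. F x * indicator (E x) \<omega>) \<in> borel_measurable M"
      by (intro borel_measurable_sum borel_measurable_times borel_measurable_const borel_measurable_indicator E_sets)
  qed (rule meas)
  also have "\<dots> = (\<Sum>x\<in>signs n. F x * prob (E x))"
    by (subst Bochner_Integration.integral_sum) (auto simp: emeasure_finite less_top[symmetric] intro!: integrable_mult_right)
  also have "\<dots> = sign_mean n F"
    by (simp add: prob_E sign_mean_def sum_divide_distrib)
  finally show ?thesis .
qed

section \<open>Gaussian linearisation of Laplace transforms\<close>

lemma gaussian_exp_square:
  assumes l: "l > (-1::real)"
  shows "integrable std_normal_distribution (\<lambda>v. exp (- (l * v\<^sup>2 / 2)))" (is ?A)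
    and "(\<integral>v. exp (- (l * v\<^sup>2 / 2)) \<partial>std_normal_distribution) = 1 / sqrt (1 + l)" (is ?B)
proof -
  define s where "s = 1 / sqrt (1 + l)"
  have s: "s > 0" "s\<^sup>2 = 1 / (1 + l)" using l by (auto simp: s_def power_divide)
  have eq: "std_normal_density v * exp (- (l * v\<^sup>2 / 2)) = s * normal_density 0 s v" for v
  proof -
    have "- v\<^sup>2 / 2 + - (l * v\<^sup>2 / 2) = - v\<^sup>2 / (2 * s\<^sup>2)"
      using l by (simp add: s field_simps)
    then have "exp (- v\<^sup>2 / 2) * exp (- (l * v\<^sup>2 / 2)) = exp (- v\<^sup>2 / (2 * s\<^sup>2))"
      by (simp flip: exp_add)
    moreover have "s * (1 / sqrt (2 * pi * s\<^sup>2)) = 1 / sqrt (2 * pi)"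
      using s(1) by (simp add: real_sqrt_mult)
    ultimately show ?thesis
      unfolding normal_density_def by (simp add: field_simps)
  qed
  have 1: "integrable lborel (\<lambda>v. std_normal_density v * exp (- (l * v\<^sup>2 / 2)))"
    unfolding eq using s by (intro integrable_mult_right) auto
  then show ?A by (subst integrable_density) (auto simp: normal_density_nonneg)
  have "(\<integral>v. exp (- (l * v\<^sup>2 / 2)) \<partial>std_normal_distribution) = (\<integral>v. s * normal_density 0 s v \<partial>lborel)"
    by (subst integral_density) (auto simp: normal_density_nonneg eq)
  also have "\<dots> = s" using s by simp
  finally show ?B by (simp add: s_def)
qed

abbreviation gauss :: "nat \<Rightarrow> (nat \<Rightarrow> real) measure" where
  "gauss d \<equiv> Pi\<^sub>M {..<d} (\<lambda>_. std_normal_distribution)"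

interpretation std_normal_prob: prob_space std_normal_distribution
  by (intro prob_space_normal_density) simp

interpretation std_normal: product_sigma_finite "\<lambda>_::nat. std_normal_distribution"
  by unfold_locales

interpretation gauss: prob_space "gauss d" for d
  by (intro prob_space_PiM) (rule std_normal_prob.prob_space_axioms)

text \<open>
  The case \<open>l j = - 1 / 2\<close> is used below as an exponential moment for tail bounds, which is why
  negative values are admitted.
\<close>
lemma gauss_exp_quadratic:
  assumes l: "\<And>j. j < d \<Longrightarrow> l j > (-1::real)"
  shows "integrable (gauss d) (\<lambda>v. exp (- (\<Sum>j<d. l j * (v j)\<^sup>2) / 2))" (is ?A)
    and "(\<integral>v. exp (- (\<Sum>j<d. l j * (v j)\<^sup>2) / 2) \<partial>gauss d) = (\<Prod>j<d. 1 / sqrt (1 + l j))" (is ?B)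
proof -
  have eq: "exp (- (\<Sum>j<d. l j * (v j)\<^sup>2) / 2) = (\<Prod>j<d. exp (- (l j * (v j)\<^sup>2 / 2)))" for v :: "nat \<Rightarrow> real"
    by (simp add: sum_negf sum_divide_distrib flip: exp_sum)
  show ?A unfolding eq using l
    by (intro std_normal.product_integrable_prod gaussian_exp_square) auto
  show ?B unfolding eq using l
    by (subst std_normal.product_integral_prod) (auto intro!: gaussian_exp_square prod.cong)
qed

lemma gauss_char:
  "(\<integral>v. cis (\<Sum>j<d. y j * v j) \<partial>gauss d) = of_real (exp (- (\<Sum>j<d. (y j)\<^sup>2) / 2))"
proof -
  have int: "integrable std_normal_distribution (\<lambda>v. cis (s * v))" for s
    by (rule std_normal_prob.integrable_const_bound[where B=1]) (auto intro!: borel_measurable_continuous_onI continuous_intros)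
  have "(\<integral>v. cis (\<Sum>j<d. y j * v j) \<partial>gauss d) = (\<integral>v. (\<Prod>j<d. cis (y j * v j)) \<partial>gauss d)"
    by (simp add: cis_conv_exp sum_distrib_left exp_sum)
  also have "\<dots> = (\<Prod>j<d. \<integral>v. cis (y j * v) \<partial>std_normal_distribution)"
    by (rule std_normal.product_integral_prod) (auto intro: int)
  also have "\<dots> = (\<Prod>j<d. of_real (exp (- ((y j)\<^sup>2) / 2)))"
  proof (rule prod.cong)
    fix j
    have "char std_normal_distribution (y j) = of_real (exp (- ((y j)\<^sup>2) / 2))"
      using char_std_normal_distribution by (rule fun_cong)
    then show "(\<integral>v. cis (y j * v) \<partial>std_normal_distribution) = of_real (exp (- ((y j)\<^sup>2) / 2))"
      by (simp add: char_def cis_conv_exp)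
  qed simp
  also have "\<dots> = of_real (\<Prod>j<d. exp (- ((y j)\<^sup>2) / 2))"
    by simp
  also have "(\<Prod>j<d. exp (- ((y j)\<^sup>2) / 2)) = exp (- (\<Sum>j<d. (y j)\<^sup>2) / 2)"
    by (simp add: sum_negf sum_divide_distrib flip: exp_sum)
  finally show ?thesis .
qed

lemma cos_prod_measurable [measurable]:
  "(\<lambda>v. \<Prod>k<n. cos (sqrt 2 * (\<Sum>j<d. v j * A k j))) \<in> borel_measurable (gauss d)"
  by (intro borel_measurable_prod measurable_compose[OF _ borel_measurable_continuous_onI[of cos]] continuous_intros
       borel_measurable_times borel_measurable_sum borel_measurable_const) 
     (auto intro!: measurable_component_singleton[where M="\<lambda>_. std_normal_distribution", simplified])

lemma cos_prod_bound: "\<bar>\<Prod>k<(n::nat). cos (t k)\<bar> \<le> (1::real)"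
  unfolding abs_prod by (intro prod_le_1) auto

text \<open>
  For a sign vector \<open>x\<close> the exponential is the characteristic function of the Gaussian vector \<open>v\<close> at
  \<open>sqrt 2\<close> times the vector \<open>\<Sum>k<n. x k * A k j\<close>. Once \<open>v\<close> is fixed the exponent is linear in \<open>x\<close>, so the
  average over the signs factorises into cosines.
\<close>
lemma gaussian_linearisation:
  "sign_mean n (\<lambda>x. exp (- (\<Sum>j<d. (\<Sum>k<n. x k * A k j)\<^sup>2))) =
   (\<integral>v. (\<Prod>k<n. cos (sqrt 2 * (\<Sum>j<d. v j * A k j))) \<partial>gauss d)"
proof -
  define y where "y x j = sqrt 2 * (\<Sum>k<n. x k * A k j)" for x :: "nat \<Rightarrow> real" and j
  define t where "t v k = sqrt 2 * (\<Sum>j<d. v j * A k j)" for v :: "nat \<Rightarrow> real" and k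
  have [measurable]: "(\<lambda>v. \<Sum>j<d. y x j * v j) \<in> borel_measurable (gauss d)" for x
    by (intro borel_measurable_sum borel_measurable_times borel_measurable_const)
       (auto intro!: measurable_component_singleton[where M="\<lambda>_. std_normal_distribution", simplified])
  have int: "integrable (gauss d) (\<lambda>v. cis (\<Sum>j<d. y x j * v j))" for x
    by (rule gauss.integrable_const_bound[where B=1])
       (auto intro!: measurable_compose[OF _ borel_measurable_continuous_onI[of cis]] continuous_intros)
  have sw: "(\<Sum>j<d. y x j * v j) = (\<Sum>k<n. x k * t v k)" for x v
    unfolding y_def t_def sum_distrib_left sum_distrib_right
    by (subst sum.swap) (simp add: mult_ac)
  have "complex_of_real (\<Sum>x\<in>signs n. exp (- (\<Sum>j<d. (\<Sum>k<n. x k * A k j)\<^sup>2)))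
        = (\<Sum>x\<in>signs n. \<integral>v. cis (\<Sum>j<d. y x j * v j) \<partial>gauss d)"
    unfolding of_real_sum gauss_char
    by (intro sum.cong refl arg_cong[where f=of_real] arg_cong[where f=exp])
       (simp add: y_def power_mult_distrib sum_distrib_left[symmetric])
  also have "\<dots> = (\<integral>v. (\<Sum>x\<in>signs n. cis (\<Sum>j<d. y x j * v j)) \<partial>gauss d)"
    by (rule Bochner_Integration.integral_sum[symmetric]) (rule int)
  also have "\<dots> = (\<integral>v. (\<Sum>x\<in>signs n. \<Prod>k<n. cis (x k * t v k)) \<partial>gauss d)"
    unfolding sw by (simp add: cis_conv_exp sum_distrib_left exp_sum)
  also have "\<dots> = (\<integral>v. 2 ^ n * of_real (\<Prod>k<n. cos (t v k)) \<partial>gauss d)"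
    by (simp only: sum_signs_prod_cis)
  also have "\<dots> = 2 ^ n * of_real (\<integral>v. (\<Prod>k<n. cos (t v k)) \<partial>gauss d)"
    by (simp del: of_real_prod)
  also have "\<dots> = of_real (2 ^ n * (\<integral>v. (\<Prod>k<n. cos (t v k)) \<partial>gauss d))" by simp
  finally have "(\<Sum>x\<in>signs n. exp (- (\<Sum>j<d. (\<Sum>k<n. x k * A k j)\<^sup>2))) = 2 ^ n * (\<integral>v. (\<Prod>k<n. cos (t v k)) \<partial>gauss d)"
    unfolding of_real_eq_iff .
  then show ?thesis
    unfolding sign_mean_def t_def by simp
qed

lemma cos_le_gauss:
  assumes "\<bar>x\<bar> \<le> (1::real)"
  shows "cos x \<le> exp (- (x\<^sup>2 / 2))"
proof -
  have *: "cos x \<le> exp (- (x\<^sup>2 / 2))" if "0 \<le> x" "x \<le> 1" for x :: real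
  proof -
    have pi: "1 < pi / 2" using pi_gt3 by simp
    have "- ln (cos 0) - 0\<^sup>2 / 2 \<le> - ln (cos x) - x\<^sup>2 / 2"
    proof (rule DERIV_nonneg_imp_nondecreasing[OF that(1)])
      fix y :: real assume y: "0 \<le> y" "y \<le> x"
      then have c: "cos y > 0" using that pi by (intro cos_gt_zero_pi) auto
      have "\<bar>y\<bar> \<le> \<bar>tan y\<bar>" using y that pi by (intro abs_tan_ge) auto
      moreover have "0 \<le> tan y" using y that pi by (intro tan_pos_pi2_le) auto
      ultimately have "0 \<le> sin y / cos y - y" using y by (simp add: tan_def)
      moreover have "((\<lambda>x. - ln (cos x) - x\<^sup>2 / 2) has_real_derivative sin y / cos y - y) (at y)"
        using c by (auto intro!: derivative_eq_intros simp: field_simps power2_eq_square)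
      ultimately show "\<exists>z. ((\<lambda>x. - ln (cos x) - x\<^sup>2 / 2) has_real_derivative z) (at y) \<and> 0 \<le> z"
        by blast
    qed
    then have "ln (cos x) \<le> - (x\<^sup>2 / 2)" by simp
    moreover have "cos x > 0" using that pi by (intro cos_gt_zero_pi) auto
    ultimately show ?thesis by (metis exp_le_cancel_iff exp_ln)
  qed
  show ?thesis using *[of "\<bar>x\<bar>"] assms by simp
qed

text \<open>
  Together with \<open>cos_le_gauss\<close> this pins the logarithm of the cosine to \<open>- x\<^sup>2 / 2\<close> up to \<open>O(x ^ 4)\<close>.
\<close>
lemma cos_ge_gauss:
  assumes "\<bar>x\<bar> \<le> (1::real)"
  shows "exp (- (x\<^sup>2 / 2 + x ^ 4 / 2)) \<le> cos x"
proof -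
  define y where "y = x\<^sup>2 / 2"
  have "x\<^sup>2 \<le> 1" using assms by (simp add: abs_square_le_1)
  then have y: "0 \<le> y" "y \<le> 1/2" by (auto simp: y_def)
  have "exp (- (x\<^sup>2 / 2 + x ^ 4 / 2)) = exp (- y - 2 * y\<^sup>2)"
    by (simp add: y_def power2_eq_square power4_eq_xxxx field_simps)
  also have "\<dots> \<le> exp (ln (1 - y))"
    using ln_one_minus_pos_lower_bound[OF y] by simp
  also have "\<dots> = 1 - x\<^sup>2 / 2" using y by (simp add: y_def)
  also have "\<dots> \<le> cos x" 
  proof -
    have "(sin (x / 2))\<^sup>2 \<le> (x / 2)\<^sup>2"
      using abs_sin_x_le_abs_x[of "x / 2"] by (rule abs_le_square_iff[THEN iffD1])
    then show ?thesis using cos_double_sin[of "x / 2"] by (simp add: power_divide)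
  qed
  finally show ?thesis .
qed

lemma exp_diff_le: "\<bar>exp (- a) - exp (- b)\<bar> \<le> \<bar>a - b\<bar> * exp (- min a (b::real))"
proof -
  have *: "exp (- a) - exp (- b) \<le> (b - a) * exp (- a)" if "a \<le> b" for a b :: real
  proof -
    have "1 - exp (- (b - a)) \<le> b - a" using exp_ge_add_one_self[of "- (b - a)"] by linarith
    then have "exp (- a) * (1 - exp (- (b - a))) \<le> exp (- a) * (b - a)" by (intro mult_left_mono) auto
    moreover have "exp (- a) * exp (- (b - a)) = exp (- b)" by (simp flip: exp_add)
    ultimately show ?thesis by (simp add: algebra_simps)
  qed
  show ?thesis using *[of a b] *[of b a] by (cases "a \<le> b") auto
qed

text \<open>
  The product equals \<open>exp (- p)\<close> with \<open>p - q\<close> of order \<open>\<kappa> q + \<beta> q\<^sup>2\<close>, where \<open>\<kappa>\<close> measures the defect of the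
  quadratic term and \<open>\<beta>\<close> the size of the quartic one. Since \<open>p\<close> and \<open>q\<close> are both at least \<open>q / 2\<close>, the
  factor \<open>exp (- q / 2)\<close> absorbs the powers of \<open>q\<close> and the error is uniform in \<open>q\<close>.
\<close>
lemma prod_cos_close:
  fixes x :: "nat \<Rightarrow> real"
  assumes small: "\<And>k. k < n \<Longrightarrow> (x k)\<^sup>2 \<le> \<beta> * q" "\<beta> * q \<le> 1"
    and quad: "\<bar>(\<Sum>k<n. (x k)\<^sup>2 / 2) - q\<bar> \<le> \<kappa> * q" "\<kappa> \<le> 1/2" and nn: "0 \<le> q" "0 \<le> \<beta>" "0 \<le> \<kappa>"
  shows "\<bar>(\<Prod>k<n. cos (x k)) - exp (- q)\<bar> \<le> \<kappa> + 5 * \<beta>"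
    and "(\<Prod>k<n. cos (x k)) \<le> exp (- (q / 2))"
proof -
  define s where "s = (\<Sum>k<n. (x k)\<^sup>2 / 2)"
  define t where "t = (\<Sum>k<n. (x k) ^ 4 / 2)"
  have x1: "\<bar>x k\<bar> \<le> 1" if "k < n" for k
    using small(1)[OF that] small(2) by (simp flip: abs_square_le_1)
  have up: "(\<Prod>k<n. cos (x k)) \<le> exp (- s)"
  proof -
    have "(\<Prod>k<n. cos (x k)) \<le> (\<Prod>k<n. exp (- ((x k)\<^sup>2 / 2)))"
      using x1 by (intro prod_mono conjI cos_le_gauss) (auto intro: order_trans[OF _ cos_ge_gauss])
    then show ?thesis by (simp add: s_def sum_negf flip: exp_sum)
  qed
  have low: "exp (- (s + t)) \<le> (\<Prod>k<n. cos (x k))"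
  proof -
    have "(\<Prod>k<n. exp (- ((x k)\<^sup>2 / 2 + (x k) ^ 4 / 2))) \<le> (\<Prod>k<n. cos (x k))"
      using x1 by (intro prod_mono conjI cos_ge_gauss) auto
    then show ?thesis by (simp add: s_def t_def sum.distrib sum_negf sum_subtractf flip: exp_sum)
  qed
  have kq: "\<kappa> * q \<le> q / 2" using mult_right_mono[OF quad(2) nn(1)] by simp
  have s: "q / 2 \<le> s" "s \<le> 3 / 2 * q" "\<bar>s - q\<bar> \<le> \<kappa> * q"
    using quad(1) kq unfolding s_def[symmetric] by (auto simp: abs_le_iff)
  have t: "0 \<le> t" "t \<le> 3 / 2 * \<beta> * q\<^sup>2"
  proof -
    show "0 \<le> t" by (auto simp: t_def intro!: sum_nonneg)
    have "t \<le> (\<Sum>k<n. (\<beta> * q) * ((x k)\<^sup>2 / 2))"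
      unfolding t_def
    proof (rule sum_mono)
      fix k assume "k \<in> {..<n}"
      then have "(x k)\<^sup>2 * (x k)\<^sup>2 \<le> \<beta> * q * (x k)\<^sup>2" using small(1) by (intro mult_right_mono) auto
      then show "x k ^ 4 / 2 \<le> \<beta> * q * ((x k)\<^sup>2 / 2)"
        by (simp add: power4_eq_xxxx power2_eq_square mult_ac)
    qed
    also have "\<dots> = \<beta> * q * s" by (simp add: s_def sum_distrib_left)
    also have "\<dots> \<le> \<beta> * q * (3 / 2 * q)" using s nn by (intro mult_left_mono) auto
    finally show "t \<le> 3 / 2 * \<beta> * q\<^sup>2" by (simp add: power2_eq_square)
  qed
  show "(\<Prod>k<n. cos (x k)) \<le> exp (- (q / 2))"
    using up s(1) by (meson exp_le_cancel_iff le_imp_neg_le order_trans)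
  define p where "p = - ln (\<Prod>k<n. cos (x k))"
  have pos: "(\<Prod>k<n. cos (x k)) > 0" using low by (meson exp_gt_zero less_le_trans)
  have P: "(\<Prod>k<n. cos (x k)) = exp (- p)" using pos by (simp add: p_def)
  have p: "s \<le> p" "p \<le> s + t" using up low unfolding P by auto
  have pq: "\<bar>p - q\<bar> \<le> \<kappa> * q + 3 / 2 * \<beta> * q\<^sup>2" using p s t by (auto simp: abs_le_iff)
  have "\<bar>exp (- p) - exp (- q)\<bar> \<le> \<bar>p - q\<bar> * exp (- min p q)" by (rule exp_diff_le)
  also have "\<dots> \<le> (\<kappa> * q + 3 / 2 * \<beta> * q\<^sup>2) * exp (- (q / 2))"
    using pq p s nn by (intro mult_mono) auto
  also have "\<dots> = \<kappa> * (q * exp (- (q / 2))) + 3 / 2 * \<beta> * (q\<^sup>2 * exp (- (q / 2)))"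
    by (simp add: algebra_simps)
  also have "\<dots> \<le> \<kappa> * 1 + 3 / 2 * \<beta> * (10/3)"
  proof (intro add_mono mult_left_mono)
    \<comment> \<open>The maxima of \<open>q exp (- q / 2)\<close> and \<open>q\<^sup>2 exp (- q / 2)\<close> are bounded via the quadratic Taylor polynomial of exp.\<close>
    have "q \<le> 1 + q / 2 + (q / 2)\<^sup>2 / 2"
      using zero_le_power2[of "q - 2"] by (simp add: power2_eq_square field_simps)
    also have "\<dots> \<le> exp (q / 2)" using nn by (intro exp_lower_Taylor_quadratic) auto
    finally show "q * exp (- (q / 2)) \<le> 1" by (simp add: exp_minus field_simps)
    have "q \<le> 9/5 * (1 + q / 4 + (q / 4)\<^sup>2 / 2)"
      using zero_le_power2[of "q - 44/9"] by (simp add: power2_eq_square field_simps)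
    also have "\<dots> \<le> 9/5 * exp (q / 4)" using nn by (intro mult_left_mono exp_lower_Taylor_quadratic) auto
    finally have "q\<^sup>2 \<le> (9/5 * exp (q / 4))\<^sup>2" using nn by (intro power_mono) auto
    also have "\<dots> = 81 / 25 * exp (q / 2)"
      by (simp add: power2_eq_square flip: exp_add)
    also have "\<dots> \<le> 10 / 3 * exp (q / 2)" by simp
    finally show "q\<^sup>2 * exp (- (q / 2)) \<le> 10/3" by (simp add: exp_minus field_simps)
  qed (use nn in auto)
  finally show "\<bar>(\<Prod>k<n. cos (x k)) - exp (- q)\<bar> \<le> \<kappa> + 5 * \<beta>" unfolding P by simp
qed


text \<open>
  Linearise and compare the product of cosines with \<open>exp (- q v)\<close>, whose Gaussian mean is the product
  of the factors \<open>1 / sqrt (1 + lam j)\<close>. The comparison needs \<open>\<beta> * q v \<le> 1\<close>; the complementary event has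
  probability at most \<open>2 ^ d * exp (- 1 / (2 \<beta> U))\<close> by an exponential Chebyshev bound, because
  \<open>q v / (2 U)\<close> is at most \<open>|v|\<^sup>2 / 4\<close>. The one-sided second estimate does not lose a term linear in \<open>\<kappa>\<close>.
\<close>
lemma gaussian_comparison:
  fixes A :: "nat \<Rightarrow> nat \<Rightarrow> real" and lam :: "nat \<Rightarrow> real" and \<kappa> \<beta> U :: real and n d :: nat
  defines "L \<equiv> \<lambda>v k. \<Sum>j<d. v j * A k j" and "q \<equiv> \<lambda>v. (\<Sum>j<d. lam j * (v j)\<^sup>2) / 2"
  defines "m \<equiv> sign_mean n (\<lambda>x. exp (- (\<Sum>j<d. (\<Sum>k<n. x k * A k j)\<^sup>2)))"
  assumes lam: "\<And>j. j < d \<Longrightarrow> 0 \<le> lam j" "\<And>j. j < d \<Longrightarrow> lam j \<le> U" and U: "U > 0"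
    and quad: "\<And>v. \<bar>(\<Sum>k<n. (L v k)\<^sup>2) - q v\<bar> \<le> \<kappa> * q v"
    and small: "\<And>v k. k < n \<Longrightarrow> 2 * (L v k)\<^sup>2 \<le> \<beta> * q v"
    and nn: "0 \<le> \<kappa>" "0 < \<beta>"
  shows "\<bar>m - (\<Prod>j<d. 1 / sqrt (1 + lam j))\<bar> \<le> 2 * \<kappa> + 5 * \<beta> + 2 * 2 ^ d * exp (- (1 / (2 * \<beta> * U)))" (is ?A)
    and "\<kappa> \<le> 1/2 \<Longrightarrow> m \<le> (\<Prod>j<d. 1 / sqrt (1 + lam j / 2)) + 2 ^ d * exp (- (1 / (2 * \<beta> * U)))" (is "_ \<Longrightarrow> ?B")
proof -
  define P where "P v = (\<Prod>k<n. cos (sqrt 2 * L v k))" for v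
  define T where "T = exp (- (1 / (2 * \<beta> * U)))"
  \<comment> \<open>\<open>H v\<close> is \<open>exp (|v|\<^sup>2 / 4)\<close>, written in the form of \<open>gauss_exp_quadratic\<close>.\<close>
  define H where "H v = exp (- (\<Sum>j<d. (-1/2) * (v j)\<^sup>2) / 2)" for v :: "nat \<Rightarrow> real"
  have T0: "T > 0" by (simp add: T_def)
  have H0: "H v > 0" for v by (simp add: H_def)
  have q0: "0 \<le> q v" for v unfolding q_def using lam by (intro divide_nonneg_nonneg sum_nonneg mult_nonneg_nonneg) auto
  have P1: "\<bar>P v\<bar> \<le> 1" for v unfolding P_def by (rule cos_prod_bound)
  have m: "m = (\<integral>v. P v \<partial>gauss d)" unfolding m_def P_def L_def by (rule gaussian_linearisation)
  have [measurable]: "P \<in> borel_measurable (gauss d)" unfolding P_def L_def by (rule cos_prod_measurable)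
  have intP: "integrable (gauss d) P"
    by (rule gauss.integrable_const_bound[where B=1]) (use P1 in auto)
  have intq: "integrable (gauss d) (\<lambda>v. exp (- q v))"
    and valq: "(\<integral>v. exp (- q v) \<partial>gauss d) = (\<Prod>j<d. 1 / sqrt (1 + lam j))"
    using gauss_exp_quadratic[of d lam] lam by (force simp: q_def)+
  have intq2: "integrable (gauss d) (\<lambda>v. exp (- (q v / 2)))"
    and valq2: "(\<integral>v. exp (- (q v / 2)) \<partial>gauss d) = (\<Prod>j<d. 1 / sqrt (1 + lam j / 2))"
    using gauss_exp_quadratic[of d "\<lambda>j. lam j / 2"] lam by (force simp: q_def sum_divide_distrib)+
  have intH: "integrable (gauss d) H" and valH: "(\<integral>v. H v \<partial>gauss d) \<le> 2 ^ d"
  proof -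
    show "integrable (gauss d) H" unfolding H_def by (intro gauss_exp_quadratic) auto
    have "(\<integral>v. H v \<partial>gauss d) = (\<Prod>j<d. 1 / sqrt (1 + -1/2))" unfolding H_def
      by (subst gauss_exp_quadratic) auto
    also have "\<dots> = sqrt 2 ^ d" by (simp add: real_sqrt_divide)
    also have "\<dots> \<le> 2 ^ d" by (intro power_mono) (auto simp: sqrt2_less_2 less_imp_le)
    finally show "(\<integral>v. H v \<partial>gauss d) \<le> 2 ^ d" .
  qed
  \<comment> \<open>Pointwise form of the exponential Chebyshev bound: \<open>T * H\<close> dominates the indicator of the bad event.\<close>
  have far: "1 \<le> T * H v" if "\<not> \<beta> * q v \<le> 1" for v
  proof -
    have "q v \<le> (\<Sum>j<d. U * (v j)\<^sup>2) / 2"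
      unfolding q_def using lam by (intro divide_right_mono sum_mono mult_right_mono) auto
    then have "q v / (2 * U) \<le> (\<Sum>j<d. (v j)\<^sup>2) / 4"
      using U by (simp add: sum_distrib_left[symmetric] field_simps)
    moreover have "1 / (2 * \<beta> * U) \<le> q v / (2 * U)"
      using that U nn by (simp add: field_simps)
    ultimately have "0 \<le> - (1 / (2 * \<beta> * U)) + - (\<Sum>j<d. (-1/2) * (v j)\<^sup>2) / 2"
      unfolding sum_distrib_left[symmetric] by linarith
    then have "1 \<le> exp (- (1 / (2 * \<beta> * U)) + - (\<Sum>j<d. (-1/2) * (v j)\<^sup>2) / 2)"
      using one_le_exp_iff by blast
    then show ?thesis by (simp only: T_def H_def exp_add)
  qed
  have near: "\<bar>P v - exp (- q v)\<bar> \<le> \<kappa> + 5 * \<beta>" "P v \<le> exp (- (q v / 2))" if "\<beta> * q v \<le> 1" "\<kappa> \<le> 1/2" for v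
  proof -
    have *: "(\<Sum>k<n. (sqrt 2 * L v k)\<^sup>2 / 2) = (\<Sum>k<n. (L v k)\<^sup>2)" by (simp add: power_mult_distrib)
    show "\<bar>P v - exp (- q v)\<bar> \<le> \<kappa> + 5 * \<beta>" "P v \<le> exp (- (q v / 2))"
      unfolding P_def using quad[of v] small that q0 nn
      by (intro prod_cos_close[where \<beta>=\<beta> and \<kappa>=\<kappa>]; simp add: * power_mult_distrib)+
  qed
  show ?A
  proof (cases "\<kappa> \<le> 1/2")
    case False
    have "0 \<le> m" "m \<le> 1"
      unfolding m_def using sign_mean_mono[of n "\<lambda>_. 0"] sign_mean_mono[of n _ "\<lambda>_. 1"]
      by (auto simp: sum_nonneg)
    moreover have "0 \<le> (\<Prod>j<d. 1 / sqrt (1 + lam j))" "(\<Prod>j<d. 1 / sqrt (1 + lam j)) \<le> 1"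
      using lam by (auto intro!: prod_nonneg prod_le_1 simp: divide_le_eq_1 not_less)
    moreover have "0 \<le> 2 * 2 ^ d * T" using T0 by simp
    ultimately show ?thesis using False nn unfolding T_def[symmetric] abs_le_iff by linarith
  next
    case True
    have "\<bar>m - (\<Prod>j<d. 1 / sqrt (1 + lam j))\<bar> = \<bar>\<integral>v. P v - exp (- q v) \<partial>gauss d\<bar>"
      using intP intq by (simp add: m valq)
    also have "\<dots> \<le> (\<integral>v. \<bar>P v - exp (- q v)\<bar> \<partial>gauss d)" by (rule integral_abs_bound)
    also have "\<dots> \<le> (\<integral>v. (\<kappa> + 5 * \<beta>) + 2 * T * H v \<partial>gauss d)"
    proof (rule integral_mono)
      fix v
      show "\<bar>P v - exp (- q v)\<bar> \<le> (\<kappa> + 5 * \<beta>) + 2 * T * H v"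
      proof (cases "\<beta> * q v \<le> 1")
        case t: True
        have "0 \<le> 2 * T * H v" using T0 H0[of v] by simp
        then show ?thesis using near(1)[OF t True] by linarith
      next
        case False
        have "exp (- q v) \<le> 1" using q0[of v] by simp
        then have "\<bar>P v - exp (- q v)\<bar> \<le> 2" using P1[of v] exp_gt_zero[of "- q v"] unfolding abs_le_iff by linarith
        then show ?thesis using far[OF False] nn by linarith
      qed
    qed (use intP intq intH in auto)
    also have "\<dots> = (\<kappa> + 5 * \<beta>) + 2 * T * (\<integral>v. H v \<partial>gauss d)"
      using intH by (simp add: gauss.prob_space)
    also have "\<dots> \<le> (\<kappa> + 5 * \<beta>) + 2 * T * 2 ^ d" using valH T0 by simp
    finally show ?thesis using nn unfolding T_def[symmetric] by (simp add: mult_ac)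
  qed
  show ?B if True: "\<kappa> \<le> 1/2"
  proof -
    have "m \<le> (\<integral>v. exp (- (q v / 2)) + T * H v \<partial>gauss d)"
      unfolding m
    proof (rule integral_mono)
      fix v
      show "P v \<le> exp (- (q v / 2)) + T * H v"
      proof (cases "\<beta> * q v \<le> 1")
        case t: True
        have "0 \<le> T * H v" using T0 H0[of v] by simp
        then show ?thesis using near(2)[OF t True] by linarith
      next
        case False
        then show ?thesis using far[OF False] P1[of v] by (smt (verit) exp_gt_zero)
      qed
    qed (use intP intq2 intH in auto)
    also have "\<dots> = (\<Prod>j<d. 1 / sqrt (1 + lam j / 2)) + T * (\<integral>v. H v \<partial>gauss d)"
      using intH intq2 by (simp add: valq2)
    also have "\<dots> \<le> (\<Prod>j<d. 1 / sqrt (1 + lam j / 2)) + T * 2 ^ d" using valH T0 by simp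
    finally show ?thesis unfolding T_def by (simp add: mult_ac)
  qed
qed

section \<open>Trigonometric sums on the circle\<close>

lemma circle_measure_density:
  "circle_measure = density lborel (\<lambda>x. ennreal (indicator {-pi..pi} x / (2 * pi)))"
proof -
  have "emeasure lborel {-pi..pi} = ennreal (2 * pi)" by simp
  moreover have "indicator {-pi..pi} x / ennreal (2 * pi) = ennreal (indicator {-pi..pi} x / (2 * pi))" for x :: real
    using divide_ennreal[of 1 "2 * pi"] by (auto simp: indicator_def)
  ultimately show ?thesis unfolding circle_measure_def uniform_measure_def by simp
qed

lemma sets_circle_measure [simp, measurable_cong]: "sets circle_measure = sets borel"
  by (simp add: circle_measure_def)

lemma space_circle_measure [simp]: "space circle_measure = UNIV"
  by (simp add: circle_measure_def)

interpretation circle: prob_space circle_measure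
  unfolding circle_measure_def by (intro prob_space_uniform_measure) (auto simp: pi_ge_zero)

lemma circle_integral:
  fixes f :: "real \<Rightarrow> real"
  assumes "f \<in> borel_measurable borel"
  shows "(\<integral>x. f x \<partial>circle_measure) = (\<integral>x. indicator {-pi..pi} x * f x \<partial>lborel) / (2 * pi)"
proof -
  have "(\<integral>x. f x \<partial>circle_measure) = (\<integral>x. (indicator {-pi..pi} x / (2 * pi)) * f x \<partial>lborel)"
    unfolding circle_measure_density using assms by (subst integral_density) auto
  then show ?thesis by simp
qed

lemma circle_integral_cos:
  assumes "m \<noteq> 0"
  shows "(\<integral>x. cos (of_int m * x + c) \<partial>circle_measure) = 0"
proof -
  define F where "F x = sin (of_int m * x + c) / of_int m" for x :: real
  have "(\<integral>x. indicator {-pi..pi} x *\<^sub>R cos (of_int m * x + c) \<partial>lborel) = F pi - F (- pi)"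
  proof (rule integral_FTC_atLeastAtMost)
    show "(F has_vector_derivative cos (of_int m * x + c)) (at x within {-pi..pi})" for x
      unfolding F_def has_real_derivative_iff_has_vector_derivative[symmetric] using assms
      by (auto intro!: derivative_eq_intros)
  qed (auto intro!: continuous_intros)
  also have "\<dots> = 0"
  proof -
    have "sin (of_int m * pi + c) = sin (of_int m * (- pi) + c + 2 * pi * of_int m)" by (simp add: algebra_simps)
    also have "\<dots> = sin (of_int m * (- pi) + c)" unfolding sin_add[of "of_int m * (- pi) + c"]
      by (simp only: sin_int_2pin cos_int_2pin mult_1_right mult_zero_right add_0_right)
    finally show ?thesis by (simp add: F_def)
  qed
  finally show ?thesis by (subst circle_integral) auto
qed

abbreviation \<mu> :: "real measure" where
  "\<mu> \<equiv> circle_measure"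

definition trig_sum :: "nat \<Rightarrow> (nat \<Rightarrow> real) \<Rightarrow> real \<Rightarrow> complex" where
  "trig_sum n b \<theta> = (\<Sum>k<n. of_real (b k) * cis (real k * \<theta>))"

lemma continuous_trig_sum [continuous_intros]:
  "continuous_on A f \<Longrightarrow> continuous_on A (\<lambda>x. trig_sum n b (f x))"
  unfolding trig_sum_def by (intro continuous_intros)

lemma trig_sum_measurable [measurable]: "trig_sum n b \<in> borel_measurable borel"
  by (intro borel_measurable_continuous_onI continuous_intros)

lemma norm_trig_sum_le: "norm (trig_sum n b \<theta>) \<le> (\<Sum>k<n. \<bar>b k\<bar>)"
  unfolding trig_sum_def by (rule order_trans[OF norm_sum]) (simp add: norm_mult)

lemma norm_trig_sum_square:
  "(norm (trig_sum n b \<theta>))\<^sup>2 = (\<Sum>k<n. \<Sum>l<n. b k * b l * cos (of_int (int k - int l) * \<theta>))"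
proof -
  have "(norm (trig_sum n b \<theta>))\<^sup>2 = (\<Sum>k<n. b k * cos (k * \<theta>))\<^sup>2 + (\<Sum>k<n. b k * sin (k * \<theta>))\<^sup>2"
    unfolding trig_sum_def cmod_power2 by simp
  also have "\<dots> = (\<Sum>k<n. \<Sum>l<n. b k * b l * (cos (k * \<theta>) * cos (l * \<theta>) + sin (k * \<theta>) * sin (l * \<theta>)))"
    by (simp add: power2_eq_square sum_product sum.distrib[symmetric] algebra_simps)
  also have "\<dots> = (\<Sum>k<n. \<Sum>l<n. b k * b l * cos (of_int (int k - int l) * \<theta>))"
    by (simp add: cos_diff left_diff_distrib)
  finally show ?thesis .
qed

lemma circle_integrable_bounded:
  fixes f :: "real \<Rightarrow> real"
  assumes "f \<in> borel_measurable borel" "\<And>x. \<bar>f x\<bar> \<le> B"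
  shows "integrable \<mu> f"
  using assms by (intro circle.integrable_const_bound[where B=B]) auto

text \<open>
  The affine change of angle covers all frequencies that occur in correlations of two angles.
\<close>
lemma circle_parseval:
  assumes m: "m \<noteq> 0"
  shows "(\<integral>\<theta>. (norm (trig_sum n b (of_int m * \<theta> + c)))\<^sup>2 \<partial>\<mu>) = (\<Sum>k<n. (b k)\<^sup>2)"
proof -
  have int: "integrable \<mu> (\<lambda>\<theta>. cos (of_int i * \<theta> + e))" for i e
    by (rule circle_integrable_bounded[where B=1]) auto
  have eq: "cos (of_int (int k - int l) * (of_int m * \<theta> + c)) =
        cos (of_int ((int k - int l) * m) * \<theta> + of_int (int k - int l) * c)" for k l \<theta>
    by (simp add: algebra_simps)
  have "(\<integral>\<theta>. (norm (trig_sum n b (of_int m * \<theta> + c)))\<^sup>2 \<partial>\<mu>) =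
    (\<Sum>k<n. \<Sum>l<n. b k * b l * (\<integral>\<theta>. cos (of_int ((int k - int l) * m) * \<theta> + of_int (int k - int l) * c) \<partial>\<mu>))"
    unfolding norm_trig_sum_square eq
    by (simp add: Bochner_Integration.integral_sum int del: of_int_mult of_int_diff)
  also have "\<dots> = (\<Sum>k<n. \<Sum>l<n. if k = l then (b k)\<^sup>2 else 0)"
  proof (intro sum.cong refl, goal_cases)
    case (1 k l)
    show ?case
    proof (cases "k = l")
      case False
      then have "(int k - int l) * m \<noteq> 0" using m by simp
      from circle_integral_cos[OF this] show ?thesis using False by simp
    qed (use circle.prob_space in \<open>simp add: power2_eq_square\<close>)
  qed
  finally show ?thesis by simp
qed

lemma square_Re: "(Re z)\<^sup>2 = ((norm z)\<^sup>2 + Re (z\<^sup>2)) / 2"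
  unfolding cmod_power2 by (simp add: power2_eq_square)

lemma norm_add_square: "(norm (x + y))\<^sup>2 = (norm x)\<^sup>2 + (norm y)\<^sup>2 + 2 * Re (x * cnj y)"
  unfolding cmod_power2 by (simp add: power2_eq_square algebra_simps)

text \<open>
  Each summand is expanded with \<open>(Re z)\<^sup>2 = (|z|\<^sup>2 + Re (z\<^sup>2)) / 2\<close>.
\<close>
lemma quadratic_form_trig:
  fixes P Q :: complex and c :: "nat \<Rightarrow> real" and n :: nat and \<theta> \<phi> :: real
  defines "D \<equiv> trig_sum n (\<lambda>k. (c k)\<^sup>2)"
  assumes c: "(\<Sum>k<n. (c k)\<^sup>2) = 1"
  shows "(\<Sum>k<n. (c k * Re (P * cis (k * \<theta>) + Q * cis (k * \<phi>)))\<^sup>2) =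
    ((norm P)\<^sup>2 + (norm Q)\<^sup>2) / 2 + Re (P * cnj Q * D (\<theta> - \<phi>)) +
    Re (P\<^sup>2 * D (2 * \<theta>) + Q\<^sup>2 * D (2 * \<phi>) + 2 * P * Q * D (\<theta> + \<phi>)) / 2"
proof -
  have summand: "(c k * Re (P * cis (k * \<theta>) + Q * cis (k * \<phi>)))\<^sup>2 =
     ((norm P)\<^sup>2 + (norm Q)\<^sup>2) / 2 * (c k)\<^sup>2 + Re (P * cnj Q * (of_real ((c k)\<^sup>2) * cis (k * (\<theta> - \<phi>)))) +
     Re (P\<^sup>2 * (of_real ((c k)\<^sup>2) * cis (k * (2 * \<theta>))) + Q\<^sup>2 * (of_real ((c k)\<^sup>2) * cis (k * (2 * \<phi>)))
        + 2 * P * Q * (of_real ((c k)\<^sup>2) * cis (k * (\<theta> + \<phi>)))) / 2" for k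
  proof -
    define e f where "e = cis (k * \<theta>)" and "f = cis (k * \<phi>)"
    have 1: "cis (k * (\<theta> - \<phi>)) = e * cnj f" "cis (k * (2 * \<theta>)) = e\<^sup>2" "cis (k * (2 * \<phi>)) = f\<^sup>2" "cis (k * (\<theta> + \<phi>)) = e * f"
      by (simp_all add: e_def f_def cis_cnj cis_mult power2_eq_square algebra_simps)
    have "norm e = 1" "norm f = 1" by (simp_all add: e_def f_def)
    then have N: "(norm (P * e + Q * f))\<^sup>2 = (norm P)\<^sup>2 + (norm Q)\<^sup>2 + 2 * Re (P * cnj Q * (e * cnj f))"
      by (subst norm_add_square) (simp add: norm_mult power_mult_distrib mult_ac del: times_complex.sel)
    have sq: "(P * e + Q * f)\<^sup>2 = P\<^sup>2 * e\<^sup>2 + Q\<^sup>2 * f\<^sup>2 + 2 * P * Q * (e * f)"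
      by (simp add: power2_eq_square algebra_simps)
    have key: "(Re (P * e + Q * f))\<^sup>2 = ((norm P)\<^sup>2 + (norm Q)\<^sup>2) / 2 + Re (P * cnj Q * (e * cnj f)) +
         (Re (P\<^sup>2 * e\<^sup>2) + Re (Q\<^sup>2 * f\<^sup>2) + Re (2 * P * Q * (e * f))) / 2"
      unfolding square_Re N sq
      unfolding plus_complex.sel(1) by argo
    have pull: "Re (a * (of_real ((c k)\<^sup>2) * b)) = (c k)\<^sup>2 * Re (a * b)" for a b :: complex
      by (simp add: algebra_simps)
    have distr: "s * (N / 2 + a + (b1 + b2 + b3) / 2) = N / 2 * s + s * a + (s * b1 + s * b2 + s * b3) / 2"
      for s N a b1 b2 b3 :: real by (simp add: field_simps)
    show ?thesis
      unfolding 1 e_def[symmetric] f_def[symmetric] power_mult_distrib plus_complex.sel(1) pull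
      unfolding plus_complex.sel(1)[symmetric] key
      unfolding plus_complex.sel(1) by (rule distr)
  qed
  show ?thesis
    unfolding summand D_def trig_sum_def
    by (simp only: sum.distrib sum_divide_distrib[symmetric] Re_sum[symmetric] sum_distrib_left[symmetric] c mult_1_right)
qed


text \<open>
  The four frequencies at which the off-diagonal part of the quadratic form in
  \<open>quadratic_form_trig\<close> is evaluated; small values mean that the random sums at \<open>\<theta>\<close> and \<open>\<phi>\<close> look like
  independent circularly symmetric Gaussians.
\<close>
definition correlation :: "nat \<Rightarrow> (nat \<Rightarrow> real) \<Rightarrow> real \<Rightarrow> real \<Rightarrow> real" where
  "correlation n c \<theta> \<phi> = (let D = (\<lambda>t. norm (trig_sum n (\<lambda>k. (c k)\<^sup>2) t)) in
     D (2 * \<theta>) + D (2 * \<phi>) + D (\<theta> + \<phi>) + D (\<theta> - \<phi>))"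

lemma quadratic_form_trig_bound:
  fixes P Q :: complex and c :: "nat \<Rightarrow> real" and n :: nat and \<theta> \<phi> :: real
  assumes c: "(\<Sum>k<n. (c k)\<^sup>2) = 1"
  defines "q \<equiv> ((norm P)\<^sup>2 + (norm Q)\<^sup>2) / 2"
  shows "\<bar>(\<Sum>k<n. (c k * Re (P * cis (k * \<theta>) + Q * cis (k * \<phi>)))\<^sup>2) - q\<bar> \<le> correlation n c \<theta> \<phi> * q"
proof -
  define D where "D = trig_sum n (\<lambda>k. (c k)\<^sup>2)"
  define d1 d2 d3 d4 where "d1 = norm (D (2 * \<theta>))" and "d2 = norm (D (2 * \<phi>))"
    and "d3 = norm (D (\<theta> + \<phi>))" and "d4 = norm (D (\<theta> - \<phi>))"
  have d0: "0 \<le> d1" "0 \<le> d2" "0 \<le> d3" "0 \<le> d4" by (auto simp: d1_def d2_def d3_def d4_def)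
  have pq: "norm P * norm Q \<le> q" using zero_le_power2[of "norm P - norm Q"] by (simp add: q_def power2_eq_square algebra_simps)
  have P: "(norm P)\<^sup>2 \<le> 2 * q" and Q: "(norm Q)\<^sup>2 \<le> 2 * q" by (simp_all add: q_def)
  have "\<bar>(\<Sum>k<n. (c k * Re (P * cis (k * \<theta>) + Q * cis (k * \<phi>)))\<^sup>2) - q\<bar> =
    \<bar>Re (P * cnj Q * D (\<theta> - \<phi>)) + Re (P\<^sup>2 * D (2 * \<theta>) + Q\<^sup>2 * D (2 * \<phi>) + 2 * P * Q * D (\<theta> + \<phi>)) / 2\<bar>"
    unfolding quadratic_form_trig[OF c] q_def D_def by simp
  also have "\<dots> \<le> norm (P * cnj Q * D (\<theta> - \<phi>)) + norm (P\<^sup>2 * D (2 * \<theta>) + Q\<^sup>2 * D (2 * \<phi>) + 2 * P * Q * D (\<theta> + \<phi>)) / 2"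
    using abs_Re_le_cmod[of "P * cnj Q * D (\<theta> - \<phi>)"] abs_Re_le_cmod[of "P\<^sup>2 * D (2 * \<theta>) + Q\<^sup>2 * D (2 * \<phi>) + 2 * P * Q * D (\<theta> + \<phi>)"]
    by linarith
  also have "norm (P\<^sup>2 * D (2 * \<theta>) + Q\<^sup>2 * D (2 * \<phi>) + 2 * P * Q * D (\<theta> + \<phi>)) \<le>
     norm (P\<^sup>2 * D (2 * \<theta>)) + norm (Q\<^sup>2 * D (2 * \<phi>)) + norm (2 * P * Q * D (\<theta> + \<phi>))"
    by (intro norm_triangle_le add_mono order_refl norm_triangle_ineq)
  also have "norm (P * cnj Q * D (\<theta> - \<phi>)) + (norm (P\<^sup>2 * D (2 * \<theta>)) + norm (Q\<^sup>2 * D (2 * \<phi>)) + norm (2 * P * Q * D (\<theta> + \<phi>))) / 2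
     = norm P * norm Q * d4 + ((norm P)\<^sup>2 * d1 + (norm Q)\<^sup>2 * d2) / 2 + norm P * norm Q * d3"
    by (simp add: norm_mult norm_power d1_def d2_def d3_def d4_def add_divide_distrib)
  also have "\<dots> \<le> q * d4 + (2 * q * d1 + 2 * q * d2) / 2 + q * d3"
    using pq P Q d0 by (intro add_mono divide_right_mono mult_right_mono) auto
  also have "\<dots> = correlation n c \<theta> \<phi> * q"
    unfolding correlation_def d1_def d2_def d3_def d4_def D_def Let_def by (simp add: algebra_simps)
  finally show ?thesis by simp
qed

text \<open>
  The pair of complex sums is a random walk in four real dimensions, with steps the columns \<open>A k\<close>.
  The bound \<open>quad\<close> is only required for those \<open>Q\<close> that occur, so that \<open>w = 0\<close> gives a statement about the
  single angle \<open>\<theta>\<close>.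
\<close>
lemma gaussian_pair:
  fixes c :: "nat \<Rightarrow> real" and n :: nat and \<theta> \<phi> u w U B \<kappa> :: real
  defines "S \<equiv> \<lambda>x. trig_sum n (\<lambda>k. x k * c k)"
  assumes c: "(\<Sum>k<n. (c k)\<^sup>2) = 1" and B: "\<And>k. k < n \<Longrightarrow> (c k)\<^sup>2 \<le> B" "0 < B"
    and u: "0 \<le> u" "u \<le> U" and w: "0 \<le> w" "w \<le> U" and U: "U > 0"
    and \<kappa>: "0 \<le> \<kappa>"
    and quad: "\<And>P Q. (w = 0 \<Longrightarrow> Q = 0) \<Longrightarrow>
      \<bar>(\<Sum>k<n. (c k * Re (P * cis (k * \<theta>) + Q * cis (k * \<phi>)))\<^sup>2) - ((norm P)\<^sup>2 + (norm Q)\<^sup>2) / 2\<bar>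
        \<le> \<kappa> * (((norm P)\<^sup>2 + (norm Q)\<^sup>2) / 2)"
  defines "m \<equiv> sign_mean n (\<lambda>x. exp (- (u * (norm (S x \<theta>))\<^sup>2 + w * (norm (S x \<phi>))\<^sup>2)))"
  shows "\<bar>m - 1 / ((1 + u) * (1 + w))\<bar> \<le> 2 * \<kappa> + 40 * B + 32 * exp (- (1 / (16 * B * U)))" (is ?A)
    and "\<kappa> \<le> 1/2 \<Longrightarrow> m \<le> 1 / ((1 + u / 2) * (1 + w / 2)) + 16 * exp (- (1 / (16 * B * U)))" (is "_ \<Longrightarrow> ?B")
proof -
  define A where "A k j = c k * (if j = 0 then sqrt u * cos (k * \<theta>) else if j = 1 then sqrt u * sin (k * \<theta>)
     else if j = 2 then sqrt w * cos (k * \<phi>) else sqrt w * sin (k * \<phi>))" for k j :: nat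
  define lam where "lam j = (if j < 2 then u else w)" for j :: nat
  define P where "P v = Complex (sqrt u * v 0) (- (sqrt u * v 1))" for v :: "nat \<Rightarrow> real"
  define Q where "Q v = Complex (sqrt w * v 2) (- (sqrt w * v 3))" for v :: "nat \<Rightarrow> real"
  have four: "{..<4::nat} = {0,1,2,3}" by auto
  have L: "(\<Sum>j<4. v j * A k j) = c k * Re (P v * cis (k * \<theta>) + Q v * cis (k * \<phi>))" for v k
    by (simp add: four A_def P_def Q_def algebra_simps)
  have q: "(\<Sum>j<4. lam j * (v j)\<^sup>2) / 2 = ((norm (P v))\<^sup>2 + (norm (Q v))\<^sup>2) / 2" for v
    using u w by (simp add: four lam_def P_def Q_def cmod_power2 power_mult_distrib algebra_simps)
  have S: "(\<Sum>j<4. (\<Sum>k<n. x k * A k j)\<^sup>2) = u * (norm (S x \<theta>))\<^sup>2 + w * (norm (S x \<phi>))\<^sup>2" for x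
  proof -
    have *: "(\<Sum>k<n. x k * (c k * (sqrt a * t k)))\<^sup>2 = a * (\<Sum>k<n. x k * c k * t k)\<^sup>2" if "0 \<le> a" for a t
    proof -
      have "(\<Sum>k<n. x k * (c k * (sqrt a * t k))) = sqrt a * (\<Sum>k<n. x k * c k * t k)"
        by (simp add: sum_distrib_left mult_ac)
      then show ?thesis using that by (simp add: power_mult_distrib)
    qed
    show ?thesis
      using u w by (simp add: four A_def * S_def trig_sum_def cmod_power2 distrib_left)
  qed
  have prod: "(\<Prod>j<4. 1 / sqrt (1 + lam j)) = 1 / ((1 + u) * (1 + w))"
    and prod2: "(\<Prod>j<4. 1 / sqrt (1 + lam j / 2)) = 1 / ((1 + u / 2) * (1 + w / 2))"
    using u w by (simp_all add: four lam_def)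
  have small: "2 * (c k * Re (P * cis (k * \<theta>) + Q * cis (k * \<phi>)))\<^sup>2 \<le> 8 * B * (((norm P)\<^sup>2 + (norm Q)\<^sup>2) / 2)"
    if "k < n" for k P Q
  proof -
    have "\<bar>Re (P * cis (k * \<theta>) + Q * cis (k * \<phi>))\<bar> \<le> norm (P * cis (k * \<theta>)) + norm (Q * cis (k * \<phi>))"
      by (rule order_trans[OF abs_Re_le_cmod norm_triangle_ineq])
    then have "\<bar>Re (P * cis (k * \<theta>) + Q * cis (k * \<phi>))\<bar> \<le> norm P + norm Q" by (simp add: norm_mult)
    then have "(Re (P * cis (k * \<theta>) + Q * cis (k * \<phi>)))\<^sup>2 \<le> (norm P + norm Q)\<^sup>2"
      by (simp add: abs_le_square_iff[symmetric])
    also have "\<dots> \<le> 2 * ((norm P)\<^sup>2 + (norm Q)\<^sup>2)"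
      using zero_le_power2[of "norm P - norm Q"] by (simp add: power2_eq_square algebra_simps)
    finally have "(c k)\<^sup>2 * (Re (P * cis (k * \<theta>) + Q * cis (k * \<phi>)))\<^sup>2 \<le> B * (2 * ((norm P)\<^sup>2 + (norm Q)\<^sup>2))"
      using B that by (intro mult_mono) auto
    then show ?thesis by (simp only: power_mult_distrib mult_ac)
  qed
  have lam: "0 \<le> lam j" "lam j \<le> U" for j using u w by (auto simp: lam_def)
  have quad4: "\<bar>(\<Sum>k<n. (\<Sum>j<4. v j * A k j)\<^sup>2) - (\<Sum>j<4. lam j * (v j)\<^sup>2) / 2\<bar>
       \<le> \<kappa> * ((\<Sum>j<4. lam j * (v j)\<^sup>2) / 2)" for v
    unfolding L q by (rule quad) (simp add: Q_def complex_eq_iff)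
  have small4: "2 * (\<Sum>j<4. v j * A k j)\<^sup>2 \<le> 8 * B * ((\<Sum>j<4. lam j * (v j)\<^sup>2) / 2)" if "k < n" for v k
    unfolding L q using that by (rule small)
  have B8: "0 < 8 * B" using B by simp
  note comparison = gaussian_comparison[OF lam U quad4 small4 \<kappa> B8, unfolded S prod prod2, folded m_def]
  show ?A using comparison(1) by simp
  show ?B if "\<kappa> \<le> 1/2" using comparison(2) that by simp
qed

lemma gaussian_pair_comparison:
  fixes c :: "nat \<Rightarrow> real" and n :: nat and \<theta> \<phi> u w U B :: real
  defines "S \<equiv> \<lambda>x. trig_sum n (\<lambda>k. x k * c k)"
  assumes c: "(\<Sum>k<n. (c k)\<^sup>2) = 1" and B: "\<And>k. k < n \<Longrightarrow> (c k)\<^sup>2 \<le> B" "0 < B"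
    and u: "0 \<le> u" "u \<le> U" and w: "0 \<le> w" "w \<le> U" and U: "U > 0"
  shows "\<bar>sign_mean n (\<lambda>x. exp (- (u * (norm (S x \<theta>))\<^sup>2 + w * (norm (S x \<phi>))\<^sup>2))) - 1 / ((1 + u) * (1 + w))\<bar>
     \<le> 2 * correlation n c \<theta> \<phi> + 40 * B + 32 * exp (- (1 / (16 * B * U)))"
  unfolding S_def using c B u w U
  by (intro gaussian_pair quadratic_form_trig_bound) (auto simp: correlation_def Let_def)

text \<open>
  The dependence on the correlation is quadratic: when it exceeds \<open>1 / 2\<close> the trivial bound \<open>1\<close> is used,
  and otherwise it does not enter at all. After integration over the angle the error is therefore
  \<open>O(1 / n)\<close> and not only \<open>O(1 / sqrt n)\<close>, as the estimate of the truncation loss requires.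
\<close>
lemma gaussian_single_upper_bound:
  fixes c :: "nat \<Rightarrow> real" and n :: nat and \<theta> u U B :: real
  defines "S \<equiv> \<lambda>x. trig_sum n (\<lambda>k. x k * c k)"
  assumes c: "(\<Sum>k<n. (c k)\<^sup>2) = 1" and B: "\<And>k. k < n \<Longrightarrow> (c k)\<^sup>2 \<le> B" "0 < B" and U: "U > 0"
  shows "sign_mean n (\<lambda>x. exp (- (U * (norm (S x \<theta>))\<^sup>2)))
     \<le> 1 / (1 + U / 2) + 16 * exp (- (1 / (16 * B * U))) + 4 * (norm (trig_sum n (\<lambda>k. (c k)\<^sup>2) (2 * \<theta>)))\<^sup>2"
proof -
  define \<kappa> where "\<kappa> = norm (trig_sum n (\<lambda>k. (c k)\<^sup>2) (2 * \<theta>))"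
  show ?thesis
  proof (cases "\<kappa> \<le> 1 / 2")
    case False
    then have "(1/2)\<^sup>2 \<le> \<kappa>\<^sup>2" by (intro power_mono) auto
    then have "1 \<le> 4 * \<kappa>\<^sup>2" by (simp add: power2_eq_square)
    moreover have "sign_mean n (\<lambda>x. exp (- (U * (norm (S x \<theta>))\<^sup>2))) \<le> 1"
      using sign_mean_mono[of n _ "\<lambda>_. 1"] U by auto
    moreover have "0 \<le> 1 / (1 + U / 2)" "0 \<le> 16 * exp (- (1 / (16 * B * U)))" using U by auto
    ultimately show ?thesis unfolding \<kappa>_def by linarith
  next
    case True
    have quad: "\<bar>(\<Sum>k<n. (c k * Re (P * cis (k * \<theta>) + Q * cis (k * 0)))\<^sup>2) - ((norm P)\<^sup>2 + (norm Q)\<^sup>2) / 2\<bar>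
        \<le> \<kappa> * (((norm P)\<^sup>2 + (norm Q)\<^sup>2) / 2)" if "(0::real) = 0 \<Longrightarrow> Q = 0" for P Q
    proof -
      have Q: "Q = 0" using that by simp
      have "\<bar>(\<Sum>k<n. (c k * Re (P * cis (k * \<theta>) + Q * cis (k * 0)))\<^sup>2) - ((norm P)\<^sup>2 + (norm Q)\<^sup>2) / 2\<bar> =
          \<bar>Re (P\<^sup>2 * trig_sum n (\<lambda>k. (c k)\<^sup>2) (2 * \<theta>)) / 2\<bar>"
        using quadratic_form_trig[OF c, of P \<theta> 0 0] Q by simp
      also have "\<dots> \<le> norm (P\<^sup>2 * trig_sum n (\<lambda>k. (c k)\<^sup>2) (2 * \<theta>)) / 2"
        using abs_Re_le_cmod[of "P\<^sup>2 * trig_sum n (\<lambda>k. (c k)\<^sup>2) (2 * \<theta>)"] by linarith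
      also have "\<dots> = \<kappa> * (((norm P)\<^sup>2 + (norm Q)\<^sup>2) / 2)" by (simp add: \<kappa>_def norm_mult norm_power Q)
      finally show ?thesis .
    qed
    have "sign_mean n (\<lambda>x. exp (- (U * (norm (S x \<theta>))\<^sup>2 + 0 * (norm (S x 0))\<^sup>2)))
        \<le> 1 / ((1 + U / 2) * (1 + 0 / 2)) + 16 * exp (- (1 / (16 * B * U)))"
      unfolding S_def
      by (rule gaussian_pair(2)[where \<kappa>=\<kappa> and B=B and U=U]) (use c B U True quad in \<open>auto simp: \<kappa>_def\<close>)
    then have "sign_mean n (\<lambda>x. exp (- (U * (norm (S x \<theta>))\<^sup>2))) \<le> 1 / (1 + U / 2) + 16 * exp (- (1 / (16 * B * U)))"
      by simp
    then show ?thesis unfolding \<kappa>_def[symmetric] by (simp add: add_increasing2)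
  qed
qed

section \<open>The truncated Frullani integral and Euler's constant\<close>

text \<open>
  As \<open>a\<close> tends to \<open>0\<close> and \<open>U\<close> to infinity this tends to \<open>ln y\<close>.
\<close>
definition frullani :: "real \<Rightarrow> real \<Rightarrow> real \<Rightarrow> real" where
  "frullani a U y = integral {a..U} (\<lambda>u. (exp (- u) - exp (- (u * y))) / u)"

lemma frullani_derivative:
  assumes a: "0 < a" "a \<le> U" and y: "0 < y"
  shows "(frullani a U has_real_derivative (exp (- (a * y)) - exp (- (U * y))) / y) (at y)"
proof -
  have "((\<lambda>y. integral (cbox a U) (\<lambda>u. (exp (- u) - exp (- (u * y))) / u)) has_field_derivative
        integral (cbox a U) (\<lambda>u. exp (- (u * y)))) (at y within UNIV)"
  proof (rule leibniz_rule_field_derivative[where fx="\<lambda>y u. exp (- (u * y))"])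
    fix y u :: real assume u: "u \<in> cbox a U"
    then show "((\<lambda>y. (exp (- u) - exp (- (u * y))) / u) has_field_derivative exp (- (u * y))) (at y within UNIV)"
      using a by (auto intro!: derivative_eq_intros)
  next
    fix y :: real
    show "(\<lambda>u. (exp (- u) - exp (- (u * y))) / u) integrable_on cbox a U"
      using a by (intro integrable_continuous continuous_intros) auto
  next
    show "continuous_on (UNIV \<times> cbox a U) (\<lambda>(y, u). exp (- (u * y)))"
      unfolding split_beta by (intro continuous_intros)
  qed auto
  moreover have "((\<lambda>u. exp (- (u * y))) has_integral - exp (- (U * y)) / y - - exp (- (a * y)) / y) {a..U}"
    using a y by (intro fundamental_theorem_of_calculus)
      (auto intro!: derivative_eq_intros simp flip: has_real_derivative_iff_has_vector_derivative)
  then have "integral (cbox a U) (\<lambda>u. exp (- (u * y))) = (exp (- (a * y)) - exp (- (U * y))) / y"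
    by (simp add: integral_unique diff_divide_distrib)
  ultimately show ?thesis unfolding frullani_def by simp
qed

lemma frullani_1 [simp]: "frullani a U 1 = 0"
  by (simp add: frullani_def)

text \<open>
  The difference \<open>h\<close> vanishes at \<open>1\<close> and has derivative \<open>(1 - exp (- a t) + exp (- U t)) / t\<close>, which lies
  between \<open>0\<close> and \<open>a + exp (- U t) / t\<close>; integrate from \<open>1\<close> to \<open>y\<close>. For \<open>y < 1\<close> the exponential is largest at
  the end point \<open>y\<close>, which produces the logarithmic term.
\<close>
lemma ln_frullani:
  assumes a: "0 < a" "a \<le> U" and y: "0 < y"
  shows "\<bar>ln y - frullani a U y\<bar> \<le> a * \<bar>y - 1\<bar> + exp (- (U * y)) * max 0 (- ln y) + exp (- U) * y"
proof -
  define h where "h t = ln t - frullani a U t" for t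
  define h' where "h' t = (1 - exp (- (a * t)) + exp (- (U * t))) / t" for t
  have h1: "h 1 = 0" by (simp add: h_def)
  have der: "(h has_real_derivative h' t) (at t)" if "0 < t" for t
    unfolding h_def h'_def using that a
    by (auto intro!: derivative_eq_intros frullani_derivative simp: diff_divide_distrib add_divide_distrib)
  have h'0: "0 \<le> h' t" if "0 < t" for t using that a unfolding h'_def by (intro divide_nonneg_pos add_nonneg_nonneg) auto
  have h'1: "h' t \<le> a + exp (- (U * t)) / t" if "0 < t" for t
  proof -
    have "1 - exp (- (a * t)) \<le> a * t" using exp_ge_add_one_self[of "- (a * t)"] by linarith
    then have "(1 - exp (- (a * t))) / t \<le> a" using that by (simp add: divide_le_eq)
    then show ?thesis unfolding h'_def add_divide_distrib by simp
  qed
  have U: "U > 0" using a by simp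
  show ?thesis
  proof (cases "1 \<le> y")
    case True
    have "h 1 \<le> h y"
      by (rule DERIV_nonneg_imp_nondecreasing[OF True]) (meson der h'0 less_le_trans zero_less_one)
    moreover have "(a + exp (- U)) * 1 - h 1 \<le> (a + exp (- U)) * y - h y"
    proof (rule DERIV_nonneg_imp_nondecreasing[OF True])
      fix t assume t: "1 \<le> t" "t \<le> y"
      have "exp (- (U * t)) / t \<le> exp (- U) / 1" using t U by (intro frac_le) auto
      then have "0 \<le> a + exp (- U) - h' t" using h'1[of t] t by simp
      moreover have "((\<lambda>t. (a + exp (- U)) * t - h t) has_real_derivative a + exp (- U) - h' t) (at t)"
        using t der by (auto intro!: derivative_eq_intros)
      ultimately show "\<exists>z. ((\<lambda>t. (a + exp (- U)) * t - h t) has_real_derivative z) (at t) \<and> 0 \<le> z" by blast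
    qed
    moreover have max0: "max 0 (- ln y) = 0" using True by simp
    moreover have "(a + exp (- U)) * y = a * y + exp (- U) * y" "a * \<bar>y - 1\<bar> = a * y - a"
      using True by (auto simp: algebra_simps)
    moreover have "exp (- U) > 0" by simp
    ultimately have "\<bar>ln y - frullani a U y\<bar> \<le> a * \<bar>y - 1\<bar> + 0 + exp (- U) * y"
      using h1 unfolding h_def by argo
    then show ?thesis unfolding max0 by simp
  next
    case False
    then have y1: "y \<le> 1" by simp
    have "h y \<le> h 1"
      by (rule DERIV_nonneg_imp_nondecreasing[OF y1]) (meson der h'0 less_le_trans y)
    moreover have "a * y + exp (- (U * y)) * ln y - h y \<le> a * 1 + exp (- (U * y)) * ln 1 - h 1"
    proof (rule DERIV_nonneg_imp_nondecreasing[OF y1])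
      fix t assume t: "y \<le> t" "t \<le> 1"
      have "exp (- (U * t)) / t \<le> exp (- (U * y)) / t" using t U y by (intro divide_right_mono) auto
      then have "0 \<le> a + exp (- (U * y)) / t - h' t" using h'1[of t] t y by simp
      moreover have "((\<lambda>t. a * t + exp (- (U * y)) * ln t - h t) has_real_derivative a + exp (- (U * y)) / t - h' t) (at t)"
        using t y der by (auto intro!: derivative_eq_intros)
      ultimately show "\<exists>z. ((\<lambda>t. a * t + exp (- (U * y)) * ln t - h t) has_real_derivative z) (at t) \<and> 0 \<le> z" by blast
    qed
    moreover have "max 0 (- ln y) = - ln y" using y y1 by simp
    moreover have "0 \<le> exp (- U) * y" using y by simp
    ultimately show ?thesis using y1 h1 unfolding h_def by (simp add: algebra_simps)
  qed
qed

text \<open>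
  The mean of \<open>frullani a U\<close> under the standard exponential law, the law of \<open>|Z|\<^sup>2\<close> for a standard complex
  Gaussian \<open>Z\<close>.
\<close>
definition gauss_frullani :: "real \<Rightarrow> real \<Rightarrow> real" where
  "gauss_frullani a U = integral {a..U} (\<lambda>u. (exp (- u) - 1 / (1 + u)) / u)"

lemma exp_minus_inverse_bounds:
  assumes "(0::real) < u"
  shows "(exp (- u) - 1 / (1 + u)) / u \<le> 0" "- 1 \<le> (exp (- u) - 1 / (1 + u)) / u"
    "- (1 / u\<^sup>2) \<le> (exp (- u) - 1 / (1 + u)) / u"
proof -
  have "exp (- u) \<le> 1 / (1 + u)"
    using assms exp_ge_add_one_self[of u] by (simp add: exp_minus field_simps)
  then show "(exp (- u) - 1 / (1 + u)) / u \<le> 0" using assms by (simp add: divide_le_0_iff)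
  have "1 / (1 + u) - exp (- u) \<le> u" 
  proof -
    have "1 / (1 + u) \<le> 1" using assms by simp
    then show ?thesis using exp_ge_add_one_self[of "- u"] by linarith
  qed
  then show "- 1 \<le> (exp (- u) - 1 / (1 + u)) / u" using assms by (simp add: le_divide_eq)
  have "1 / (1 + u) \<le> 1 / u" using assms by (intro divide_left_mono) auto
  then have "- (1 / u) \<le> exp (- u) - 1 / (1 + u)" by (smt (verit) exp_gt_zero)
  then have "- (1 / u) / u \<le> (exp (- u) - 1 / (1 + u)) / u" using assms by (intro divide_right_mono) auto
  then show "- (1 / u\<^sup>2) \<le> (exp (- u) - 1 / (1 + u)) / u" by (simp add: power2_eq_square)
qed

lemma gauss_frullani_integrable:
  "0 < a \<Longrightarrow> (\<lambda>u. (exp (- u) - 1 / (1 + u)) / u) integrable_on {a..U::real}"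
  by (intro integrable_continuous_real continuous_intros) auto

lemma gauss_frullani_extend:
  assumes "0 < a'" "a' \<le> a" "a \<le> U" "U \<le> U'"
  shows "\<bar>gauss_frullani a U - gauss_frullani a' U'\<bar> \<le> a + 1 / U"
proof -
  let ?f = "\<lambda>u::real. (exp (- u) - 1 / (1 + u)) / u"
  have "gauss_frullani a' U' = integral {a'..a} ?f + (integral {a..U} ?f + integral {U..U'} ?f)"
    unfolding gauss_frullani_def using assms
    by (subst Henstock_Kurzweil_Integration.integral_combine gauss_frullani_integrable; simp)+
  moreover have "integral {a'..a} ?f \<le> integral {a'..a} (\<lambda>_. 0)" "integral {U..U'} ?f \<le> integral {U..U'} (\<lambda>_. 0)"
    "integral {a'..a} (\<lambda>_. - 1) \<le> integral {a'..a} ?f"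
  proof -
    have i: "?f integrable_on {a'..a}" "?f integrable_on {U..U'}"
      using assms by (auto intro!: gauss_frullani_integrable)
    show "integral {a'..a} ?f \<le> integral {a'..a} (\<lambda>_. 0)"
      by (rule integral_le[OF i(1)]) (use assms in \<open>auto intro: exp_minus_inverse_bounds\<close>)
    show "integral {U..U'} ?f \<le> integral {U..U'} (\<lambda>_. 0)"
      by (rule integral_le[OF i(2)]) (use assms in \<open>auto intro: exp_minus_inverse_bounds\<close>)
    show "integral {a'..a} (\<lambda>_. - 1) \<le> integral {a'..a} ?f"
      by (rule integral_le[OF _ i(1)]) (use assms in \<open>auto intro: exp_minus_inverse_bounds\<close>)
  qed
  moreover have "integral {U..U'} (\<lambda>u. - (1 / u\<^sup>2)) \<le> integral {U..U'} ?f"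
  proof (rule integral_le)
    show "(\<lambda>u. - (1 / u\<^sup>2)) integrable_on {U..U'}" using assms by (intro integrable_continuous_real continuous_intros) auto
    show "?f integrable_on {U..U'}" using assms by (intro gauss_frullani_integrable) auto
  qed (use assms in \<open>auto intro: exp_minus_inverse_bounds\<close>)
  moreover have "((\<lambda>u. - (1 / u\<^sup>2)) has_integral 1 / U' - 1 / U) {U..U'}"
    using assms by (intro fundamental_theorem_of_calculus)
      (auto intro!: derivative_eq_intros simp: power2_eq_square simp flip: has_real_derivative_iff_has_vector_derivative)
  then have "integral {U..U'} (\<lambda>u. - (1 / u\<^sup>2)) = 1 / U' - 1 / U" by (rule integral_unique)
  moreover have "1 / U' \<ge> 0" using assms by simp
  moreover have "integral {a'..a} (\<lambda>_. - 1::real) = a' - a" using assms by simp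
  moreover have "integral {a'..a} (\<lambda>_. 0::real) = 0" "integral {U..U'} (\<lambda>_. 0::real) = 0" by simp_all
  ultimately show ?thesis using assms unfolding gauss_frullani_def by linarith
qed

lemma integral_inverse_power:
  assumes "0 < a" "a \<le> U" "0 < k"
  shows "((\<lambda>u. 1 / (1 + u) ^ (k + 1)) has_integral (1 / (1 + a) ^ k - 1 / (1 + U) ^ k) / real k) {a..U::real}"
proof -
  have "((\<lambda>u. 1 / (1 + u) ^ (k + 1)) has_integral - (1 / (1 + U) ^ k) / real k - - (1 / (1 + a) ^ k) / real k) {a..U}"
  proof (rule fundamental_theorem_of_calculus[OF assms(2)])
    fix u assume "u \<in> {a..U}"
    then have u: "1 + u > 0" using assms by auto
    have "((\<lambda>u. - inverse ((1 + u) ^ k) / real k) has_real_derivative 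
       inverse ((1 + u) ^ k) * (real k * (1 + u) ^ (k - 1)) * inverse ((1 + u) ^ k) / real k) (at u within {a..U})"
      using u by (auto intro!: derivative_eq_intros)
    moreover have "inverse (z ^ k) * (real k * z ^ (k - 1)) * inverse (z ^ k) / real k = 1 / z ^ (k + 1)"
      if "z > 0" for z :: real
      using that assms(3) by (cases k) (simp_all add: power_add inverse_eq_divide)
    note this[OF u]
    ultimately show "((\<lambda>u. - (1 / (1 + u) ^ k) / real k) has_vector_derivative 1 / (1 + u) ^ (k + 1)) (at u within {a..U})"
      by (simp add: inverse_eq_divide flip: has_real_derivative_iff_has_vector_derivative)
  qed
  then show ?thesis by (simp add: diff_divide_distrib)
qed


lemma power_one_plus_inverse_ge:
  assumes "(0::real) \<le> a" "a \<le> 1"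
  shows "1 - real k * a \<le> 1 / (1 + a) ^ k"
proof -
  have "1 - real k * a \<le> (1 - a) ^ k"
    using Bernoulli_inequality[of "- a" k] assms by simp
  also have "\<dots> \<le> (1 / (1 + a)) ^ k"
    using assms by (intro power_mono) (auto simp: field_simps)
  finally show ?thesis by (simp add: power_divide)
qed

lemma inverse_power_step:
  assumes "(0::real) < u"
  shows "u * (1 / (1 + u) ^ (k + 1)) = 1 / (1 + u) ^ k - 1 / (1 + u) ^ (k + 1)"
proof -
  have "1 / (1 + u) ^ k = (1 + u) / (1 + u) ^ (k + 1)" using assms by simp
  also have "\<dots> = 1 / (1 + u) ^ (k + 1) + u / (1 + u) ^ (k + 1)" by (rule add_divide_distrib)
  finally show ?thesis by simp
qed

text \<open>
  Compare \<open>exp (- n u)\<close> with \<open>(1 + u) ^ (- n)\<close> via \<open>u - u\<^sup>2 \<le> ln (1 + u) \<le> u\<close>. The right-hand side is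
  written as a combination of powers of \<open>1 / (1 + u)\<close> so that its integral is elementary and \<open>O(1 / n)\<close>.
\<close>
lemma exp_power_remainder:
  assumes u: "(0::real) < u" and n: "0 < n"
  shows "\<bar>exp (- (real n * u)) - 1 / (1 + u) ^ (n + 1)\<bar> / u \<le> real n * (1 / (1 + u) ^ (n - 1) - 1 / (1 + u) ^ n) + 1 / (1 + u) ^ (n + 1)"
proof -
  define g where "g = 1 / (1 + u) ^ n"
  have g: "g > 0" using u by (simp add: g_def)
  have ln: "u - u\<^sup>2 \<le> ln (1 + u)"
  proof (cases "u \<le> 1")
    case True then show ?thesis using u by (intro ln_one_plus_pos_lower_bound) auto
  next
    case False
    then have "u - u\<^sup>2 \<le> 0" by (simp add: power2_eq_square)
    also have "0 \<le> ln (1 + u)" using u by simp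
    finally show ?thesis .
  qed
  have gexp: "g = exp (- (real n * ln (1 + u)))"
    using u by (simp add: g_def exp_minus exp_of_nat_mult inverse_eq_divide)
  have "exp (- (real n * u)) \<le> g"
    unfolding gexp using u by (intro exp_mono) (auto intro!: mult_left_mono ln_add_one_self_le_self)
  moreover have "g - exp (- (real n * u)) \<le> real n * u\<^sup>2 * g"
  proof -
    have "exp (- (real n * u)) = g * exp (- (real n * (u - ln (1 + u))))"
      unfolding gexp by (simp add: algebra_simps flip: exp_add)
    moreover have "1 - real n * (u - ln (1 + u)) \<le> exp (- (real n * (u - ln (1 + u))))"
      using exp_ge_add_one_self[of "- (real n * (u - ln (1 + u)))"] by simp
    moreover have "real n * (u - ln (1 + u)) \<le> real n * u\<^sup>2" using ln by (intro mult_left_mono) auto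
    ultimately have "g * (1 - real n * u\<^sup>2) \<le> exp (- (real n * u))"
      using g by (auto intro!: mult_left_mono)
    then show ?thesis by (simp add: algebra_simps)
  qed
  moreover have "1 / (1 + u) ^ (n + 1) = g - u * (1 / (1 + u) ^ (n + 1))"
    using inverse_power_step[OF u, of n] by (simp add: g_def)
  ultimately have "\<bar>exp (- (real n * u)) - 1 / (1 + u) ^ (n + 1)\<bar> \<le> real n * u\<^sup>2 * g + u * (1 / (1 + u) ^ (n + 1))"
    using u by (smt (verit) zero_le_divide_1_iff zero_le_mult_iff zero_le_power)
  also have "\<dots> = u * (real n * (u * g) + 1 / (1 + u) ^ (n + 1))"
    by (simp add: power2_eq_square algebra_simps)
  also have "u * g = 1 / (1 + u) ^ (n - 1) - 1 / (1 + u) ^ n"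
    using inverse_power_step[OF u, of "n - 1"] n by (simp add: g_def)
  finally show ?thesis using u by (simp add: divide_le_eq mult.commute)
qed

text \<open>
  Insert \<open>exp (- n u)\<close> and \<open>(1 + u) ^ (- n - 1)\<close> between \<open>exp (- u)\<close> and \<open>1 / (1 + u)\<close>. The first difference
  is a Frullani integral for \<open>ln n\<close>, the last one is minus a geometric sum whose terms integrate to nearly
  \<open>1 / k\<close> and thus yields minus the harmonic number, and the middle one is small.
\<close>
lemma gauss_frullani_harmonic:
  assumes n: "n \<ge> (3::nat)" and a: "0 < a" "a \<le> 1" "a \<le> U"
  shows "\<bar>gauss_frullani a U - (ln (real n) - harm n)\<bar> \<le>
     a * real n + exp (- U) * real n + 2 * (real n * a + real n / (1 + U)) + (real n / ((real n - 1) * (real n - 2)) + 1 / real n)"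
proof -
  define T where "T k = integral {a..U} (\<lambda>u. 1 / (1 + u) ^ (k + 1))" for k
  define R where "R = integral {a..U} (\<lambda>u. (exp (- (u * real n)) - 1 / (1 + u) ^ (n + 1)) / u)"
  have U: "U > 0" using a by simp
  have T: "T k = (1 / (1 + a) ^ k - 1 / (1 + U) ^ k) / real k" if "k > 0" for k
    unfolding T_def using integral_inverse_power[of a U k] a that by (simp add: integral_unique)
  have Tint: "(\<lambda>u. 1 / (1 + u) ^ (k + 1)) integrable_on {a..U}" if "k > 0" for k
    using integral_inverse_power[of a U k] a that by (auto simp: integrable_on_def)
  \<comment> \<open>The geometric sum is \<open>(1 / (1 + u) - 1 / (1 + u) ^ (n + 1)) / u\<close>.\<close>
  have tele: "(exp (- u) - 1 / (1 + u)) / u = (exp (- u) - exp (- (u * real n))) / u - (\<Sum>k\<in>{1..n}. 1 / (1 + u) ^ (k + 1))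
      + (exp (- (u * real n)) - 1 / (1 + u) ^ (n + 1)) / u" if "u \<in> {a..U}" for u
  proof -
    have u: "u > 0" using that a by auto
    have *: "u * (\<Sum>k\<in>{1..m}. 1 / (1 + u) ^ (k + 1)) = 1 / (1 + u) - 1 / (1 + u) ^ (m + 1)" for m
      
    proof (induction m)
      case (Suc m)
      then show ?case using inverse_power_step[OF u, of "m + 1"] by (simp add: distrib_left)
    qed simp
    have "(\<Sum>k\<in>{1..n}. 1 / (1 + u) ^ (k + 1)) = u * (\<Sum>k\<in>{1..n}. 1 / (1 + u) ^ (k + 1)) / u"
      using u by simp
    then have "(\<Sum>k\<in>{1..n}. 1 / (1 + u) ^ (k + 1)) = (1 / (1 + u) - 1 / (1 + u) ^ (n + 1)) / u"
      unfolding * .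
    then show ?thesis by (simp add: diff_divide_distrib)
  qed
  have G: "gauss_frullani a U = frullani a U (real n) - (\<Sum>k\<in>{1..n}. T k) + R"
  proof -
    have i1: "(\<lambda>u. (exp (- u) - exp (- (u * real n))) / u) integrable_on {a..U}"
      using a by (intro integrable_continuous_real continuous_intros) auto
    have i2: "(\<lambda>u. \<Sum>k\<in>{1..n}. 1 / (1 + u) ^ (k + 1)) integrable_on {a..U}"
      by (intro integrable_sum Tint) auto
    have i3: "(\<lambda>u. (exp (- (u * real n)) - 1 / (1 + u) ^ (n + 1)) / u) integrable_on {a..U}"
      using a by (intro integrable_continuous_real continuous_intros) auto
    have "gauss_frullani a U = integral {a..U} (\<lambda>u. (exp (- u) - exp (- (u * real n))) / u - (\<Sum>k\<in>{1..n}. 1 / (1 + u) ^ (k + 1))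
      + (exp (- (u * real n)) - 1 / (1 + u) ^ (n + 1)) / u)"
      unfolding gauss_frullani_def by (rule Henstock_Kurzweil_Integration.integral_cong) (rule tele)
    also have "\<dots> = integral {a..U} (\<lambda>u. (exp (- u) - exp (- (u * real n))) / u - (\<Sum>k\<in>{1..n}. 1 / (1 + u) ^ (k + 1))) + R"
      unfolding R_def by (intro Henstock_Kurzweil_Integration.integral_add integrable_diff i1 i2 i3)
    also have "integral {a..U} (\<lambda>u. (exp (- u) - exp (- (u * real n))) / u - (\<Sum>k\<in>{1..n}. 1 / (1 + u) ^ (k + 1)))
        = frullani a U (real n) - integral {a..U} (\<lambda>u. \<Sum>k\<in>{1..n}. 1 / (1 + u) ^ (k + 1))"
      unfolding frullani_def by (intro Henstock_Kurzweil_Integration.integral_diff i1 i2)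
    also have "integral {a..U} (\<lambda>u. \<Sum>k\<in>{1..n}. 1 / (1 + u) ^ (k + 1)) = (\<Sum>k\<in>{1..n}. T k)"
      unfolding T_def by (intro Henstock_Kurzweil_Integration.integral_sum Tint) auto
    finally show ?thesis .
  qed
  have E1: "\<bar>ln (real n) - frullani a U (real n)\<bar> \<le> a * real n + exp (- U) * real n"
  proof -
    have "\<bar>ln (real n) - frullani a U (real n)\<bar> \<le> a * \<bar>real n - 1\<bar> + exp (- (U * real n)) * max 0 (- ln (real n)) + exp (- U) * real n"
      using a n by (intro ln_frullani) auto
    also have "max 0 (- ln (real n)) = 0" using n by simp
    also have "a * \<bar>real n - 1\<bar> \<le> a * real n" using a n by (intro mult_left_mono) auto
    finally show ?thesis by simp
  qed
  have TK: "\<bar>T k - inverse (real k)\<bar> \<le> a + 1 / (1 + U)" if k: "k > 0" for k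
  proof -
    have "1 / (1 + a) ^ k \<le> 1" using a by (simp add: divide_le_eq_1)
    moreover have "1 - real k * a \<le> 1 / (1 + a) ^ k" using a by (intro power_one_plus_inverse_ge) auto
    moreover have "0 \<le> 1 / (1 + U) ^ k" using U by simp
    moreover have "1 / (1 + U) ^ k \<le> real k * (1 / (1 + U))"
    proof -
      have "1 / (1 + U) ^ k \<le> 1 / (1 + U) ^ 1" using U k by (intro divide_left_mono power_increasing) auto
      also have "\<dots> \<le> real k * (1 / (1 + U))" using k U mult_right_mono[of 1 "real k" "1 / (1 + U)"] by simp
      finally show ?thesis .
    qed
    ultimately have "\<bar>1 / (1 + a) ^ k - 1 / (1 + U) ^ k - 1\<bar> \<le> real k * (a + 1 / (1 + U))"
      unfolding distrib_left abs_le_iff by linarith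
    then have "\<bar>1 / (1 + a) ^ k - 1 / (1 + U) ^ k - 1\<bar> / real k \<le> a + 1 / (1 + U)"
      using k by (simp add: divide_le_eq mult.commute)
    moreover have "T k - inverse (real k) = (1 / (1 + a) ^ k - 1 / (1 + U) ^ k - 1) / real k"
      using k by (simp add: T diff_divide_distrib inverse_eq_divide)
    ultimately show ?thesis by simp
  qed
  have E2: "\<bar>(\<Sum>k\<in>{1..n}. T k) - harm n\<bar> \<le> real n * a + real n / (1 + U)"
  proof -
    have "\<bar>\<Sum>k\<in>{1..n}. T k - inverse (real k)\<bar> \<le> (\<Sum>k\<in>{1..n}. a + 1 / (1 + U))"
      by (intro order_trans[OF sum_abs] sum_mono TK) auto
    then show ?thesis by (simp add: harm_def sum_subtractf distrib_left)
  qed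
  have E3: "\<bar>R\<bar> \<le> real n / ((real n - 1) * (real n - 2)) + 1 / real n + (real n * a + real n / (1 + U))"
  proof -
    have i: "(\<lambda>u. (exp (- (u * real n)) - 1 / (1 + u) ^ (n + 1)) / u) integrable_on {a..U}"
      using a by (intro integrable_continuous_real continuous_intros) auto
    have pow: "1 / (1 + u) ^ (n - 1) = 1 / (1 + u) ^ ((n - 2) + 1)" "1 / (1 + u) ^ n = 1 / (1 + u) ^ ((n - 1) + 1)" for u :: real
      using n by (simp_all add: Suc_diff_Suc numeral_2_eq_2)
    define F where "F k = (1 / (1 + a) ^ k - 1 / (1 + U) ^ k) / real k" for k
    have hi: "((\<lambda>u. real n * (1 / (1 + u) ^ (n - 1) - 1 / (1 + u) ^ n) + 1 / (1 + u) ^ (n + 1)) has_integral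
        real n * (F (n - 2) - F (n - 1)) + F n) {a..U}"
    proof -
      have "((\<lambda>u. 1 / (1 + u) ^ (k + 1)) has_integral F k) {a..U}" if "0 < k" for k
        unfolding F_def using a that by (intro integral_inverse_power) auto
      from this[of "n - 2"] this[of "n - 1"] this[of n] show ?thesis
        unfolding pow using n by (intro has_integral_add has_integral_mult_right has_integral_diff) auto
    qed
    have "\<bar>R\<bar> \<le> real n * (F (n - 2) - F (n - 1)) + F n"
      unfolding R_def real_norm_def[symmetric]
    proof (rule integral_norm_bound_integral[OF i, of "\<lambda>u. real n * (1 / (1 + u) ^ (n - 1) - 1 / (1 + u) ^ n) + 1 / (1 + u) ^ (n + 1)",
          unfolded integral_unique[OF hi]])
      fix u assume "u \<in> {a..U}"
      then have "u > 0" using a by auto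
      then show "norm ((exp (- (u * real n)) - 1 / (1 + u) ^ (n + 1)) / u)
          \<le> real n * (1 / (1 + u) ^ (n - 1) - 1 / (1 + u) ^ n) + 1 / (1 + u) ^ (n + 1)"
        using exp_power_remainder[of u n] n by (simp add: mult.commute)
    qed (use hi in blast)
    also have "\<dots> \<le> real n * (1 / (real n - 2) - 1 / (real n - 1)) + 1 / real n
        + (real n * a + real n / (1 + U))"
    proof -
      have Fle: "F k \<le> 1 / real k" if "k > 0" for k
      proof -
        have "1 / (1 + a) ^ k - 1 / (1 + U) ^ k \<le> 1 - 0"
          using a U by (intro diff_mono) (auto simp: divide_le_eq_1)
        then show ?thesis unfolding F_def by (intro divide_right_mono) auto
      qed
      have FT: "F k = T k" if "k > 0" for k using T[OF that] by (simp add: F_def)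
      have "F (n - 2) \<le> 1 / (real n - 2)" "F n \<le> 1 / real n" using Fle[of "n - 2"] Fle[of n] n by (auto simp: of_nat_diff)
      moreover have "1 / (real n - 1) - (a + 1 / (1 + U)) \<le> F (n - 1)"
        using TK[of "n - 1"] FT[of "n - 1"] n by (simp add: of_nat_diff inverse_eq_divide abs_le_iff)
      ultimately have "real n * (F (n - 2) - F (n - 1)) + F n \<le> real n * (1 / (real n - 2) - 1 / (real n - 1) + (a + 1 / (1 + U))) + 1 / real n"
        by (intro add_mono mult_left_mono) auto
      then show ?thesis by (simp add: distrib_left)
    qed
    also have "1 / (real n - 2) - 1 / (real n - 1) = 1 / ((real n - 1) * (real n - 2))"
      using n by (simp add: field_simps)
    finally show ?thesis by simp
  qed
  show ?thesis unfolding G using E1 E2 E3 unfolding abs_le_iff distrib_left by linarith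
qed


text \<open>
  Compare with the cut-offs \<open>1 / n\<^sup>2\<close> and \<open>n\<^sup>2\<close>, for which the integral approaches \<open>ln n - harm n\<close>, and let
  \<open>n\<close> tend to infinity.
\<close>
lemma gauss_frullani_limit:
  assumes a: "0 < a" "a \<le> U"
  shows "\<bar>gauss_frullani a U + euler_mascheroni\<bar> \<le> a + 1 / U"
proof -
  have U: "U > 0" using a by simp
  define e where "e n = (a + 1 / U) + ((1 / real n ^ 2) * real n + exp (- (real n ^ 2)) * real n
     + 2 * (real n * (1 / real n ^ 2) + real n / (1 + real n ^ 2)) + (real n / ((real n - 1) * (real n - 2)) + 1 / real n))" for n :: nat
  have "(\<lambda>n. \<bar>gauss_frullani a U - (ln (real n) - harm n)\<bar>) \<longlonglongrightarrow> \<bar>gauss_frullani a U + euler_mascheroni\<bar>"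
  proof -
    have "(\<lambda>n. \<bar>gauss_frullani a U + (harm n - ln (real n))\<bar>) \<longlonglongrightarrow> \<bar>gauss_frullani a U + euler_mascheroni\<bar>"
      by (intro tendsto_intros euler_mascheroni_LIMSEQ)
    then show ?thesis by (simp add: algebra_simps)
  qed
  moreover have "e \<longlonglongrightarrow> a + 1 / U" unfolding e_def by real_asymp
  moreover have "eventually (\<lambda>n. \<bar>gauss_frullani a U - (ln (real n) - harm n)\<bar> \<le> e n) sequentially"
  proof -
    have "eventually (\<lambda>n. 1 / real n ^ 2 \<le> a) sequentially" using a by real_asymp
    moreover have "eventually (\<lambda>n. U \<le> real n ^ 2) sequentially" by real_asymp
    ultimately show ?thesis using eventually_ge_at_top[of 3]
    proof eventually_elim
      case (elim n)
      have n: "1 \<le> real n" "1 \<le> real n ^ 2" using elim by auto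
      then have "1 / real n ^ 2 \<le> 1" by (simp add: divide_le_eq_1)
      then have "\<bar>gauss_frullani (1 / real n ^ 2) (real n ^ 2) - (ln (real n) - harm n)\<bar> \<le> e n - (a + 1 / U)"
        unfolding e_def add_diff_cancel_left'
        using elim n \<open>1 / real n ^ 2 \<le> 1\<close> order_trans[OF \<open>1 / real n ^ 2 \<le> 1\<close> n(2)]
        by (intro gauss_frullani_harmonic) simp_all
      moreover have "\<bar>gauss_frullani a U - gauss_frullani (1 / real n ^ 2) (real n ^ 2)\<bar> \<le> a + 1 / U"
        using elim a n by (intro gauss_frullani_extend) auto
      ultimately show ?case by linarith
    qed
  qed
  ultimately show ?thesis
    using tendsto_le[OF sequentially_bot] by blast
qed

section \<open>Small values of a polynomial on a circle\<close>

lemma nn_integral_powr_minus_half: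
  assumes "0 < b"
  shows "(\<integral>\<^sup>+s. ennreal (indicator {0..b} s * s powr (-1/2)) \<partial>lborel) = ennreal (2 * sqrt b)"
proof -
  have "((\<lambda>s. s powr (-1/2)) has_integral (b powr (-1/2 + 1) / (-1/2 + 1))) {0..b}"
    using assms by (intro has_integral_powr_from_0) auto
  moreover have "b powr (-1/2 + 1) / (-1/2 + 1) = 2 * sqrt b"
    using assms by (simp add: powr_half_sqrt)
  ultimately have "((\<lambda>s. s powr (-1/2)) has_integral (2 * sqrt b)) {0..b}" by (simp add: mult.commute)
  from nn_integral_has_integral_lebesgue[OF _ this]
  show ?thesis by simp
qed

text \<open>
  An integrable majorant of \<open>|sin s| powr (-1/2)\<close> around a zero of the sine.
\<close>
definition bump :: "real \<Rightarrow> real" where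
  "bump s = sqrt 2 * (indicator {0..pi/2} s * s powr (-1/2) + indicator {0..pi/2} (- s) * (- s) powr (-1/2))"

lemma bump_measurable [measurable]: "bump \<in> borel_measurable borel"
  unfolding bump_def by measurable

lemma bump_nonneg: "0 \<le> bump s"
  by (simp add: bump_def)

lemma nn_integral_bump: "(\<integral>\<^sup>+s. ennreal (bump (s - t)) \<partial>lborel) \<le> ennreal (4 * sqrt pi)"
proof -
  define h where "h s = ennreal (indicator {0..pi/2} s * s powr (-1/2))" for s :: real
  have [measurable]: "h \<in> borel_measurable borel" unfolding h_def by measurable
  have h: "(\<integral>\<^sup>+s. h s \<partial>lborel) = ennreal (2 * sqrt (pi / 2))"
    unfolding h_def by (rule nn_integral_powr_minus_half) simp
  have shift: "(\<integral>\<^sup>+s. f s \<partial>lborel) = (\<integral>\<^sup>+s. f (t + c * s) \<partial>lborel)"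
    if "\<bar>c\<bar> = 1" "f \<in> borel_measurable borel" for f :: "real \<Rightarrow> ennreal" and c t :: real
    using that nn_integral_real_affine[of f c t] by auto
  have "(\<integral>\<^sup>+s. ennreal (bump (s - t)) \<partial>lborel) = (\<integral>\<^sup>+s. ennreal (bump s) \<partial>lborel)"
    by (subst shift[where t=t and c=1]) auto
  also have "\<dots> = (\<integral>\<^sup>+s. ennreal (sqrt 2) * (h s + h (- s)) \<partial>lborel)"
    unfolding bump_def h_def by (intro nn_integral_cong) (simp add: ennreal_mult ennreal_plus)
  also have "\<dots> = ennreal (sqrt 2) * ((\<integral>\<^sup>+s. h s \<partial>lborel) + (\<integral>\<^sup>+s. h (- s) \<partial>lborel))"
    by (simp add: nn_integral_cmult nn_integral_add)
  also have "(\<integral>\<^sup>+s. h (- s) \<partial>lborel) = (\<integral>\<^sup>+s. h s \<partial>lborel)"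
    by (subst (2) shift[where t=0 and c="-1"]) auto
  also have "ennreal (sqrt 2) * ((\<integral>\<^sup>+s. h s \<partial>lborel) + (\<integral>\<^sup>+s. h s \<partial>lborel)) = ennreal (sqrt 2 * (2 * sqrt (pi / 2) + 2 * sqrt (pi / 2)))"
    unfolding h by (subst ennreal_plus[symmetric]; (subst ennreal_mult[symmetric])?; simp)
  also have "sqrt 2 * (2 * sqrt (pi / 2) + 2 * sqrt (pi / 2)) = 4 * sqrt pi"
    by (simp add: real_sqrt_divide)
  finally show ?thesis by simp
qed

lemma sin_le_bump:
  assumes "\<bar>s\<bar> \<le> pi / 2" "s \<noteq> 0"
  shows "\<bar>sin s\<bar> powr (-1/2) \<le> bump s"
proof -
  have *: "\<bar>sin s\<bar> powr (-1/2) \<le> sqrt 2 * s powr (-1/2)" if "0 < s" "s \<le> pi / 2" for s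
  proof -
    have "s / 2 \<le> sin s"
    proof -
      have "s / 2 * cos (s / 2) \<le> sin (s / 2)"
      proof -
        have "s / 2 \<le> tan (s / 2)"
          using abs_tan_ge[of "s / 2"] tan_pos_pi2_le[of "s / 2"] that by simp
        moreover have "cos (s / 2) > 0" using that by (intro cos_gt_zero_pi) auto
        ultimately show ?thesis by (simp add: tan_def field_simps)
      qed
      moreover have "cos (s / 2) > 0" using that by (intro cos_gt_zero_pi) auto
      ultimately have "2 * (s / 2 * cos (s / 2)) * cos (s / 2) \<le> 2 * sin (s / 2) * cos (s / 2)"
        by (intro mult_right_mono) auto
      also have "\<dots> = sin s" using sin_double[of "s / 2"] by simp
      finally have "s * (cos (s / 2))\<^sup>2 \<le> sin s" by (simp add: power2_eq_square mult_ac)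
      moreover have "(cos (s / 2))\<^sup>2 \<ge> 1 / 2"
        using cos_double_cos[of "s / 2"] cos_ge_zero[of s] that by simp
      then have "s * (1 / 2) \<le> s * (cos (s / 2))\<^sup>2" using that by (intro mult_left_mono) auto
      ultimately show ?thesis by simp
    qed
    then have "\<bar>sin s\<bar> powr (-1/2) \<le> (s / 2) powr (-1/2)"
      using that by (intro powr_mono2') auto
    also have "\<dots> = sqrt 2 * s powr (-1/2)"
      using that by (simp add: powr_divide powr_minus_divide powr_half_sqrt)
    finally show ?thesis .
  qed
  show ?thesis
  proof (cases "s > 0")
    case True
    then show ?thesis using *[of s] assms by (simp add: bump_def)
  next
    case False
    then show ?thesis using *[of "- s"] assms by (simp add: bump_def)
  qed
qed

text \<open>
  The nearest zero of the sine on \<open>[- 2 pi, 2 pi]\<close> is \<open>j pi\<close> with \<open>|j| \<le> 2\<close>.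
\<close>
lemma sin_shift_le_bumps:
  assumes s: "\<bar>s\<bar> \<le> 2 * pi" and nz: "sin s \<noteq> 0"
  shows "\<bar>sin s\<bar> powr (-1/2) \<le> (\<Sum>j\<in>{-2..2::int}. bump (s - of_int j * pi))"
proof -
  define j where "j = round (s / pi)"
  have j1: "\<bar>of_int j - s / pi\<bar> \<le> 1/2" unfolding j_def by (rule of_int_round_abs_le)
  have "\<bar>s / pi\<bar> \<le> 2" using s by (simp add: abs_divide divide_le_eq)
  then have "real_of_int j < 3" "- 3 < real_of_int j" using j1 by linarith+
  then have j2: "j \<in> {-2..2}" by auto
  have "s - of_int j * pi = - ((of_int j - s / pi) * pi)" by (simp add: field_simps)
  then have "\<bar>s - of_int j * pi\<bar> \<le> 1/2 * pi" using j1 by (simp only: abs_minus_cancel abs_mult) (intro mult_mono; simp)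
  moreover have "\<bar>sin s\<bar> = \<bar>sin (s - of_int j * pi)\<bar>"
    by (simp add: sin_diff mult.commute[of _ pi] sin_npi_int cos_npi_int)
  moreover from this nz have "s - of_int j * pi \<noteq> 0" by auto
  ultimately have "\<bar>sin s\<bar> powr (-1/2) \<le> bump (s - of_int j * pi)"
    using sin_le_bump[of "s - of_int j * pi"] by simp
  also have "\<dots> \<le> (\<Sum>j\<in>{-2..2::int}. bump (s - of_int j * pi))"
    using j2 by (intro member_le_sum) (auto simp: bump_nonneg)
  finally show ?thesis .
qed

lemma circle_nn_integral:
  assumes [measurable]: "f \<in> borel_measurable borel"
  shows "(\<integral>\<^sup>+x. f x \<partial>\<mu>) = (\<integral>\<^sup>+x. ennreal (indicator {-pi..pi} x / (2 * pi)) * f x \<partial>lborel)"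
  unfolding circle_measure_density by (subst nn_integral_density) auto

lemma AE_circle_countable:
  assumes "countable {\<theta>. \<not> P \<theta>}"
  shows "AE \<theta> in \<mu>. P \<theta>"
proof -
  have "{\<theta>. \<not> P \<theta>} \<in> null_sets lborel" using assms by (rule countable_imp_null_set_lborel)
  then have "AE \<theta> in lborel. P \<theta>" by (rule AE_I') auto
  then show ?thesis unfolding circle_measure_density by (subst AE_density) auto
qed

text \<open>
  The distance is at least the component orthogonal to the direction of \<open>w\<close>.
\<close>
lemma dist_circle_ge_sin:
  assumes "0 \<le> r"
  shows "r * \<bar>sin (\<theta> - Arg w)\<bar> \<le> norm (of_real r * cis \<theta> - w)"
proof -
  have "w = of_real (norm w) * cis (Arg w)"
    by (metis Arg_zero cis_Arg complex_sgn_def mult_zero_left norm_zero of_real_0 rcis_cmod_Arg rcis_def)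
  then have "(of_real r * cis \<theta> - w) * cis (- Arg w) = of_real r * cis (\<theta> - Arg w) - of_real (norm w)"
    by (metis (no_types, opaque_lifting) left_diff_distrib mult.assoc cis_mult diff_conv_add_uminus add.right_inverse cis_zero mult.right_neutral)
  then have "Im ((of_real r * cis \<theta> - w) * cis (- Arg w)) = r * sin (\<theta> - Arg w)" by simp
  then have "r * \<bar>sin (\<theta> - Arg w)\<bar> \<le> norm ((of_real r * cis \<theta> - w) * cis (- Arg w))"
    using abs_Im_le_cmod[of "(of_real r * cis \<theta> - w) * cis (- Arg w)"] assms by (simp add: abs_mult)
  then show ?thesis by (simp add: norm_mult)
qed

lemma countable_sin_zeros: "countable {\<theta>::real. sin (\<theta> - t) = 0}"
proof -
  have "{\<theta>::real. sin (\<theta> - t) = 0} \<subseteq> range (\<lambda>i::int. t + of_int i * pi)"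
    by (auto simp: sin_zero_iff_int2 algebra_simps)
  then show ?thesis by (rule countable_subset) auto
qed

text \<open>
  The point of this bound is its uniformity in \<open>w\<close>.
\<close>
lemma circle_inverse_sqrt_distance:
  assumes r: "1/2 \<le> r"
  shows "(\<integral>\<^sup>+\<theta>. ennreal (norm (of_real r * cis \<theta> - w) powr (-1/2)) \<partial>\<mu>) \<le> 10"
proof -
  define t where "t = Arg w"
  have t: "\<bar>t\<bar> \<le> pi" using Arg_bounded[of w] by (auto simp: t_def)
  have [measurable]: "(\<lambda>\<theta>. norm (of_real r * cis \<theta> - w)) \<in> borel_measurable borel"
    by (intro borel_measurable_continuous_onI continuous_intros)
  have "(\<integral>\<^sup>+\<theta>. ennreal (norm (of_real r * cis \<theta> - w) powr (-1/2)) \<partial>\<mu>) =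
      (\<integral>\<^sup>+\<theta>. ennreal (indicator {-pi..pi} \<theta> / (2 * pi)) * ennreal (norm (of_real r * cis \<theta> - w) powr (-1/2)) \<partial>lborel)"
    by (rule circle_nn_integral) auto
  also have "\<dots> \<le> (\<integral>\<^sup>+\<theta>. ennreal (sqrt 2 / (2 * pi)) * (\<Sum>j\<in>{-2..2::int}. ennreal (bump (\<theta> - (t + of_int j * pi)))) \<partial>lborel)"
  proof (rule nn_integral_mono_AE)
    have "{\<theta>. sin (\<theta> - t) = 0} \<in> null_sets lborel"
      by (intro countable_imp_null_set_lborel countable_sin_zeros)
    then have "AE \<theta> in lborel. sin (\<theta> - t) \<noteq> 0" by (rule AE_I') auto
    then show "AE \<theta> in lborel. ennreal (indicator {-pi..pi} \<theta> / (2 * pi)) * ennreal (norm (of_real r * cis \<theta> - w) powr (-1/2))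
       \<le> ennreal (sqrt 2 / (2 * pi)) * (\<Sum>j\<in>{-2..2::int}. ennreal (bump (\<theta> - (t + of_int j * pi))))"
    proof eventually_elim
      case (elim \<theta>)
      show ?case
      proof (cases "\<theta> \<in> {-pi..pi}")
        case True
        then have s: "\<bar>\<theta> - t\<bar> \<le> 2 * pi" using t by auto
        have "1/2 * \<bar>sin (\<theta> - t)\<bar> \<le> r * \<bar>sin (\<theta> - t)\<bar>" using r by (intro mult_right_mono) auto
        also have "\<dots> \<le> norm (of_real r * cis \<theta> - w)" unfolding t_def using r by (intro dist_circle_ge_sin) auto
        finally have "norm (of_real r * cis \<theta> - w) powr (-1/2) \<le> (1/2 * \<bar>sin (\<theta> - t)\<bar>) powr (-1/2)"
          using elim by (intro powr_mono2') auto
        also have "\<dots> = sqrt 2 * \<bar>sin (\<theta> - t)\<bar> powr (-1/2)"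
          by (simp add: powr_mult powr_divide powr_minus_divide powr_half_sqrt real_sqrt_divide)
        also have "\<dots> \<le> sqrt 2 * (\<Sum>j\<in>{-2..2::int}. bump (\<theta> - t - of_int j * pi))"
          using sin_shift_le_bumps[OF s elim] by (intro mult_left_mono) auto
        finally have "norm (of_real r * cis \<theta> - w) powr (-1/2) / (2 * pi) \<le> sqrt 2 * (\<Sum>j\<in>{-2..2::int}. bump (\<theta> - t - of_int j * pi)) / (2 * pi)"
          by (intro divide_right_mono) auto
        then have "ennreal (norm (of_real r * cis \<theta> - w) powr (-1/2) / (2 * pi)) \<le> ennreal (sqrt 2 / (2 * pi) * (\<Sum>j\<in>{-2..2::int}. bump (\<theta> - (t + of_int j * pi))))"
          by (intro ennreal_leI) (simp add: algebra_simps)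
        also have "\<dots> = ennreal (sqrt 2 / (2 * pi)) * (\<Sum>j\<in>{-2..2::int}. ennreal (bump (\<theta> - (t + of_int j * pi))))"
          by (subst ennreal_mult) (auto simp: sum_nonneg bump_nonneg sum_ennreal)
        also have "ennreal (norm (of_real r * cis \<theta> - w) powr (-1/2) / (2 * pi)) =
            ennreal (indicator {-pi..pi} \<theta> / (2 * pi)) * ennreal (norm (of_real r * cis \<theta> - w) powr (-1/2))"
          using True by (simp flip: ennreal_mult)
        finally show ?thesis .
      qed auto
    qed
  qed
  also have "\<dots> = ennreal (sqrt 2 / (2 * pi)) * (\<Sum>j\<in>{-2..2::int}. \<integral>\<^sup>+\<theta>. ennreal (bump (\<theta> - (t + of_int j * pi))) \<partial>lborel)"
    by (subst nn_integral_cmult) (auto simp: nn_integral_sum)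
  also have "\<dots> \<le> ennreal (sqrt 2 / (2 * pi)) * (\<Sum>j\<in>{-2..2::int}. ennreal (4 * sqrt pi))"
    by (intro mult_left_mono sum_mono nn_integral_bump) auto
  also have "\<dots> = ennreal (sqrt 2 / (2 * pi) * (20 * sqrt pi))"
    by (subst sum_ennreal, simp, subst ennreal_mult[symmetric]) simp_all
  also have "sqrt 2 / (2 * pi) * (20 * sqrt pi) \<le> 10"
  proof -
    have "sqrt 2 * sqrt pi \<le> pi" 
      unfolding real_sqrt_mult[symmetric] by (rule real_le_lsqrt) (use pi_gt3 in \<open>auto simp: power2_eq_square\<close>)
    then show ?thesis by (simp add: field_simps)
  qed
  finally show ?thesis by (simp add: ennreal_leI)
qed


text \<open>
  A product of \<open>d\<close> distances is at least the \<open>d\<close>-th power of the smallest one.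
\<close>
lemma poly_near_root:
  fixes p :: "complex poly"
  assumes d: "degree p > 0" and lc: "1 \<le> norm (lead_coeff p)"
  obtains root where "\<And>z. \<exists>i<degree p. norm (z - root i) powr (real (degree p)) \<le> norm (poly p z)"
    "\<And>i. i < degree p \<Longrightarrow> poly p (root i) = 0"
proof -
  obtain root where root: "smult (lead_coeff p) (\<Prod>i<degree p. [:- root i, 1:]) = p"
    using complex_poly_decompose'[of p] by metis
  have eval: "poly p z = lead_coeff p * (\<Prod>i<degree p. z - root i)" for z
    using arg_cong[OF root, of "\<lambda>q. poly q z"] by (simp add: poly_prod)
  show ?thesis
  proof
    fix z
    show "\<exists>i<degree p. norm (z - root i) powr (real (degree p)) \<le> norm (poly p z)"
    proof (rule ccontr)
      assume "\<not> ?thesis"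
      then have far: "norm (poly p z) < norm (z - root i) powr (real (degree p))" if "i < degree p" for i
        using that by (force simp: not_le)
      define m where "m = Min ((\<lambda>i. norm (z - root i)) ` {..<degree p})"
      have "m \<in> (\<lambda>i. norm (z - root i)) ` {..<degree p}"
        unfolding m_def using d by (intro Min_in) auto
      then obtain i where i: "i < degree p" "m = norm (z - root i)" by auto
      have "m ^ degree p = (\<Prod>i<degree p. m)" by simp
      also have "\<dots> \<le> (\<Prod>i<degree p. norm (z - root i))"
      proof (rule prod_mono)
        fix k assume "k \<in> {..<degree p}"
        then have "m \<le> norm (z - root k)" unfolding m_def by (intro Min_le) auto
        then show "0 \<le> m \<and> m \<le> norm (z - root k)" using i(2) by simp
      qed
      also have "\<dots> \<le> norm (poly p z)"
        unfolding eval norm_mult prod_norm[symmetric]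
        using mult_right_mono[OF lc, of "\<Prod>i<degree p. norm (z - root i)"] by (simp add: prod_nonneg)
      also have "\<dots> < m powr (real (degree p))" using far[OF i(1)] i(2) by simp
      also have "\<dots> = m ^ degree p" using d i(2) by (cases "m = 0") (auto simp: powr_realpow)
      finally show False by simp
    qed
  next
    show "poly p (root i) = 0" if "i < degree p" for i using that unfolding eval by auto
  qed
qed

lemma AE_circle_poly_nonzero:
  fixes p :: "complex poly"
  assumes r: "0 < r" and p: "p \<noteq> 0"
  shows "AE \<theta> in \<mu>. poly p (of_real r * cis \<theta>) \<noteq> 0"
proof (rule AE_circle_countable)
  have "{\<theta>. \<not> poly p (of_real r * cis \<theta>) \<noteq> 0} \<subseteq> (\<Union>w\<in>{w. poly p w = 0}. {\<theta>. sin (\<theta> - Arg w) = 0})"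
  proof
    fix \<theta> assume "\<theta> \<in> {\<theta>. \<not> poly p (of_real r * cis \<theta>) \<noteq> 0}"
    then have z: "poly p (of_real r * cis \<theta>) = 0" by simp
    have "r * \<bar>sin (\<theta> - Arg (of_real r * cis \<theta>))\<bar> \<le> 0"
      using dist_circle_ge_sin[of r \<theta> "of_real r * cis \<theta>"] r by simp
    then have "sin (\<theta> - Arg (of_real r * cis \<theta>)) = 0" using r by (simp add: mult_le_0_iff)
    with z show "\<theta> \<in> (\<Union>w\<in>{w. poly p w = 0}. {\<theta>. sin (\<theta> - Arg w) = 0})"
      by (intro UN_I[where a="of_real r * cis \<theta>"]) simp_all
  qed
  moreover have "countable (\<Union>w\<in>{w. poly p w = 0}. {\<theta>. sin (\<theta> - Arg w) = 0})"
    using p by (intro countable_UN countable_sin_zeros countable_finite poly_roots_finite)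
  ultimately show "countable {\<theta>. \<not> poly p (of_real r * cis \<theta>) \<noteq> 0}" by (rule countable_subset)
qed

lemma poly_circle_measurable [measurable]: "(\<lambda>\<theta>. poly p (of_real r * cis \<theta>)) \<in> borel_measurable borel"
  by (intro borel_measurable_continuous_onI continuous_intros)

text \<open>
  By \<open>poly_near_root\<close> the integrand is at most the sum over the roots of the inverse square roots of the
  distances.
\<close>
lemma circle_poly_inverse_power:
  fixes p :: "complex poly"
  assumes d: "degree p > 0" and lc: "1 \<le> norm (lead_coeff p)" and r: "1/2 \<le> r"
  shows "(\<integral>\<^sup>+\<theta>. ennreal (norm (poly p (of_real r * cis \<theta>)) powr (- 1 / (2 * real (degree p)))) \<partial>\<mu>) \<le> ennreal (10 * real (degree p))"
proof -
  obtain root where root: "\<And>z. \<exists>i<degree p. norm (z - root i) powr (real (degree p)) \<le> norm (poly p z)"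
    "\<And>i. i < degree p \<Longrightarrow> poly p (root i) = 0"
    by (rule poly_near_root[OF d lc]) blast
  have [measurable]: "(\<lambda>\<theta>. norm (of_real r * cis \<theta> - w)) \<in> borel_measurable borel" for w
    by (intro borel_measurable_continuous_onI continuous_intros)
  have pt: "norm (poly p z) powr (- 1 / (2 * real (degree p))) \<le> (\<Sum>i<degree p. norm (z - root i) powr (-1/2))"
    for z
  proof (cases "poly p z = 0")
    case False
    obtain i where i: "i < degree p" "norm (z - root i) powr (real (degree p)) \<le> norm (poly p z)" using root(1) by blast
    then have nz: "z \<noteq> root i" using root(2) False by blast
    have "norm (poly p z) powr (- 1 / (2 * real (degree p))) \<le> (norm (z - root i) powr (real (degree p))) powr (- 1 / (2 * real (degree p)))"
      using i nz d by (intro powr_mono2') auto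
    also have "\<dots> = norm (z - root i) powr (-1/2)" using d by (simp add: powr_powr)
    also have "\<dots> \<le> (\<Sum>i<degree p. norm (z - root i) powr (-1/2))"
      using i by (intro member_le_sum) auto
    finally show ?thesis .
  qed (auto intro!: sum_nonneg)
  have "(\<integral>\<^sup>+\<theta>. ennreal (norm (poly p (of_real r * cis \<theta>)) powr (- 1 / (2 * real (degree p)))) \<partial>\<mu>)
     \<le> (\<integral>\<^sup>+\<theta>. (\<Sum>i<degree p. ennreal (norm (of_real r * cis \<theta> - root i) powr (-1/2))) \<partial>\<mu>)"
    using pt by (intro nn_integral_mono) (simp add: sum_ennreal ennreal_leI)
  also have "\<dots> = (\<Sum>i<degree p. \<integral>\<^sup>+\<theta>. ennreal (norm (of_real r * cis \<theta> - root i) powr (-1/2)) \<partial>\<mu>)"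
    by (rule nn_integral_sum) measurable
  also have "\<dots> \<le> (\<Sum>i<degree p. ennreal 10)"
    using circle_inverse_sqrt_distance[OF r] by (intro sum_mono) simp
  also have "\<dots> = ennreal (10 * real (degree p))"
    by (subst sum_ennreal) (simp_all add: mult.commute)
  finally show ?thesis .
qed

text \<open>
  A Cartan type estimate, obtained from \<open>circle_poly_inverse_power\<close> by Markov's inequality.
\<close>
lemma circle_poly_small:
  fixes p :: "complex poly"
  assumes d: "degree p > 0" and lc: "1 \<le> norm (lead_coeff p)" and r: "1/2 \<le> r" and \<delta>: "0 < \<delta>"
  shows "measure \<mu> {\<theta>. norm (poly p (of_real r * cis \<theta>)) \<le> \<delta>} \<le> 10 * real (degree p) * \<delta> powr (1 / (2 * real (degree p)))"
proof -
  define e where "e = 1 / (2 * real (degree p))"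
  have e: "e > 0" "- 1 / (2 * real (degree p)) = - e" using d by (auto simp: e_def)
  have p0: "p \<noteq> 0" using d by auto
  have "emeasure \<mu> {\<theta>. norm (poly p (of_real r * cis \<theta>)) \<le> \<delta>}
      = (\<integral>\<^sup>+\<theta>. indicator {\<theta>. norm (poly p (of_real r * cis \<theta>)) \<le> \<delta>} \<theta> \<partial>\<mu>)"
    by (subst nn_integral_indicator) measurable
  also have "\<dots> \<le> (\<integral>\<^sup>+\<theta>. ennreal (\<delta> powr e) * ennreal (norm (poly p (of_real r * cis \<theta>)) powr (- e)) \<partial>\<mu>)"
  proof (rule nn_integral_mono_AE)
    have "AE \<theta> in \<mu>. poly p (of_real r * cis \<theta>) \<noteq> 0" using r p0 by (intro AE_circle_poly_nonzero) auto
    then show "AE \<theta> in \<mu>. indicator {\<theta>. norm (poly p (of_real r * cis \<theta>)) \<le> \<delta>} \<theta> \<le>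
         ennreal (\<delta> powr e) * ennreal (norm (poly p (of_real r * cis \<theta>)) powr (- e))"
    proof eventually_elim
      case (elim \<theta>)
      define y where "y = norm (poly p (of_real r * cis \<theta>))"
      have y: "y > 0" using elim by (simp add: y_def)
      have "1 \<le> \<delta> powr e * y powr (- e)" if "y \<le> \<delta>"
      proof -
        have "y powr e \<le> \<delta> powr e" using that y e by (intro powr_mono2) auto
        then show ?thesis using y by (simp add: powr_minus field_simps)
      qed
      then have "indicator {\<theta>. norm (poly p (of_real r * cis \<theta>)) \<le> \<delta>} \<theta> \<le> ennreal (\<delta> powr e * y powr (- e))"
        unfolding y_def by (auto simp: indicator_def)
      then show ?case by (simp add: ennreal_mult y_def)
    qed
  qed
  also have "\<dots> = ennreal (\<delta> powr e) * (\<integral>\<^sup>+\<theta>. ennreal (norm (poly p (of_real r * cis \<theta>)) powr (- e)) \<partial>\<mu>)"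
    by (rule nn_integral_cmult) measurable
  also have "\<dots> \<le> ennreal (\<delta> powr e) * ennreal (10 * real (degree p))"
    using circle_poly_inverse_power[OF d lc r] unfolding e(2) by (intro mult_left_mono) auto
  also have "\<dots> = ennreal (10 * real (degree p) * \<delta> powr e)"
    by (simp add: ennreal_mult mult.commute)
  finally show ?thesis unfolding e_def[symmetric]
    by (simp add: circle.emeasure_eq_measure)
qed

section \<open>Tiny values of random polynomials\<close>

text \<open>
  The halved differences of two distinct sign vectors of length \<open>m\<close>.
\<close>
definition nonzero_trits :: "nat \<Rightarrow> (nat \<Rightarrow> real) set" where
  "nonzero_trits m = PiE {..<m} (\<lambda>_. {-1, 0, 1}) - {\<lambda>k\<in>{..<m}. 0}"

lemma finite_nonzero_trits [simp]: "finite (nonzero_trits m)"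
  unfolding nonzero_trits_def by (intro finite_Diff finite_PiE) auto

lemma card_nonzero_trits: "card (nonzero_trits m) \<le> 3 ^ m"
proof -
  have "card (nonzero_trits m) \<le> card (PiE {..<m} (\<lambda>_. {-1, 0, 1::real}))"
    unfolding nonzero_trits_def by (intro card_mono finite_PiE) auto
  also have "\<dots> = 3 ^ m" by (subst card_PiE) (auto simp: numeral_3_eq_3)
  finally show ?thesis .
qed

text \<open>
  If no polynomial with coefficients in \<open>{-1, 0, 1}\<close> is small at \<open>z\<close>, then a sign vector with a small value
  is determined by its entries from \<open>m\<close> on: two such vectors that agree there have a halved difference of
  modulus at most \<open>\<delta>\<close>. This leaves a proportion of at most \<open>2 ^ (- m)\<close>.
\<close>
lemma anticoncentration:
  fixes z :: complex
  assumes mn: "m \<le> n"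
  shows "sign_mean n (\<lambda>x. of_bool (norm (littlewood_poly n x z) \<le> \<delta>)) \<le>
     1 / 2 ^ m + (\<Sum>e\<in>nonzero_trits m. of_bool (norm (littlewood_poly m e z) \<le> \<delta>))"
proof (cases "\<exists>e\<in>nonzero_trits m. norm (littlewood_poly m e z) \<le> \<delta>")
  case True
  then obtain e where e: "e \<in> nonzero_trits m" "norm (littlewood_poly m e z) \<le> \<delta>" by blast
  have "sign_mean n (\<lambda>x. of_bool (norm (littlewood_poly n x z) \<le> \<delta>)) \<le> sign_mean n (\<lambda>_. 1)"
    by (intro sign_mean_mono) auto
  also have "\<dots> = of_bool (norm (littlewood_poly m e z) \<le> \<delta>)" using e by simp
  also have "\<dots> \<le> (\<Sum>e\<in>nonzero_trits m. of_bool (norm (littlewood_poly m e z) \<le> \<delta>))"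
    using e by (intro member_le_sum) auto
  finally show ?thesis by (rule add_increasing[rotated]) simp
next
  case False
  define A where "A = {x \<in> signs n. norm (littlewood_poly n x z) \<le> \<delta>}"
  define B where "B = PiE {m..<n} (\<lambda>_. {1, -1::real})"
  have inj: "inj_on (\<lambda>x. restrict x {m..<n}) A"
  proof (rule inj_onI)
    fix x y assume x: "x \<in> A" and y: "y \<in> A" and eq: "restrict x {m..<n} = restrict y {m..<n}"
    have xy: "x \<in> signs n" "y \<in> signs n" using x y by (auto simp: A_def)
    have eq': "x k = y k" if "m \<le> k" "k < n" for k
      using fun_cong[OF eq, of k] that by simp
    define e where "e = (\<lambda>k\<in>{..<m}. (x k - y k) / 2)"
    have e_val: "e k = (x k - y k) / 2" if "k < m" for k using that by (simp add: e_def)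
    have "e \<in> PiE {..<m} (\<lambda>_. {-1, 0, 1})"
    proof (rule PiE_I)
      fix k assume "k \<in> {..<m}"
      then show "e k \<in> {-1, 0, 1}"
        using signs_values[OF xy(1), of k] signs_values[OF xy(2), of k] mn by (auto simp: e_val)
    qed (auto simp: e_def)
    moreover have "norm (littlewood_poly m e z) \<le> \<delta>"
    proof -
      have "littlewood_poly n x z - littlewood_poly n y z = (\<Sum>k<n. of_real (x k - y k) * z ^ k)"
        by (simp add: littlewood_poly_def sum_subtractf left_diff_distrib)
      also have "\<dots> = (\<Sum>k<m. of_real (x k - y k) * z ^ k)"
        using eq' mn by (intro sum.mono_neutral_right) auto
      also have "\<dots> = 2 * littlewood_poly m e z"
        by (simp add: littlewood_poly_def sum_distrib_left e_val)
      finally have "2 * norm (littlewood_poly m e z) = norm (littlewood_poly n x z - littlewood_poly n y z)"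
        by (simp add: norm_mult)
      also have "\<dots> \<le> norm (littlewood_poly n x z) + norm (littlewood_poly n y z)" by (rule norm_triangle_ineq4)
      also have "\<dots> \<le> \<delta> + \<delta>" using x y by (intro add_mono) (auto simp: A_def)
      finally show ?thesis by simp
    qed
    ultimately have "e = (\<lambda>k\<in>{..<m}. 0)" using False by (auto simp: nonzero_trits_def)
    then have "x k = y k" if "k < m" for k using e_val[OF that] that by simp
    then have "x k = y k" if "k < n" for k using eq' that by (cases "k < m") auto
    then show "x = y" using xy unfolding signs_def by (intro PiE_ext[of x "{..<n}" "\<lambda>_. {1,-1}"]) auto
  qed
  have "card A \<le> card B"
  proof (rule card_inj_on_le[OF inj])
    show "(\<lambda>x. restrict x {m..<n}) ` A \<subseteq> B"
      by (auto simp: A_def B_def dest: signs_values)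
    show "finite B" unfolding B_def by (intro finite_PiE) auto
  qed
  also have "card B = 2 ^ (n - m)" unfolding B_def by (subst card_PiE) (auto simp: numeral_2_eq_2)
  finally have card: "card A \<le> 2 ^ (n - m)" .
  have "sign_mean n (\<lambda>x. of_bool (norm (littlewood_poly n x z) \<le> \<delta>)) = real (card A) / 2 ^ n"
    by (simp add: sign_mean_def A_def sum.If_cases of_bool_def Int_def)
  also have "\<dots> \<le> real (2 ^ (n - m)) / 2 ^ n"
    using card by (intro divide_right_mono of_nat_mono) auto
  also have "real (2 ^ (n - m)) = 2 ^ n / 2 ^ m"
    using mn by (simp only: of_nat_power of_nat_numeral) (simp add: power_diff)
  also have "2 ^ n / 2 ^ m / 2 ^ n = (1 / 2 ^ m :: real)" by simp
  finally have "sign_mean n (\<lambda>x. of_bool (norm (littlewood_poly n x z) \<le> \<delta>)) \<le> 1 / 2 ^ m" .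
  moreover have "0 \<le> (\<Sum>e\<in>nonzero_trits m. of_bool (norm (littlewood_poly m e z) \<le> \<delta>) :: real)" by (intro sum_nonneg) auto
  ultimately show ?thesis by linarith
qed

definition coeff_poly :: "nat \<Rightarrow> (nat \<Rightarrow> real) \<Rightarrow> complex poly" where
  "coeff_poly n x = (\<Sum>k<n. monom (of_real (x k)) k)"

lemma poly_coeff_poly: "poly (coeff_poly n x) z = littlewood_poly n x z"
  by (simp add: coeff_poly_def littlewood_poly_def poly_sum poly_monom)

lemma coeff_coeff_poly: "coeff (coeff_poly n x) k = (if k < n then of_real (x k) else 0)"
  by (simp add: coeff_poly_def coeff_sum)

lemma littlewood_circle_measurable [measurable]:
  "(\<lambda>\<theta>. littlewood_poly n x (of_real r * cis \<theta>)) \<in> borel_measurable borel"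
  unfolding poly_coeff_poly[symmetric] by measurable

lemma degree_coeff_poly_less: "coeff_poly n x \<noteq> 0 \<Longrightarrow> degree (coeff_poly n x) < n"
  using leading_coeff_0_iff[of "coeff_poly n x"] by (auto simp: coeff_coeff_poly split: if_splits)

lemma trit_poly_small:
  assumes e: "e \<in> nonzero_trits m" and r: "1/2 \<le> r" and \<delta>: "0 < \<delta>" "\<delta> < 1"
  shows "measure \<mu> {\<theta>. norm (littlewood_poly m e (of_real r * cis \<theta>)) \<le> \<delta>} \<le> 10 * real m * \<delta> powr (1 / (2 * real m))"
proof -
  define p where "p = coeff_poly m e"
  have vals: "e k \<in> {-1, 0, 1}" if "k < m" for k using e that by (auto simp: nonzero_trits_def dest: PiE_mem)
  have "\<exists>k<m. e k \<noteq> 0"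
  proof (rule ccontr)
    assume "\<not> ?thesis"
    then have "e = (\<lambda>k\<in>{..<m}. 0)"
      using e by (intro PiE_ext[of e "{..<m}" "\<lambda>_. {-1,0,1}"]) (auto simp: nonzero_trits_def)
    then show False using e by (simp add: nonzero_trits_def)
  qed
  then have p0: "p \<noteq> 0" by (auto simp: p_def poly_eq_iff coeff_coeff_poly)
  then have d: "degree p < m" unfolding p_def by (rule degree_coeff_poly_less)
  have "lead_coeff p \<noteq> 0" using p0 by simp
  then have "lead_coeff p = of_real (e (degree p))" "e (degree p) \<noteq> 0"
    using d by (auto simp: p_def coeff_coeff_poly)
  then have lc: "norm (lead_coeff p) = 1" using vals[OF d] by auto
  show ?thesis
  proof (cases "degree p = 0")
    case True
    then have "poly p z = lead_coeff p" for z by (metis degree_0_id poly_const_conv coeff_pCons_0 degree_eq_zeroE)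
    then have "{\<theta>. norm (littlewood_poly m e (of_real r * cis \<theta>)) \<le> \<delta>} = {}"
      using lc \<delta> by (auto simp: p_def poly_coeff_poly)
    then show ?thesis by (simp add: measure_empty)
  next
    case False
    have "measure \<mu> {\<theta>. norm (littlewood_poly m e (of_real r * cis \<theta>)) \<le> \<delta>} \<le> 10 * real (degree p) * \<delta> powr (1 / (2 * real (degree p)))"
      using circle_poly_small[of p r \<delta>] False lc r \<delta> by (simp add: p_def poly_coeff_poly)
    also have "\<dots> \<le> 10 * real m * \<delta> powr (1 / (2 * real m))"
      using d False \<delta> by (intro mult_mono powr_mono' divide_left_mono) auto
    finally show ?thesis .
  qed
qed

lemma exp_four_ge: "(12::real) \<le> exp 4"
proof -
  have "(2::real) ^ 4 \<le> exp 1 ^ 4" using exp_ge_add_one_self[of "1::real"] by (intro power_mono) auto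
  also have "exp 1 ^ 4 = exp (4::real)" by (simp flip: exp_of_nat_mult)
  finally show ?thesis by simp
qed

text \<open>
  At the threshold \<open>exp (- 8 m\<^sup>2)\<close> each of the at most \<open>3 ^ m\<close> polynomials is small on a set of measure at
  most \<open>10 m exp (- 4 m)\<close>, and \<open>exp 4 \<ge> 12\<close> makes the total \<open>O(2 ^ (- m))\<close>.
\<close>
lemma littlewood_small_mean:
  assumes m: "1 \<le> m" "m \<le> n" and r: "1/2 \<le> r"
  shows "(\<integral>\<theta>. sign_mean n (\<lambda>x. of_bool (norm (littlewood_poly n x (of_real r * cis \<theta>)) \<le> exp (- 8 * real m ^ 2))) \<partial>\<mu>) \<le> 11 / 2 ^ m"
proof -
  define \<delta> where "\<delta> = exp (- 8 * real m ^ 2)"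
  have \<delta>: "0 < \<delta>" "\<delta> < 1" using m by (auto simp: \<delta>_def)
  have meas [measurable]: "{\<theta>. norm (littlewood_poly k e (of_real r * cis \<theta>)) \<le> \<delta>} \<in> sets borel" for k e
    by measurable
  have int: "integrable \<mu> (\<lambda>\<theta>. of_bool (norm (littlewood_poly k e (of_real r * cis \<theta>)) \<le> \<delta>) :: real)" for k e
    by (rule circle_integrable_bounded[where B=1]) (auto simp: of_bool_def)
  have val: "(\<integral>\<theta>. of_bool (norm (littlewood_poly k e (of_real r * cis \<theta>)) \<le> \<delta>) \<partial>\<mu>) =
      measure \<mu> {\<theta>. norm (littlewood_poly k e (of_real r * cis \<theta>)) \<le> \<delta>}" for k e
  proof -
    have "(\<lambda>\<theta>. of_bool (norm (littlewood_poly k e (of_real r * cis \<theta>)) \<le> \<delta>) :: real) =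
       indicator {\<theta>. norm (littlewood_poly k e (of_real r * cis \<theta>)) \<le> \<delta>}"
      by (auto simp: indicator_def)
    then show ?thesis by simp
  qed
  have "\<delta> powr (1 / (2 * real m)) = exp (- 4 * real m)"
    using m by (simp add: \<delta>_def powr_def power2_eq_square field_simps)
  also have "\<dots> = inverse (exp 4 ^ m)" by (simp add: exp_minus exp_of_nat_mult mult.commute)
  also have "\<dots> \<le> inverse (12 ^ m)" using exp_four_ge by (intro le_imp_inverse_le power_mono) auto
  finally have dm: "\<delta> powr (1 / (2 * real m)) \<le> inverse (12 ^ m)" .
  have "(\<integral>\<theta>. sign_mean n (\<lambda>x. of_bool (norm (littlewood_poly n x (of_real r * cis \<theta>)) \<le> \<delta>)) \<partial>\<mu>)
     \<le> (\<integral>\<theta>. 1 / 2 ^ m + (\<Sum>e\<in>nonzero_trits m. of_bool (norm (littlewood_poly m e (of_real r * cis \<theta>)) \<le> \<delta>)) \<partial>\<mu>)"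
    using m int by (intro integral_mono integrable_sign_mean anticoncentration Bochner_Integration.integrable_add Bochner_Integration.integrable_sum) auto
  also have "\<dots> = 1 / 2 ^ m + (\<Sum>e\<in>nonzero_trits m. measure \<mu> {\<theta>. norm (littlewood_poly m e (of_real r * cis \<theta>)) \<le> \<delta>})"
    using int circle.prob_space
    by (subst Bochner_Integration.integral_add) (auto simp: Bochner_Integration.integral_sum val simp del: sum_of_bool_eq)
  also have "\<dots> \<le> 1 / 2 ^ m + (\<Sum>e\<in>nonzero_trits m. 10 * real m * inverse (12 ^ m))"
    using r \<delta> by (intro add_left_mono sum_mono order_trans[OF trit_poly_small] mult_left_mono dm) auto
  also have "\<dots> = 1 / 2 ^ m + real (card (nonzero_trits m)) * (10 * real m * inverse (12 ^ m))" by simp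
  also have "\<dots> \<le> 1 / 2 ^ m + 3 ^ m * (10 * 2 ^ m * inverse (12 ^ m))"
  proof (intro add_left_mono mult_mono)
    show "real (card (nonzero_trits m)) \<le> 3 ^ m" using card_nonzero_trits[of m] by (metis of_nat_le_iff of_nat_numeral of_nat_power)
    show "real m \<le> 2 ^ m" using less_exp[of m] by (metis less_imp_le of_nat_le_iff of_nat_numeral of_nat_power)
  qed auto
  also have "3 ^ m * (10 * 2 ^ m * inverse (12 ^ m)) = 10 * ((3 * 2) ^ m / (12::real) ^ m)"
    by (simp only: power_mult_distrib) (simp add: field_simps)
  also have "\<dots> = 10 * (1 / 2) ^ m" by (simp flip: power_divide)
  also have "1 / 2 ^ m + 10 * (1 / 2) ^ m = (11::real) / 2 ^ m" by (simp add: power_divide)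
  finally show ?thesis unfolding \<delta>_def .
qed

text \<open>
  The exponent is chosen such that the right-hand side is integrable by \<open>circle_poly_inverse_power\<close> for a
  polynomial of degree \<open>d\<close>.
\<close>
lemma ln_neg_part_le:
  assumes "0 < y" "0 < (d::real)"
  shows "(max 0 (- ln y)) ^ 4 \<le> (8 * d) ^ 4 * y powr (- 1 / (2 * d))"
proof -
  define t where "t = y powr (- 1 / (8 * d))"
  have t: "t > 0" using assms by (simp add: t_def)
  have "- ln y = 8 * d * ln t" using assms by (simp add: t_def ln_powr)
  also have "ln t \<le> t" using ln_le_minus_one[OF t] by simp
  finally have "- ln y \<le> 8 * d * t" using assms by (simp add: mult_left_mono)
  then have "max 0 (- ln y) \<le> 8 * d * t" using assms t by simp
  then have "(max 0 (- ln y)) ^ 4 \<le> (8 * d * t) ^ 4" by (intro power_mono) auto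
  also have "\<dots> = (8 * d) ^ 4 * t ^ 4" by (rule power_mult_distrib)
  also have "t ^ 4 = t powr 4" using t by simp
  also have "\<dots> = y powr (- 1 / (2 * d))" unfolding t_def powr_powr using assms by (simp add: field_simps)
  finally show ?thesis .
qed

lemma littlewood_poly_lead:
  assumes x: "x \<in> signs n" and n: "2 \<le> n"
  shows "degree (coeff_poly n x) = n - 1" "norm (lead_coeff (coeff_poly n x)) = 1"
proof -
  have c: "coeff (coeff_poly n x) (n - 1) = of_real (x (n - 1))" using n by (simp add: coeff_coeff_poly)
  have v: "x (n - 1) = 1 \<or> x (n - 1) = -1" using signs_values[OF x] n by auto
  have "n - 1 \<le> degree (coeff_poly n x)" using c v by (intro le_degree) auto
  moreover have "coeff_poly n x \<noteq> 0" using c v by (metis coeff_0 of_real_0 of_real_eq_iff one_neq_zero neg_equal_0_iff_equal)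
  then have "degree (coeff_poly n x) < n" by (rule degree_coeff_poly_less)
  ultimately show "degree (coeff_poly n x) = n - 1" by simp
  then show "norm (lead_coeff (coeff_poly n x)) = 1" using c v by auto
qed

lemma littlewood_log_moment:
  assumes x: "x \<in> signs n" and n: "2 \<le> n" and r: "1/2 \<le> r"
  shows "integrable \<mu> (\<lambda>\<theta>. (max 0 (- ln (norm (littlewood_poly n x (of_real r * cis \<theta>))))) ^ 4)"
    and "(\<integral>\<theta>. (max 0 (- ln (norm (littlewood_poly n x (of_real r * cis \<theta>))))) ^ 4 \<partial>\<mu>) \<le> 40960 * real n ^ 5"
proof -
  define p where "p = coeff_poly n x"
  define d where "d = real (degree p)"
  have deg: "degree p = n - 1" and lc: "norm (lead_coeff p) = 1" using littlewood_poly_lead[OF x n] by (auto simp: p_def)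
  have d: "0 < d" "d \<le> n" using n by (auto simp: d_def deg)
  define f where "f \<theta> = (max 0 (- ln (norm (poly p (of_real r * cis \<theta>))))) ^ 4" for \<theta>
  have f0: "0 \<le> f \<theta>" for \<theta> by (simp add: f_def)
  have [measurable]: "f \<in> borel_measurable borel" unfolding f_def by measurable
  have "(\<integral>\<^sup>+\<theta>. ennreal (f \<theta>) \<partial>\<mu>) \<le> (\<integral>\<^sup>+\<theta>. ennreal ((8 * d) ^ 4) * ennreal (norm (poly p (of_real r * cis \<theta>)) powr (- 1 / (2 * d))) \<partial>\<mu>)"
  proof (rule nn_integral_mono)
    fix \<theta>
    have "f \<theta> \<le> (8 * d) ^ 4 * norm (poly p (of_real r * cis \<theta>)) powr (- 1 / (2 * d))"
      using ln_neg_part_le[of "norm (poly p (of_real r * cis \<theta>))" d] d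
      by (cases "poly p (of_real r * cis \<theta>) = 0") (auto simp: f_def)
    then show "ennreal (f \<theta>) \<le> ennreal ((8 * d) ^ 4) * ennreal (norm (poly p (of_real r * cis \<theta>)) powr (- 1 / (2 * d)))"
      using d by (simp add: ennreal_leI flip: ennreal_mult)
  qed
  also have "\<dots> = ennreal ((8 * d) ^ 4) * (\<integral>\<^sup>+\<theta>. ennreal (norm (poly p (of_real r * cis \<theta>)) powr (- 1 / (2 * d))) \<partial>\<mu>)"
    by (rule nn_integral_cmult) measurable
  also have "\<dots> \<le> ennreal ((8 * d) ^ 4) * ennreal (10 * d)"
    unfolding d_def using n r lc deg by (intro mult_left_mono circle_poly_inverse_power) auto
  also have "\<dots> = ennreal ((8 * d) ^ 4 * (10 * d))" using d by (simp flip: ennreal_mult)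
  also have "\<dots> \<le> ennreal ((8 * real n) ^ 4 * (10 * real n))"
    using d by (intro ennreal_leI mult_mono power_mono) auto
  also have "(8 * real n) ^ 4 * (10 * real n) = 40960 * real n ^ 5" by (simp add: power_mult_distrib eval_nat_numeral)
  finally have nn: "(\<integral>\<^sup>+\<theta>. ennreal (f \<theta>) \<partial>\<mu>) \<le> ennreal (40960 * real n ^ 5)" by simp
  have eq: "f = (\<lambda>\<theta>. (max 0 (- ln (norm (littlewood_poly n x (of_real r * cis \<theta>))))) ^ 4)"
    by (simp add: f_def[abs_def] p_def poly_coeff_poly)
  have "integrable \<mu> f"
    by (rule integrableI_nonneg) (use f0 nn in \<open>auto intro: le_less_trans\<close>)
  then show "integrable \<mu> (\<lambda>\<theta>. (max 0 (- ln (norm (littlewood_poly n x (of_real r * cis \<theta>))))) ^ 4)"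
    by (simp only: eq)
  have "(\<integral>\<theta>. f \<theta> \<partial>\<mu>) \<le> 40960 * real n ^ 5"
    by (rule integral_real_bounded[OF _ nn]) simp
  then show "(\<integral>\<theta>. (max 0 (- ln (norm (littlewood_poly n x (of_real r * cis \<theta>))))) ^ 4 \<partial>\<mu>) \<le> 40960 * real n ^ 5"
    by (simp only: eq)
qed


definition neg_log :: "real \<Rightarrow> real" where
  "neg_log y = max 0 (- ln y)"

lemma neg_log_nonneg [simp]: "0 \<le> neg_log y"
  by (simp add: neg_log_def)

lemma neg_log_measurable [measurable]: "neg_log \<in> borel_measurable borel"
  unfolding neg_log_def by measurable

lemma normalized_poly_trig_sum:
  "normalized_poly n x r \<theta> = trig_sum n (\<lambda>k. x k * (r ^ k / sigma_norm n r)) \<theta>"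
proof -
  have "(of_real r * exp (\<i> * of_real \<theta>)) ^ k = of_real (r ^ k) * cis (real k * \<theta>)" for k
    unfolding cis_conv_exp[symmetric] power_mult_distrib Complex.DeMoivre by simp
  then show ?thesis
    by (simp add: normalized_poly_def littlewood_poly_def trig_sum_def sum_divide_distrib mult.assoc)
qed

lemma normalized_poly_measurable [measurable]: "normalized_poly n x r \<in> borel_measurable borel"
  unfolding normalized_poly_trig_sum[abs_def] by measurable

lemma norm_normalized_poly_square:
  assumes "0 < sigma_norm n r"
  shows "(norm (normalized_poly n x r \<theta>))\<^sup>2 = (norm (littlewood_poly n x (of_real r * cis \<theta>)))\<^sup>2 / (sigma_norm n r)\<^sup>2"
  using assms by (simp add: normalized_poly_def norm_divide power_divide cis_conv_exp)

text \<open>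
  Here \<open>p\<close> is the modulus of the polynomial and \<open>s\<close> its variance. Above the threshold the negative part of
  the logarithm is at most \<open>\<Lambda>\<close>. Below it, the square of the logarithm times the indicator is split by the
  inequality between arithmetic and geometric means with weight \<open>n ^ 6\<close>, large enough for the fourth
  moment \<open>O(n ^ 5)\<close> to become harmless.
\<close>
lemma neg_log_tail_pointwise:
  fixes p s U m n :: real
  assumes p: "0 \<le> p" and s: "1 \<le> s" "s \<le> 2 * n" and U: "0 \<le> U" and n: "1 \<le> n"
  defines "y \<equiv> p\<^sup>2 / s" and "\<Lambda> \<equiv> 16 * m\<^sup>2 + ln (2 * n)"
  shows "exp (- (U * y)) * (1 + (neg_log y)\<^sup>2) \<le> (1 + \<Lambda>\<^sup>2) * exp (- (U * y)) +
     (1 + 2 * (ln (2 * n))\<^sup>2 + 4 * n ^ 6) * of_bool (p \<le> exp (- 8 * m\<^sup>2)) + 4 / n ^ 6 * (neg_log p) ^ 4"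
proof (cases "p = 0")
  case True
  have "0 \<le> 1 + 2 * (ln (2 * n))\<^sup>2 + 4 * n ^ 6 - 1" using n by simp
  then show ?thesis using True by (simp add: y_def neg_log_def)
next
  case False
  then have p0: "p > 0" using p by simp
  have y: "y > 0" "y \<ge> 0" using p0 s by (auto simp: y_def)
  have l: "0 \<le> ln (2 * n)" "ln s \<le> ln (2 * n)" "0 \<le> ln s" using s n by auto
  have lny: "ln y = 2 * ln p - ln s" using p0 s by (simp add: y_def ln_div ln_realpow)
  have e1: "exp (- (U * y)) \<le> 1" using U y by simp
  have last: "0 \<le> 4 / n ^ 6 * (neg_log p) ^ 4" using n by simp
  show ?thesis
  proof (cases "p \<le> exp (- 8 * m\<^sup>2)")
    case True
    have "neg_log y \<le> 2 * neg_log p + ln (2 * n)" using lny l by (auto simp: neg_log_def max_def)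
    then have "(neg_log y)\<^sup>2 \<le> (2 * neg_log p + ln (2 * n))\<^sup>2" by (intro power_mono) auto
    also have "\<dots> \<le> 8 * (neg_log p)\<^sup>2 + 2 * (ln (2 * n))\<^sup>2"
      using zero_le_power2[of "2 * neg_log p - ln (2 * n)"] by (simp add: power2_eq_square algebra_simps)
    also have "8 * (neg_log p)\<^sup>2 \<le> 4 * n ^ 6 + 4 / n ^ 6 * (neg_log p) ^ 4"
    proof -
      have "0 \<le> 4 / n ^ 6 * (n ^ 6 - (neg_log p)\<^sup>2)\<^sup>2" using n by simp
      also have "\<dots> = 4 / n ^ 6 * (n ^ 6 * n ^ 6 - 2 * n ^ 6 * (neg_log p)\<^sup>2 + (neg_log p) ^ 4)"
        by (simp add: power2_eq_square power4_eq_xxxx algebra_simps)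
      also have "\<dots> = 4 * n ^ 6 - 8 * (neg_log p)\<^sup>2 + 4 / n ^ 6 * (neg_log p) ^ 4"
        using n by (simp add: field_simps)
      finally show ?thesis by simp
    qed
    finally have "1 + (neg_log y)\<^sup>2 \<le> (1 + 2 * (ln (2 * n))\<^sup>2 + 4 * n ^ 6) + 4 / n ^ 6 * (neg_log p) ^ 4" by simp
    moreover have "exp (- (U * y)) * (1 + (neg_log y)\<^sup>2) \<le> 1 * (1 + (neg_log y)\<^sup>2)"
      using e1 by (intro mult_right_mono) auto
    moreover have "0 \<le> (1 + \<Lambda>\<^sup>2) * exp (- (U * y))" by simp
    moreover have "of_bool (p \<le> exp (- 8 * m\<^sup>2)) = (1::real)" using True by simp
    moreover have "a \<le> z + k * t + l" if "b \<le> k + l" "a \<le> 1 * b" "0 \<le> z" "t = 1" for a b k l z t :: real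
      using that by simp
    ultimately show ?thesis by blast
  next
    case False
    then have "ln (exp (- 8 * m\<^sup>2)) \<le> ln p" using p0 by (subst ln_le_cancel_iff) auto
    then have "neg_log y \<le> \<Lambda>" using lny l by (auto simp: neg_log_def \<Lambda>_def)
    then have "1 + (neg_log y)\<^sup>2 \<le> 1 + \<Lambda>\<^sup>2" by (intro add_left_mono power_mono) auto
    then have "exp (- (U * y)) * (1 + (neg_log y)\<^sup>2) \<le> exp (- (U * y)) * (1 + \<Lambda>\<^sup>2)" by (intro mult_left_mono) auto
    moreover have "of_bool (p \<le> exp (- 8 * m\<^sup>2)) = (0::real)" using False by simp
    moreover have "a \<le> b * e + k * t + l" if "a \<le> e * b" "0 \<le> l" "t = 0" for a b e k l t :: real
      using that by (simp add: mult.commute)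
    ultimately show ?thesis using last by blast
  qed
qed

lemma integrable_neg_log_square:
  assumes x: "x \<in> signs n" and n: "2 \<le> n" and r: "1/2 \<le> r" and s: "0 < sigma_norm n r"
  shows "integrable \<mu> (\<lambda>\<theta>. (neg_log ((norm (normalized_poly n x r \<theta>))\<^sup>2))\<^sup>2)"
proof -
  define P where "P \<theta> = norm (littlewood_poly n x (of_real r * cis \<theta>))" for \<theta>
  define c where "c = \<bar>ln ((sigma_norm n r)\<^sup>2)\<bar>"
  have [measurable]: "P \<in> borel_measurable borel" unfolding P_def by measurable
  have bound: "(neg_log ((norm (normalized_poly n x r \<theta>))\<^sup>2))\<^sup>2 \<le> 4 + 4 * (neg_log (P \<theta>)) ^ 4 + 2 * c\<^sup>2" for \<theta>
  proof -
    have "neg_log ((norm (normalized_poly n x r \<theta>))\<^sup>2) \<le> 2 * neg_log (P \<theta>) + c"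
    proof (cases "P \<theta> = 0")
      case True
      then show ?thesis by (simp add: norm_normalized_poly_square[OF s] P_def[symmetric] neg_log_def c_def)
    next
      case False
      then have "P \<theta> > 0" by (simp add: P_def)
      then have "ln ((P \<theta>)\<^sup>2 / (sigma_norm n r)\<^sup>2) = 2 * ln (P \<theta>) - ln ((sigma_norm n r)\<^sup>2)"
        using s by (simp add: ln_div ln_realpow)
      then show ?thesis
        by (auto simp: norm_normalized_poly_square[OF s] P_def[symmetric] neg_log_def c_def)
    qed
    then have "(neg_log ((norm (normalized_poly n x r \<theta>))\<^sup>2))\<^sup>2 \<le> (2 * neg_log (P \<theta>) + c)\<^sup>2" by (intro power_mono) auto
    also have "\<dots> \<le> 8 * (neg_log (P \<theta>))\<^sup>2 + 2 * c\<^sup>2"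
      using zero_le_power2[of "2 * neg_log (P \<theta>) - c"] by (simp add: power2_eq_square algebra_simps)
    also have "8 * (neg_log (P \<theta>))\<^sup>2 \<le> 4 + 4 * (neg_log (P \<theta>)) ^ 4"
      using zero_le_power2[of "(neg_log (P \<theta>))\<^sup>2 - 1"] by (simp add: power2_eq_square power4_eq_xxxx algebra_simps)
    finally show ?thesis by simp
  qed
  have "integrable \<mu> (\<lambda>\<theta>. (neg_log (P \<theta>)) ^ 4)"
    using littlewood_log_moment(1)[OF x n r] by (simp add: neg_log_def P_def)
  then have "integrable \<mu> (\<lambda>\<theta>. 4 + 4 * (neg_log (P \<theta>)) ^ 4 + 2 * c\<^sup>2)" by simp
  then show ?thesis
    by (rule Bochner_Integration.integrable_bound) (use bound in auto)
qed

lemma neg_log_tail_mean: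
  fixes n m :: nat and r U :: real
  defines "y \<equiv> \<lambda>x \<theta>. (norm (normalized_poly n x r \<theta>))\<^sup>2" and "\<Lambda> \<equiv> 16 * (real m)\<^sup>2 + ln (2 * real n)"
  assumes n: "2 \<le> n" and r: "1/2 \<le> r" and s: "1 \<le> sigma_norm n r" "(sigma_norm n r)\<^sup>2 \<le> 2 * real n"
    and m: "1 \<le> m" "m \<le> n" and U: "0 \<le> U"
  shows "(\<integral>\<theta>. sign_mean n (\<lambda>x. exp (- (U * y x \<theta>)) * (1 + (neg_log (y x \<theta>))\<^sup>2)) \<partial>\<mu>) \<le>
    (1 + \<Lambda>\<^sup>2) * (\<integral>\<theta>. sign_mean n (\<lambda>x. exp (- (U * y x \<theta>))) \<partial>\<mu>) +
    (1 + 2 * (ln (2 * real n))\<^sup>2 + 4 * real n ^ 6) * (11 / 2 ^ m) + 163840 / real n"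
proof -
  define P where "P x \<theta> = norm (littlewood_poly n x (of_real r * cis \<theta>))" for x \<theta>
  define K where "K = 1 + 2 * (ln (2 * real n))\<^sup>2 + 4 * real n ^ 6"
  have [measurable]: "P x \<in> borel_measurable borel" "y x \<in> borel_measurable borel" for x
    unfolding P_def y_def by measurable
  have s0: "0 < sigma_norm n r" using s by simp
  have y: "y x \<theta> = (P x \<theta>)\<^sup>2 / (sigma_norm n r)\<^sup>2" for x \<theta>
    unfolding y_def P_def by (rule norm_normalized_poly_square[OF s0])
  have y0: "0 \<le> y x \<theta>" for x \<theta> by (simp add: y_def)
  have i1: "integrable \<mu> (\<lambda>\<theta>. exp (- (U * y x \<theta>)))" for x
    by (rule circle_integrable_bounded[where B=1]) (use U y0 in auto)
  have i2: "integrable \<mu> (\<lambda>\<theta>. exp (- (U * y x \<theta>)) * (1 + (neg_log (y x \<theta>))\<^sup>2))" if "x \<in> signs n" for x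
  proof (rule Bochner_Integration.integrable_bound)
    show "integrable \<mu> (\<lambda>\<theta>. 1 + (neg_log (y x \<theta>))\<^sup>2)"
      using integrable_neg_log_square[OF that n r s0] by (simp add: y_def)
    show "AE \<theta> in \<mu>. norm (exp (- (U * y x \<theta>)) * (1 + (neg_log (y x \<theta>))\<^sup>2)) \<le> norm (1 + (neg_log (y x \<theta>))\<^sup>2)"
    proof (rule AE_I2)
      fix \<theta>
      have "exp (- (U * y x \<theta>)) * (1 + (neg_log (y x \<theta>))\<^sup>2) \<le> 1 * (1 + (neg_log (y x \<theta>))\<^sup>2)"
        using U y0 by (intro mult_right_mono) auto
      then show "norm (exp (- (U * y x \<theta>)) * (1 + (neg_log (y x \<theta>))\<^sup>2)) \<le> norm (1 + (neg_log (y x \<theta>))\<^sup>2)" by simp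
    qed
  qed measurable
  have i3: "integrable \<mu> (\<lambda>\<theta>. of_bool (P x \<theta> \<le> exp (- 8 * (real m)\<^sup>2)) :: real)" for x
    by (rule circle_integrable_bounded[where B=1]) (auto simp: of_bool_def)
  have i4: "integrable \<mu> (\<lambda>\<theta>. (neg_log (P x \<theta>)) ^ 4)"
    and v4: "(\<integral>\<theta>. (neg_log (P x \<theta>)) ^ 4 \<partial>\<mu>) \<le> 40960 * real n ^ 5" if "x \<in> signs n" for x
    using littlewood_log_moment[OF that n r] by (simp_all add: neg_log_def P_def)
  have "(\<integral>\<theta>. sign_mean n (\<lambda>x. exp (- (U * y x \<theta>)) * (1 + (neg_log (y x \<theta>))\<^sup>2)) \<partial>\<mu>) \<le>
    (\<integral>\<theta>. (1 + \<Lambda>\<^sup>2) * sign_mean n (\<lambda>x. exp (- (U * y x \<theta>))) + K * sign_mean n (\<lambda>x. of_bool (P x \<theta> \<le> exp (- 8 * (real m)\<^sup>2)))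
       + 4 / real n ^ 6 * sign_mean n (\<lambda>x. (neg_log (P x \<theta>)) ^ 4) \<partial>\<mu>)"
  proof (rule integral_mono)
    fix \<theta>
    have "sign_mean n (\<lambda>x. exp (- (U * y x \<theta>)) * (1 + (neg_log (y x \<theta>))\<^sup>2)) \<le>
       sign_mean n (\<lambda>x. (1 + \<Lambda>\<^sup>2) * exp (- (U * y x \<theta>)) + K * of_bool (P x \<theta> \<le> exp (- 8 * (real m)\<^sup>2))
       + 4 / real n ^ 6 * (neg_log (P x \<theta>)) ^ 4)"
      unfolding y K_def \<Lambda>_def using s U n
      by (intro sign_mean_mono neg_log_tail_pointwise) (auto simp: P_def)
    then show "sign_mean n (\<lambda>x. exp (- (U * y x \<theta>)) * (1 + (neg_log (y x \<theta>))\<^sup>2)) \<le>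
       (1 + \<Lambda>\<^sup>2) * sign_mean n (\<lambda>x. exp (- (U * y x \<theta>))) + K * sign_mean n (\<lambda>x. of_bool (P x \<theta> \<le> exp (- 8 * (real m)\<^sup>2)))
       + 4 / real n ^ 6 * sign_mean n (\<lambda>x. (neg_log (P x \<theta>)) ^ 4)"
      by (simp only: sign_mean_add sign_mean_cmult)
  qed (intro Bochner_Integration.integrable_add integrable_mult_right integrable_sign_mean i1 i2 i3 i4; assumption)+
  also have "\<dots> = (1 + \<Lambda>\<^sup>2) * (\<integral>\<theta>. sign_mean n (\<lambda>x. exp (- (U * y x \<theta>))) \<partial>\<mu>)
      + K * (\<integral>\<theta>. sign_mean n (\<lambda>x. of_bool (P x \<theta> \<le> exp (- 8 * (real m)\<^sup>2))) \<partial>\<mu>)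
      + 4 / real n ^ 6 * (\<integral>\<theta>. sign_mean n (\<lambda>x. (neg_log (P x \<theta>)) ^ 4) \<partial>\<mu>)"
    by (subst Bochner_Integration.integral_add | subst integral_mult_right_zero
        | intro Bochner_Integration.integrable_add integrable_mult_right integrable_sign_mean i1 i3 i4 refl | assumption)+
  also have "\<dots> \<le> (1 + \<Lambda>\<^sup>2) * (\<integral>\<theta>. sign_mean n (\<lambda>x. exp (- (U * y x \<theta>))) \<partial>\<mu>)
      + K * (11 / 2 ^ m) + 4 / real n ^ 6 * (40960 * real n ^ 5)"
  proof (intro add_mono mult_left_mono order_refl)
    show "(\<integral>\<theta>. sign_mean n (\<lambda>x. of_bool (P x \<theta> \<le> exp (- 8 * (real m)\<^sup>2))) \<partial>\<mu>) \<le> 11 / 2 ^ m"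
      unfolding P_def using littlewood_small_mean[OF m r] by simp
    have "(\<integral>\<theta>. sign_mean n (\<lambda>x. (neg_log (P x \<theta>)) ^ 4) \<partial>\<mu>) = sign_mean n (\<lambda>x. \<integral>\<theta>. (neg_log (P x \<theta>)) ^ 4 \<partial>\<mu>)"
      by (intro integral_sign_mean i4)
    also have "\<dots> \<le> sign_mean n (\<lambda>_. 40960 * real n ^ 5)" by (intro sign_mean_mono v4)
    finally show "(\<integral>\<theta>. sign_mean n (\<lambda>x. (neg_log (P x \<theta>)) ^ 4) \<partial>\<mu>) \<le> 40960 * real n ^ 5" by simp
  qed (auto simp: K_def)
  also have "4 / real n ^ 6 * (40960 * real n ^ 5) = 163840 / real n"
    using n by (simp add: eval_nat_numeral)
  finally show ?thesis unfolding K_def .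
qed

section \<open>Laplace transforms averaged over the circle\<close>

definition laplace_mean :: "nat \<Rightarrow> real \<Rightarrow> (nat \<Rightarrow> real) \<Rightarrow> real \<Rightarrow> real" where
  "laplace_mean n r x u = (\<integral>\<theta>. exp (- (u * (norm (normalized_poly n x r \<theta>))\<^sup>2)) \<partial>\<mu>)"

lemma circle_mean_trig_sum:
  assumes m: "m \<noteq> 0" and h: "0 < h"
  shows "(\<integral>\<theta>. norm (trig_sum n b (of_int m * \<theta> + c)) \<partial>\<mu>) \<le> (h + (\<Sum>k<n. (b k)\<^sup>2) / h) / 2"
proof -
  have [measurable]: "(\<lambda>\<theta>. trig_sum n b (of_int m * \<theta> + c)) \<in> borel_measurable borel"
    by (intro borel_measurable_continuous_onI continuous_intros)
  have i1: "integrable \<mu> (\<lambda>\<theta>. norm (trig_sum n b (of_int m * \<theta> + c)))"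
    by (rule circle_integrable_bounded[where B="\<Sum>k<n. \<bar>b k\<bar>"]) (auto intro: norm_trig_sum_le)
  have i2: "integrable \<mu> (\<lambda>\<theta>. (norm (trig_sum n b (of_int m * \<theta> + c)))\<^sup>2)"
    by (rule circle_integrable_bounded[where B="(\<Sum>k<n. \<bar>b k\<bar>)\<^sup>2"]) (auto intro!: power_mono norm_trig_sum_le)
  have "t \<le> (h + t\<^sup>2 / h) / 2" for t
  proof -
    have "0 \<le> (t - h)\<^sup>2 / h" using h by simp
    also have "\<dots> = t\<^sup>2 / h - 2 * t + h" using h by (simp add: power2_eq_square field_simps)
    finally show ?thesis by simp
  qed
  then have "(\<integral>\<theta>. norm (trig_sum n b (of_int m * \<theta> + c)) \<partial>\<mu>) \<le>
      (\<integral>\<theta>. (h + (norm (trig_sum n b (of_int m * \<theta> + c)))\<^sup>2 / h) / 2 \<partial>\<mu>)"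
    using i1 i2 by (intro integral_mono) auto
  also have "\<dots> = (h + (\<integral>\<theta>. (norm (trig_sum n b (of_int m * \<theta> + c)))\<^sup>2 \<partial>\<mu>) / h) / 2"
    using i2 circle.prob_space by simp
  finally show ?thesis by (simp add: circle_parseval[OF m])
qed

text \<open>
  All that the argument uses of the radius: it stays away from \<open>0\<close>, and no normalised coefficient is much
  larger than the quadratic mean \<open>1 / sqrt n\<close>.
\<close>
locale flat_weights =
  fixes n :: nat and r :: real
  assumes n: "2 \<le> n" and r: "1/2 \<le> r"
    and sigma: "1 \<le> sigma_norm n r" "(sigma_norm n r)\<^sup>2 \<le> 2 * real n"
    and flat: "\<And>k. k < n \<Longrightarrow> (r ^ k / sigma_norm n r)\<^sup>2 \<le> 4 / real n"
begin

definition weight :: "nat \<Rightarrow> real" where "weight k = r ^ k / sigma_norm n r"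

definition sqmod :: "(nat \<Rightarrow> real) \<Rightarrow> real \<Rightarrow> real" where
  "sqmod x \<theta> = (norm (normalized_poly n x r \<theta>))\<^sup>2"

lemma sqmod_trig: "sqmod x \<theta> = (norm (trig_sum n (\<lambda>k. x k * weight k) \<theta>))\<^sup>2"
  by (simp add: sqmod_def normalized_poly_trig_sum weight_def)

lemma sqmod_nonneg [simp]: "0 \<le> sqmod x \<theta>"
  by (simp add: sqmod_def)

lemma sqmod_measurable [measurable]: "sqmod x \<in> borel_measurable borel"
  unfolding sqmod_def by measurable

lemma sum_weight: "(\<Sum>k<n. (weight k)\<^sup>2) = 1"
proof -
  have "(sigma_norm n r)\<^sup>2 = (\<Sum>k<n. r ^ (2 * k))"
    unfolding sigma_norm_def by (intro real_sqrt_pow2 sum_nonneg) (simp add: power_mult)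
  moreover have "(\<Sum>k<n. (weight k)\<^sup>2) = (\<Sum>k<n. r ^ (2 * k)) / (sigma_norm n r)\<^sup>2"
    by (simp add: weight_def power_divide sum_divide_distrib power_mult[symmetric] mult.commute)
  moreover have "sigma_norm n r \<noteq> 0" using sigma(1) by simp
  ultimately show ?thesis by (metis divide_self power_not_zero)
qed

definition corr :: "real \<Rightarrow> real" where
  "corr t = norm (trig_sum n (\<lambda>k. (weight k)\<^sup>2) t)"

lemma corr_bounds: "0 \<le> corr t" "corr t \<le> 1"
  using norm_trig_sum_le[of n "\<lambda>k. (weight k)\<^sup>2" t] by (simp_all add: sum_weight corr_def)

lemma correlation_corr: "correlation n weight \<theta> \<phi> = corr (2 * \<theta>) + corr (2 * \<phi>) + corr (\<theta> + \<phi>) + corr (\<theta> - \<phi>)"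
  by (simp add: correlation_def corr_def)

lemma weight_le: "k < n \<Longrightarrow> (weight k)\<^sup>2 \<le> 4 / real n"
  unfolding weight_def by (rule flat)

lemma sum_weight4: "(\<Sum>k<n. ((weight k)\<^sup>2)\<^sup>2) \<le> 4 / real n"
proof -
  have "(\<Sum>k<n. ((weight k)\<^sup>2)\<^sup>2) \<le> (\<Sum>k<n. 4 / real n * (weight k)\<^sup>2)"
    using weight_le unfolding power2_eq_square[of "(weight _)\<^sup>2"] by (intro sum_mono mult_right_mono) auto
  also have "\<dots> = 4 / real n" unfolding sum_distrib_left[symmetric] sum_weight by simp
  finally show ?thesis .
qed

lemma mean_sqmod: "x \<in> signs n \<Longrightarrow> (\<integral>\<theta>. sqmod x \<theta> \<partial>\<mu>) = 1" "integrable \<mu> (sqmod x)"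
proof -
  show "integrable \<mu> (sqmod x)"
    unfolding sqmod_trig[abs_def]
    by (rule circle_integrable_bounded[where B="(\<Sum>k<n. \<bar>x k * weight k\<bar>)\<^sup>2"]) (auto intro!: power_mono norm_trig_sum_le)
  assume x: "x \<in> signs n"
  show "(\<integral>\<theta>. sqmod x \<theta> \<partial>\<mu>) = 1"
    using circle_parseval[of 1 n "\<lambda>k. x k * weight k" 0] x
    by (simp add: sqmod_trig power_mult_distrib sum_weight)
qed

lemma integrable_corr:
  assumes "continuous_on UNIV f"
  shows "integrable \<mu> (\<lambda>\<theta>. corr (f \<theta>))" "integrable \<mu> (\<lambda>\<theta>. (corr (f \<theta>))\<^sup>2)"
proof -
  have [measurable]: "(\<lambda>\<theta>. corr (f \<theta>)) \<in> borel_measurable borel"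
    unfolding corr_def using assms by (intro borel_measurable_continuous_onI continuous_intros)
  show "integrable \<mu> (\<lambda>\<theta>. corr (f \<theta>))" "integrable \<mu> (\<lambda>\<theta>. (corr (f \<theta>))\<^sup>2)"
    by (rule circle_integrable_bounded[where B=1]; use corr_bounds in \<open>auto intro: power_le_one\<close>)+
qed

lemma mean_corr:
  assumes "m \<noteq> 0"
  shows "(\<integral>\<theta>. corr (of_int m * \<theta> + e) \<partial>\<mu>) \<le> 5 / (2 * sqrt (real n))"
proof -
  have "(\<integral>\<theta>. corr (of_int m * \<theta> + e) \<partial>\<mu>) \<le> (1 / sqrt (real n) + (\<Sum>k<n. ((weight k)\<^sup>2)\<^sup>2) / (1 / sqrt (real n))) / 2"
    unfolding corr_def using assms n by (intro circle_mean_trig_sum) auto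
  also have "\<dots> \<le> (1 / sqrt (real n) + (4 / real n) / (1 / sqrt (real n))) / 2"
    using sum_weight4 by (intro divide_right_mono add_left_mono) auto
  also have "(4 / real n) / (1 / sqrt (real n)) = 4 / sqrt (real n)"
    using n by (simp add: field_simps)
  finally show ?thesis by (simp add: field_simps)
qed

lemma mean_corr_square: "(\<integral>\<theta>. (corr (2 * \<theta>))\<^sup>2 \<partial>\<mu>) \<le> 4 / real n"
  using circle_parseval[of 2 n "\<lambda>k. (weight k)\<^sup>2" 0] sum_weight4 by (simp add: corr_def)

lemma correlation_integrable: "integrable \<mu> (\<lambda>\<phi>. correlation n weight \<theta> \<phi>)"
  unfolding correlation_corr
  by (intro Bochner_Integration.integrable_add integrable_corr(1) continuous_intros)

lemma mean_correlation_inner: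
  "(\<integral>\<phi>. correlation n weight \<theta> \<phi> \<partial>\<mu>) \<le> corr (2 * \<theta>) + 15 / (2 * sqrt (real n))"
proof -
  have "(\<integral>\<phi>. correlation n weight \<theta> \<phi> \<partial>\<mu>) = corr (2 * \<theta>) + (\<integral>\<phi>. corr (2 * \<phi>) \<partial>\<mu>)
      + (\<integral>\<phi>. corr (\<theta> + \<phi>) \<partial>\<mu>) + (\<integral>\<phi>. corr (\<theta> - \<phi>) \<partial>\<mu>)"
    unfolding correlation_corr using circle.prob_space
    by (subst Bochner_Integration.integral_add; (intro Bochner_Integration.integrable_add integrable_corr(1) continuous_intros | simp)?)+
  also have "\<dots> \<le> corr (2 * \<theta>) + 5 / (2 * sqrt (real n)) + 5 / (2 * sqrt (real n)) + 5 / (2 * sqrt (real n))"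
    using mean_corr[of 2 0] mean_corr[of 1 \<theta>] mean_corr[of "-1" \<theta>] by (intro add_mono) (auto simp: add.commute)
  finally show ?thesis by simp
qed

definition comparison_error :: "real \<Rightarrow> real" where
  "comparison_error U = 20 / sqrt (real n) + 160 / real n + 32 * exp (- (real n / (64 * U)))"

lemma exp_sqmod_integrable: "0 \<le> u \<Longrightarrow> integrable \<mu> (\<lambda>\<theta>. exp (- (u * sqmod x \<theta>)))"
  by (rule circle_integrable_bounded[where B=1]) auto

lemma laplace_mean_sqmod: "laplace_mean n r x u = (\<integral>\<theta>. exp (- (u * sqmod x \<theta>)) \<partial>\<mu>)"
  by (simp add: laplace_mean_def sqmod_def)

text \<open>
  The product of the two circle means is a double integral over pairs of angles. The pointwise error of
  \<open>gaussian_pair_comparison\<close> is linear in the correlation, whose mean over all pairs is \<open>O(1 / sqrt n)\<close>.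
\<close>
lemma laplace_mean_pair:
  assumes u: "0 \<le> u" "u \<le> U" and w: "0 \<le> w" "w \<le> U" and U: "0 < U"
  shows "\<bar>sign_mean n (\<lambda>x. laplace_mean n r x u * laplace_mean n r x w) - 1 / ((1 + u) * (1 + w))\<bar> \<le> comparison_error U"
proof -
  define e where "e = 160 / real n + 32 * exp (- (real n / (64 * U)))"
  define F where "F \<theta> \<phi> = sign_mean n (\<lambda>x. exp (- (u * sqmod x \<theta> + w * sqmod x \<phi>))) - 1 / ((1 + u) * (1 + w))" for \<theta> \<phi>
  have point: "\<bar>F \<theta> \<phi>\<bar> \<le> 2 * correlation n weight \<theta> \<phi> + e" for \<theta> \<phi>
  proof -
    have "\<bar>F \<theta> \<phi>\<bar> \<le> 2 * correlation n weight \<theta> \<phi> + 40 * (4 / real n) + 32 * exp (- (1 / (16 * (4 / real n) * U)))"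
      unfolding F_def sqmod_trig using n u w U by (intro gaussian_pair_comparison sum_weight weight_le) auto
    then show ?thesis by (simp add: e_def)
  qed
  have Fsplit: "F \<theta> \<phi> = sign_mean n (\<lambda>x. exp (- (u * sqmod x \<theta>)) * exp (- (w * sqmod x \<phi>))) - 1 / ((1 + u) * (1 + w))" for \<theta> \<phi>
    by (simp add: F_def flip: exp_add)
  have Fint: "integrable \<mu> (\<lambda>\<phi>. F \<theta> \<phi>)" for \<theta>
    unfolding Fsplit by (intro Bochner_Integration.integrable_diff integrable_sign_mean integrable_mult_right exp_sqmod_integrable w) auto
  define G where "G \<theta> = (\<integral>\<phi>. F \<theta> \<phi> \<partial>\<mu>)" for \<theta>
  have G: "G \<theta> = sign_mean n (\<lambda>x. exp (- (u * sqmod x \<theta>)) * laplace_mean n r x w) - 1 / ((1 + u) * (1 + w))" for \<theta>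
  proof -
    have "G \<theta> = (\<integral>\<phi>. sign_mean n (\<lambda>x. exp (- (u * sqmod x \<theta>)) * exp (- (w * sqmod x \<phi>))) \<partial>\<mu>) - 1 / ((1 + u) * (1 + w))"
      unfolding G_def Fsplit using circle.prob_space w
      by (subst Bochner_Integration.integral_diff) (auto intro!: integrable_sign_mean integrable_mult_right exp_sqmod_integrable)
    also have "(\<integral>\<phi>. sign_mean n (\<lambda>x. exp (- (u * sqmod x \<theta>)) * exp (- (w * sqmod x \<phi>))) \<partial>\<mu>) =
       sign_mean n (\<lambda>x. \<integral>\<phi>. exp (- (u * sqmod x \<theta>)) * exp (- (w * sqmod x \<phi>)) \<partial>\<mu>)"
      using w by (intro integral_sign_mean integrable_mult_right exp_sqmod_integrable)
    finally show ?thesis by (simp add: laplace_mean_sqmod)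
  qed
  have Gint: "integrable \<mu> G"
    unfolding G[abs_def] by (intro Bochner_Integration.integrable_diff integrable_sign_mean integrable_mult_left exp_sqmod_integrable u) auto
  have "sign_mean n (\<lambda>x. laplace_mean n r x u * laplace_mean n r x w) - 1 / ((1 + u) * (1 + w)) = (\<integral>\<theta>. G \<theta> \<partial>\<mu>)"
  proof -
    have "(\<integral>\<theta>. G \<theta> \<partial>\<mu>) = (\<integral>\<theta>. sign_mean n (\<lambda>x. exp (- (u * sqmod x \<theta>)) * laplace_mean n r x w) \<partial>\<mu>) - 1 / ((1 + u) * (1 + w))"
      unfolding G using circle.prob_space u
      by (subst Bochner_Integration.integral_diff) (auto intro!: integrable_sign_mean integrable_mult_left exp_sqmod_integrable)
    also have "(\<integral>\<theta>. sign_mean n (\<lambda>x. exp (- (u * sqmod x \<theta>)) * laplace_mean n r x w) \<partial>\<mu>) =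
       sign_mean n (\<lambda>x. \<integral>\<theta>. exp (- (u * sqmod x \<theta>)) * laplace_mean n r x w \<partial>\<mu>)"
      using u by (intro integral_sign_mean integrable_mult_left exp_sqmod_integrable)
    finally show ?thesis by (simp add: laplace_mean_sqmod)
  qed
  moreover have "\<bar>\<integral>\<theta>. G \<theta> \<partial>\<mu>\<bar> \<le> (\<integral>\<theta>. \<bar>G \<theta>\<bar> \<partial>\<mu>)" by (rule integral_abs_bound)
  moreover have "(\<integral>\<theta>. \<bar>G \<theta>\<bar> \<partial>\<mu>) \<le> (\<integral>\<theta>. 2 * corr (2 * \<theta>) + (15 / sqrt (real n) + e) \<partial>\<mu>)"
  proof (rule integral_mono)
    fix \<theta>
    have "\<bar>G \<theta>\<bar> \<le> (\<integral>\<phi>. \<bar>F \<theta> \<phi>\<bar> \<partial>\<mu>)" unfolding G_def by (rule integral_abs_bound)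
    also have "\<dots> \<le> (\<integral>\<phi>. 2 * correlation n weight \<theta> \<phi> + e \<partial>\<mu>)"
      using Fint correlation_integrable point by (intro integral_mono) auto
    also have "\<dots> = 2 * (\<integral>\<phi>. correlation n weight \<theta> \<phi> \<partial>\<mu>) + e"
      using correlation_integrable circle.prob_space by simp
    also have "\<dots> \<le> 2 * (corr (2 * \<theta>) + 15 / (2 * sqrt (real n))) + e"
      by (intro add_right_mono mult_left_mono mean_correlation_inner) auto
    finally show "\<bar>G \<theta>\<bar> \<le> 2 * corr (2 * \<theta>) + (15 / sqrt (real n) + e)" by simp
  qed (use Gint integrable_corr(1)[of "\<lambda>\<theta>. 2 * \<theta>"] in auto)
  moreover have "\<dots> = 2 * (\<integral>\<theta>. corr (2 * \<theta>) \<partial>\<mu>) + (15 / sqrt (real n) + e)"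
    using integrable_corr(1)[of "\<lambda>\<theta>. 2 * \<theta>"] circle.prob_space by simp
  moreover have "\<dots> \<le> 2 * (5 / (2 * sqrt (real n))) + (15 / sqrt (real n) + e)"
    using mean_corr[of 2 0] by simp
  moreover have "2 * (5 / (2 * sqrt (real n))) + (15 / sqrt (real n) + e) = comparison_error U"
    by (simp add: comparison_error_def e_def)
  ultimately show ?thesis by linarith
qed

lemma laplace_mean_single:
  assumes u: "0 \<le> u" "u \<le> U" and U: "0 < U"
  shows "\<bar>sign_mean n (\<lambda>x. laplace_mean n r x u) - 1 / (1 + u)\<bar> \<le> comparison_error U"
  using laplace_mean_pair[OF u, of 0] U circle.prob_space by (simp add: laplace_mean_sqmod)

lemma laplace_mean_upper:
  assumes U: "0 < U"
  shows "(\<integral>\<theta>. sign_mean n (\<lambda>x. exp (- (U * sqmod x \<theta>))) \<partial>\<mu>) \<le> 2 / U + 16 * exp (- (real n / (64 * U))) + 16 / real n"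
proof -
  define T where "T = exp (- (real n / (64 * U)))"
  have "(\<integral>\<theta>. sign_mean n (\<lambda>x. exp (- (U * sqmod x \<theta>))) \<partial>\<mu>) \<le>
     (\<integral>\<theta>. (1 / (1 + U / 2) + 16 * T) + 4 * (corr (2 * \<theta>))\<^sup>2 \<partial>\<mu>)"
  proof (rule integral_mono)
    fix \<theta>
    have "sign_mean n (\<lambda>x. exp (- (U * sqmod x \<theta>))) \<le> 1 / (1 + U / 2) + 16 * exp (- (1 / (16 * (4 / real n) * U)))
         + 4 * (corr (2 * \<theta>))\<^sup>2"
      unfolding sqmod_trig corr_def using n U by (intro gaussian_single_upper_bound sum_weight weight_le) auto
    then show "sign_mean n (\<lambda>x. exp (- (U * sqmod x \<theta>))) \<le> (1 / (1 + U / 2) + 16 * T) + 4 * (corr (2 * \<theta>))\<^sup>2"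
      by (simp add: T_def)
  qed (use U integrable_corr(2)[of "\<lambda>\<theta>. 2 * \<theta>"] in \<open>auto intro!: integrable_sign_mean exp_sqmod_integrable\<close>)
  also have "\<dots> = (1 / (1 + U / 2) + 16 * T) + 4 * (\<integral>\<theta>. (corr (2 * \<theta>))\<^sup>2 \<partial>\<mu>)"
    using integrable_corr(2)[of "\<lambda>\<theta>. 2 * \<theta>"] circle.prob_space by simp
  also have "\<dots> \<le> (2 / U + 16 * T) + 4 * (4 / real n)"
    using mean_corr_square U by (intro add_mono mult_left_mono) (auto simp: field_simps)
  finally show ?thesis by (simp add: T_def)
qed

end

section \<open>Moments of the truncated log-integral\<close>

text \<open>
  The measure \<open>du / u\<close> on \<open>[a, U]\<close>; its total mass is of order \<open>log n\<close> for the cut-offs in use.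
\<close>
definition log_measure :: "real \<Rightarrow> real \<Rightarrow> real measure" where
  "log_measure a U = density lborel (\<lambda>u. ennreal (indicator {a..U} u / u))"

lemma sets_log_measure [simp, measurable_cong]: "sets (log_measure a U) = sets borel"
  by (simp add: log_measure_def)

lemma space_log_measure [simp]: "space (log_measure a U) = UNIV"
  by (simp add: log_measure_def)

lemma AE_log_measure: "0 < a \<Longrightarrow> AE u in log_measure a U. a \<le> u \<and> u \<le> U"
  unfolding log_measure_def by (subst AE_density) (auto simp: indicator_def)

lemma log_measure_integral:
  fixes f :: "real \<Rightarrow> real"
  assumes a: "0 < a" and f: "f \<in> borel_measurable borel" "continuous_on {a..U} f"
  shows "(\<integral>u. f u \<partial>log_measure a U) = integral {a..U} (\<lambda>u. f u / u)"
    and "integrable (log_measure a U) f"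
proof -
  have int: "set_integrable lborel {a..U} (\<lambda>u. f u / u)"
    using a f by (intro borel_integrable_atLeastAtMost' continuous_intros) auto
  have eq: "(indicator {a..U} u / u) *\<^sub>R f u = indicator {a..U} u *\<^sub>R (f u / u)" for u by simp
  have nn: "AE u in lborel. 0 \<le> indicator {a..U} u / u" using a by (auto simp: indicator_def)
  show "integrable (log_measure a U) f"
    unfolding log_measure_def using int f nn
    by (subst integrable_density) (auto simp: eq set_integrable_def simp del: real_scaleR_def)
  have "(\<integral>u. f u \<partial>log_measure a U) = (LINT u:{a..U}|lborel. f u / u)"
    unfolding log_measure_def set_lebesgue_integral_def using f nn
    by (subst integral_density) (auto simp: eq simp del: real_scaleR_def)
  also have "\<dots> = integral {a..U} (\<lambda>u. f u / u)" by (rule set_borel_integral_eq_integral(2)[OF int])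
  finally show "(\<integral>u. f u \<partial>log_measure a U) = integral {a..U} (\<lambda>u. f u / u)" .
qed

lemma log_measure_finite:
  assumes a: "0 < a" "a \<le> U"
  shows "finite_measure (log_measure a U)" "measure (log_measure a U) UNIV = ln (U / a)"
proof -
  have "integrable (log_measure a U) (\<lambda>_. 1::real)" using a by (intro log_measure_integral) auto
  then have "emeasure (log_measure a U) (space (log_measure a U)) < \<infinity>"
    by (simp add: integrable_iff_bounded)
  then show "finite_measure (log_measure a U)" by (intro finite_measureI) auto
  have "measure (log_measure a U) UNIV = (\<integral>u. 1 \<partial>log_measure a U)" by simp
  also have "\<dots> = integral {a..U} (\<lambda>u. 1 / u)" using a by (intro log_measure_integral) auto
  also have "((\<lambda>u. 1 / u) has_integral (ln U - ln a)) {a..U}"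
    using a by (intro fundamental_theorem_of_calculus)
      (auto intro!: derivative_eq_intros simp flip: has_real_derivative_iff_has_vector_derivative)
  then have "integral {a..U} (\<lambda>u. 1 / u) = ln U - ln a" by (rule integral_unique)
  also have "\<dots> = ln (U / a)" using a by (simp add: ln_div)
  finally show "measure (log_measure a U) UNIV = ln (U / a)" .
qed

lemma frullani_log_measure: "0 < a \<Longrightarrow> frullani a U y = (\<integral>u. exp (- u) - exp (- (u * y)) \<partial>log_measure a U)"
  unfolding frullani_def by (subst log_measure_integral) (auto intro!: continuous_intros)

lemma gauss_frullani_log_measure: "0 < a \<Longrightarrow> gauss_frullani a U = (\<integral>u. exp (- u) - 1 / (1 + u) \<partial>log_measure a U)"
  unfolding gauss_frullani_def by (subst log_measure_integral) (auto intro!: continuous_intros)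

lemma frullani_measurable [measurable]: "0 < a \<Longrightarrow> a \<le> U \<Longrightarrow> frullani a U \<in> borel_measurable borel"
proof -
  assume a: "0 < a" "a \<le> U"
  interpret finite_measure "log_measure a U" using a by (rule log_measure_finite)
  show ?thesis unfolding frullani_log_measure[OF a(1), abs_def] by measurable
qed

lemma log_measure_bound:
  assumes a: "0 < a" "a \<le> U" and f: "\<And>u. a \<le> u \<Longrightarrow> u \<le> U \<Longrightarrow> \<bar>f u\<bar> \<le> (B::real)"
    and m: "f \<in> borel_measurable borel"
  shows "integrable (log_measure a U) f" "\<bar>\<integral>u. f u \<partial>log_measure a U\<bar> \<le> B * ln (U / a)"
proof -
  interpret finite_measure "log_measure a U" using a by (rule log_measure_finite)
  have ae: "AE u in log_measure a U. \<bar>f u\<bar> \<le> B"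
    using AE_log_measure[OF a(1), of U] by eventually_elim (use f in auto)
  show int: "integrable (log_measure a U) f"
    using ae m by (intro integrable_const_bound[where B=B]) auto
  have "\<bar>\<integral>u. f u \<partial>log_measure a U\<bar> \<le> (\<integral>u. \<bar>f u\<bar> \<partial>log_measure a U)" by (rule integral_abs_bound)
  also have "\<dots> \<le> (\<integral>u. B \<partial>log_measure a U)" using int ae by (intro integral_mono_AE) auto
  also have "\<dots> = B * ln (U / a)" using log_measure_finite(2)[OF a] by simp
  finally show "\<bar>\<integral>u. f u \<partial>log_measure a U\<bar> \<le> B * ln (U / a)" .
qed

context flat_weights
begin

definition laplace_gap :: "(nat \<Rightarrow> real) \<Rightarrow> real \<Rightarrow> real" where
  "laplace_gap x u = exp (- u) - laplace_mean n r x u"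

lemma laplace_mean_measurable [measurable]: "laplace_mean n r x \<in> borel_measurable borel"
proof -
  have "laplace_mean n r x = (\<lambda>u. \<integral>\<theta>. exp (- (u * sqmod x \<theta>)) \<partial>\<mu>)"
    by (simp add: laplace_mean_sqmod fun_eq_iff)
  then show ?thesis by simp
qed

lemma laplace_gap_measurable [measurable]: "laplace_gap x \<in> borel_measurable borel"
  unfolding laplace_gap_def[abs_def] by measurable

lemma laplace_mean_bounds:
  assumes "0 \<le> u"
  shows "0 \<le> laplace_mean n r x u" "laplace_mean n r x u \<le> 1"
proof -
  show "0 \<le> laplace_mean n r x u" by (simp add: laplace_mean_sqmod)
  have "(\<integral>\<theta>. exp (- (u * sqmod x \<theta>)) \<partial>\<mu>) \<le> (\<integral>\<theta>. 1 \<partial>\<mu>)"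
    using assms by (intro integral_mono exp_sqmod_integrable) auto
  then show "laplace_mean n r x u \<le> 1" using circle.prob_space by (simp add: laplace_mean_sqmod)
qed

lemma laplace_gap_bound:
  assumes "0 \<le> u"
  shows "\<bar>laplace_gap x u\<bar> \<le> 1"
proof -
  have "0 < exp (- u)" "exp (- u) \<le> 1" using assms by auto
  then show ?thesis using laplace_mean_bounds[OF assms, of x] unfolding laplace_gap_def abs_le_iff by linarith
qed

definition smoothed_log :: "real \<Rightarrow> real \<Rightarrow> (nat \<Rightarrow> real) \<Rightarrow> real" where
  "smoothed_log a U x = (\<integral>\<theta>. frullani a U (sqmod x \<theta>) \<partial>\<mu>) / 2"

lemma frullani_bound: "0 < a \<Longrightarrow> a \<le> U \<Longrightarrow> 0 \<le> t \<Longrightarrow> \<bar>frullani a U t\<bar> \<le> ln (U / a)"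
proof -
  assume a: "0 < a" "a \<le> U" and t: "0 \<le> t"
  have "\<bar>\<integral>u. exp (- u) - exp (- (u * t)) \<partial>log_measure a U\<bar> \<le> 1 * ln (U / a)"
  proof (rule log_measure_bound[OF a])
    fix u assume u: "a \<le> u" "u \<le> U"
    then have "exp (- u) \<le> 1" "exp (- (u * t)) \<le> 1" "0 < exp (- u)" "0 < exp (- (u * t))" using a t by auto
    then show "\<bar>exp (- u) - exp (- (u * t))\<bar> \<le> 1" unfolding abs_le_iff by linarith
  qed measurable
  then show ?thesis using frullani_log_measure[OF a(1)] by simp
qed

lemma smoothed_log_eq:
  assumes a: "0 < a" "a \<le> U"
  shows "smoothed_log a U x = (\<integral>u. laplace_gap x u \<partial>log_measure a U) / 2"
proof -
  interpret L: finite_measure "log_measure a U" using a by (rule log_measure_finite)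
  interpret P: pair_sigma_finite \<mu> "log_measure a U" ..
  define f where "f \<theta> u = exp (- u) - exp (- (u * sqmod x \<theta>))" for \<theta> u
  have f1: "\<bar>f \<theta> u\<bar> \<le> 1" if "0 \<le> u" for \<theta> u
  proof -
    have "exp (- u) \<le> 1" "exp (- (u * sqmod x \<theta>)) \<le> 1" "0 < exp (- u)" "0 < exp (- (u * sqmod x \<theta>))" using that by auto
    then show ?thesis unfolding f_def abs_le_iff by linarith
  qed
  have "(\<integral>\<theta>. (\<integral>u. f \<theta> u \<partial>log_measure a U) \<partial>\<mu>) = (\<integral>u. (\<integral>\<theta>. f \<theta> u \<partial>\<mu>) \<partial>log_measure a U)"
  proof (rule P.Fubini_integral[symmetric])
    show "integrable (\<mu> \<Otimes>\<^sub>M log_measure a U) (\<lambda>(\<theta>, u). f \<theta> u)"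
    proof (rule P.Fubini_integrable)
      show "(\<lambda>(\<theta>, u). f \<theta> u) \<in> borel_measurable (\<mu> \<Otimes>\<^sub>M log_measure a U)"
        unfolding f_def by measurable
      have m: "(\<lambda>\<theta>. \<integral>u. norm (f \<theta> u) \<partial>log_measure a U) \<in> borel_measurable borel"
        unfolding f_def by measurable
      have "\<bar>\<integral>u. norm (f \<theta> u) \<partial>log_measure a U\<bar> \<le> 1 * ln (U / a)" for \<theta>
        using f1 a by (intro log_measure_bound[OF a]) (auto simp: f_def)
      then show "integrable \<mu> (\<lambda>\<theta>. \<integral>u. norm (case (\<theta>, u) of (\<theta>, u) \<Rightarrow> f \<theta> u) \<partial>log_measure a U)"
        using m by (intro circle_integrable_bounded) auto
      show "AE \<theta> in \<mu>. integrable (log_measure a U) (\<lambda>u. case (\<theta>, u) of (\<theta>, u) \<Rightarrow> f \<theta> u)"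
        using f1 a by (intro AE_I2) (auto intro!: log_measure_bound(1)[OF a, where B=1] simp: f_def)
    qed
  qed
  moreover have "(\<integral>u. (\<integral>\<theta>. f \<theta> u \<partial>\<mu>) \<partial>log_measure a U) = (\<integral>u. laplace_gap x u \<partial>log_measure a U)"
  proof (rule integral_cong_AE)
    show "AE u in log_measure a U. (\<integral>\<theta>. f \<theta> u \<partial>\<mu>) = laplace_gap x u"
      using AE_log_measure[OF a(1), of U]
    proof eventually_elim
      case (elim u)
      then show ?case unfolding f_def using a circle.prob_space
        by (subst Bochner_Integration.integral_diff) (auto simp: laplace_gap_def laplace_mean_sqmod intro!: exp_sqmod_integrable)
    qed
  qed (unfold f_def, measurable)
  ultimately show ?thesis
    unfolding smoothed_log_def f_def frullani_log_measure[OF a(1)] by simp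
qed

lemma smoothed_log_bound:
  assumes a: "0 < a" "a \<le> U"
  shows "\<bar>smoothed_log a U x\<bar> \<le> ln (U / a) / 2"
proof -
  have "\<bar>\<integral>u. laplace_gap x u \<partial>log_measure a U\<bar> \<le> 1 * ln (U / a)"
    using a by (intro log_measure_bound laplace_gap_bound) auto
  then show ?thesis by (simp add: smoothed_log_eq[OF a])
qed

lemma smoothed_log_mean:
  assumes a: "0 < a" "a \<le> U"
  shows "\<bar>sign_mean n (smoothed_log a U) - gauss_frullani a U / 2\<bar> \<le> comparison_error U * ln (U / a) / 2"
proof -
  have int: "integrable (log_measure a U) (laplace_gap x)" for x
    using a by (intro log_measure_bound(1)[where B=1] laplace_gap_bound) auto
  have intg: "integrable (log_measure a U) (\<lambda>u. exp (- u) - 1 / (1 + u))"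
    using a by (intro log_measure_integral) (auto intro!: continuous_intros)
  have "sign_mean n (smoothed_log a U) = (1 / 2) * sign_mean n (\<lambda>x. \<integral>u. laplace_gap x u \<partial>log_measure a U)"
    unfolding sign_mean_cmult[symmetric] by (intro sign_mean_cong) (simp add: smoothed_log_eq[OF a])
  also have "sign_mean n (\<lambda>x. \<integral>u. laplace_gap x u \<partial>log_measure a U) = (\<integral>u. sign_mean n (\<lambda>x. laplace_gap x u) \<partial>log_measure a U)"
    by (rule integral_sign_mean[symmetric]) (rule int)
  finally have "sign_mean n (smoothed_log a U) - gauss_frullani a U / 2 =
      (\<integral>u. sign_mean n (\<lambda>x. laplace_gap x u) - (exp (- u) - 1 / (1 + u)) \<partial>log_measure a U) / 2"
    using int intg by (subst Bochner_Integration.integral_diff)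
      (auto intro!: integrable_sign_mean simp: gauss_frullani_log_measure[OF a(1)] diff_divide_distrib)
  moreover have "\<bar>\<integral>u. sign_mean n (\<lambda>x. laplace_gap x u) - (exp (- u) - 1 / (1 + u)) \<partial>log_measure a U\<bar> \<le> comparison_error U * ln (U / a)"
  proof (rule log_measure_bound(2)[OF a])
    fix u assume u: "a \<le> u" "u \<le> U"
    have "sign_mean n (\<lambda>x. laplace_gap x u) = exp (- u) - sign_mean n (\<lambda>x. laplace_mean n r x u)"
      by (simp add: laplace_gap_def sign_mean_diff)
    then show "\<bar>sign_mean n (\<lambda>x. laplace_gap x u) - (exp (- u) - 1 / (1 + u))\<bar> \<le> comparison_error U"
      using laplace_mean_single[of u U] u a by simp
  qed (simp add: sign_mean_def)
  ultimately show ?thesis by linarith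
qed

lemma laplace_gap_pair:
  assumes a: "0 < a" "a \<le> U" and u: "a \<le> u" "u \<le> U" and w: "a \<le> w" "w \<le> U"
  shows "\<bar>sign_mean n (\<lambda>x. laplace_gap x u * laplace_gap x w) - (exp (- u) - 1 / (1 + u)) * (exp (- w) - 1 / (1 + w))\<bar> \<le> 3 * comparison_error U"
proof -
  let ?A = "\<lambda>u. sign_mean n (\<lambda>x. laplace_mean n r x u)"
  let ?AB = "sign_mean n (\<lambda>x. laplace_mean n r x u * laplace_mean n r x w)"
  have "sign_mean n (\<lambda>x. laplace_gap x u * laplace_gap x w) =
     exp (- u) * exp (- w) - exp (- u) * ?A w - exp (- w) * ?A u + ?AB"
  proof -
    have "laplace_gap x u * laplace_gap x w = exp (- u) * exp (- w) - exp (- u) * laplace_mean n r x w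
         - exp (- w) * laplace_mean n r x u + laplace_mean n r x u * laplace_mean n r x w" for x
      by (simp add: laplace_gap_def algebra_simps)
    then show ?thesis by (simp add: sign_mean_add sign_mean_diff sign_mean_cmult)
  qed
  then have eq: "sign_mean n (\<lambda>x. laplace_gap x u * laplace_gap x w) - (exp (- u) - 1 / (1 + u)) * (exp (- w) - 1 / (1 + w)) =
     (?AB - 1 / ((1 + u) * (1 + w))) - exp (- u) * (?A w - 1 / (1 + w)) - exp (- w) * (?A u - 1 / (1 + u))"
    by (simp add: algebra_simps)
  have U: "0 < U" using a by simp
  have 1: "\<bar>?AB - 1 / ((1 + u) * (1 + w))\<bar> \<le> comparison_error U"
    using u w a by (intro laplace_mean_pair) auto
  have 2: "\<bar>exp (- v) * (?A t - 1 / (1 + t))\<bar> \<le> comparison_error U" if "a \<le> v" "a \<le> t" "t \<le> U" for v t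
  proof -
    have "\<bar>?A t - 1 / (1 + t)\<bar> \<le> comparison_error U" using that a by (intro laplace_mean_single) auto
    moreover have "exp (- v) * \<bar>?A t - 1 / (1 + t)\<bar> \<le> 1 * \<bar>?A t - 1 / (1 + t)\<bar>"
      using that a by (intro mult_right_mono) auto
    ultimately show ?thesis by (simp add: abs_mult)
  qed
  show ?thesis unfolding eq using 1 2[of u w] 2[of w u] u w by linarith
qed

text \<open>
  The square of the integral is a double integral against \<open>du dw / (u w)\<close>, and \<open>laplace_gap_pair\<close> bounds
  the error of the integrand uniformly; hence the square of the logarithm.
\<close>
lemma smoothed_log_square_mean:
  assumes a: "0 < a" "a \<le> U"
  shows "\<bar>sign_mean n (\<lambda>x. (smoothed_log a U x)\<^sup>2) - (gauss_frullani a U / 2)\<^sup>2\<bar> \<le> 3 / 4 * comparison_error U * (ln (U / a))\<^sup>2"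
proof -
  let ?L = "log_measure a U"
  interpret L: finite_measure "?L" using a by (rule log_measure_finite)
  define g where "g u = exp (- u) - 1 / (1 + u)" for u :: real
  have [measurable]: "g \<in> borel_measurable borel" unfolding g_def by measurable
  have int: "integrable ?L (laplace_gap x)" for x
    using a by (intro log_measure_bound(1)[where B=1] laplace_gap_bound) auto
  have intg: "integrable ?L g"
    unfolding g_def using a by (intro log_measure_integral) (auto intro!: continuous_intros)
  define H where "H u w = sign_mean n (\<lambda>x. laplace_gap x u * laplace_gap x w) - g u * g w" for u w
  have H_int: "integrable ?L (H u)" for u
    unfolding H_def using int intg by (intro Bochner_Integration.integrable_diff integrable_sign_mean integrable_mult_right)
  define h where "h u = (\<integral>w. H u w \<partial>?L)" for u
  have h: "h u = sign_mean n (\<lambda>x. laplace_gap x u * (\<integral>w. laplace_gap x w \<partial>?L)) - g u * (\<integral>w. g w \<partial>?L)" for u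
    unfolding h_def H_def using int intg
    by (subst Bochner_Integration.integral_diff) (auto intro!: integrable_sign_mean simp: integral_sign_mean)
  have "(\<integral>u. h u \<partial>?L) = sign_mean n (\<lambda>x. (\<integral>w. laplace_gap x w \<partial>?L) * (\<integral>w. laplace_gap x w \<partial>?L)) - (\<integral>w. g w \<partial>?L) * (\<integral>w. g w \<partial>?L)"
    unfolding h using int intg
    by (subst Bochner_Integration.integral_diff) (auto intro!: integrable_sign_mean simp: integral_sign_mean)
  moreover have "sign_mean n (\<lambda>x. (smoothed_log a U x)\<^sup>2) = (1 / 4) * sign_mean n (\<lambda>x. (\<integral>w. laplace_gap x w \<partial>?L) * (\<integral>w. laplace_gap x w \<partial>?L))"
    by (simp add: smoothed_log_eq[OF a] sign_mean_cmult[symmetric] power2_eq_square)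
  moreover have "(gauss_frullani a U / 2)\<^sup>2 = (1 / 4) * ((\<integral>w. g w \<partial>?L) * (\<integral>w. g w \<partial>?L))"
    by (simp add: gauss_frullani_log_measure[OF a(1)] g_def power2_eq_square)
  ultimately have eq: "sign_mean n (\<lambda>x. (smoothed_log a U x)\<^sup>2) - (gauss_frullani a U / 2)\<^sup>2 = (1 / 4) * (\<integral>u. h u \<partial>?L)"
    by (simp add: right_diff_distrib)
  have "\<bar>\<integral>u. h u \<partial>?L\<bar> \<le> (3 * comparison_error U * ln (U / a)) * ln (U / a)"
  proof (rule log_measure_bound(2)[OF a])
    fix u assume u: "a \<le> u" "u \<le> U"
    show "\<bar>h u\<bar> \<le> 3 * comparison_error U * ln (U / a)"
      unfolding h_def
    proof (rule log_measure_bound(2)[OF a])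
      show "\<bar>H u w\<bar> \<le> 3 * comparison_error U" if "a \<le> w" "w \<le> U" for w
        unfolding H_def g_def using a u that by (rule laplace_gap_pair)
      show "H u \<in> borel_measurable borel" unfolding H_def sign_mean_def by measurable
    qed
  next
    show "h \<in> borel_measurable borel" unfolding h[abs_def] sign_mean_def by measurable
  qed
  then show ?thesis unfolding eq by (simp add: power2_eq_square abs_mult)
qed

end

section \<open>From the truncated to the full logarithm\<close>

lemma neg_log_le_square: "neg_log t \<le> 1 + (neg_log t)\<^sup>2"
proof -
  have "2 * neg_log t \<le> 1 + (neg_log t)\<^sup>2"
    using zero_le_power2[of "neg_log t - 1"] by (simp add: power2_eq_square algebra_simps)
  then show ?thesis using neg_log_nonneg[of t] by linarith
qed

context flat_weights
begin

definition log_defect :: "real \<Rightarrow> (nat \<Rightarrow> real) \<Rightarrow> real" where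
  "log_defect U x = (\<integral>\<theta>. exp (- (U * sqmod x \<theta>)) * neg_log (sqmod x \<theta>) \<partial>\<mu>)"

lemma AE_sqmod_pos:
  assumes x: "x \<in> signs n"
  shows "AE \<theta> in \<mu>. 0 < sqmod x \<theta>"
proof -
  have "coeff_poly n x \<noteq> 0" using littlewood_poly_lead[OF x n] by auto
  then have "AE \<theta> in \<mu>. poly (coeff_poly n x) (of_real r * cis \<theta>) \<noteq> 0"
    using r by (intro AE_circle_poly_nonzero) auto
  then show ?thesis
  proof eventually_elim
    case (elim \<theta>)
    then have "normalized_poly n x r \<theta> \<noteq> 0"
      using sigma(1) by (simp add: normalized_poly_def poly_coeff_poly cis_conv_exp)
    then show ?case by (simp add: sqmod_def)
  qed
qed

lemma neg_log_integrable:
  assumes x: "x \<in> signs n" and U: "0 \<le> U"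
  shows "integrable \<mu> (\<lambda>\<theta>. (neg_log (sqmod x \<theta>))\<^sup>2)"
    "integrable \<mu> (\<lambda>\<theta>. exp (- (U * sqmod x \<theta>)) * (1 + (neg_log (sqmod x \<theta>))\<^sup>2))"
    "integrable \<mu> (\<lambda>\<theta>. exp (- (U * sqmod x \<theta>)) * neg_log (sqmod x \<theta>))"
    "integrable \<mu> (\<lambda>\<theta>. (exp (- (U * sqmod x \<theta>)) * neg_log (sqmod x \<theta>))\<^sup>2)"
proof -
  have e: "0 < exp (- (U * sqmod x \<theta>))" "exp (- (U * sqmod x \<theta>)) \<le> 1" for \<theta> using U by auto
  show i: "integrable \<mu> (\<lambda>\<theta>. (neg_log (sqmod x \<theta>))\<^sup>2)"
    unfolding sqmod_def using sigma(1) by (intro integrable_neg_log_square x n r) auto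
  have i1: "integrable \<mu> (\<lambda>\<theta>. 1 + (neg_log (sqmod x \<theta>))\<^sup>2)" using i by simp
  have b: "exp (- (U * sqmod x \<theta>)) * s \<le> s" if "0 \<le> s" for s \<theta>
    using mult_right_mono[OF e(2) that, of \<theta>] by simp
  show "integrable \<mu> (\<lambda>\<theta>. exp (- (U * sqmod x \<theta>)) * (1 + (neg_log (sqmod x \<theta>))\<^sup>2))"
    by (rule Bochner_Integration.integrable_bound[OF i1]) (auto intro!: AE_I2 b simp: abs_mult)
  show "integrable \<mu> (\<lambda>\<theta>. exp (- (U * sqmod x \<theta>)) * neg_log (sqmod x \<theta>))"
    by (rule Bochner_Integration.integrable_bound[OF i1]) (auto intro!: AE_I2 order_trans[OF b neg_log_le_square] simp: abs_mult)
  show "integrable \<mu> (\<lambda>\<theta>. (exp (- (U * sqmod x \<theta>)) * neg_log (sqmod x \<theta>))\<^sup>2)"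
  proof (rule Bochner_Integration.integrable_bound[OF i])
    show "AE \<theta> in \<mu>. norm ((exp (- (U * sqmod x \<theta>)) * neg_log (sqmod x \<theta>))\<^sup>2) \<le> norm ((neg_log (sqmod x \<theta>))\<^sup>2)"
      using b[OF neg_log_nonneg] by (intro AE_I2) (auto intro!: power_mono)
  qed measurable
qed

text \<open>
  The last bound is the Cauchy-Schwarz inequality. Both moments of the defect are thus controlled by the
  single quantity estimated in \<open>neg_log_tail_mean\<close>.
\<close>
lemma log_defect_bounds:
  assumes x: "x \<in> signs n" and U: "0 \<le> U"
  defines "Q \<equiv> (\<integral>\<theta>. exp (- (U * sqmod x \<theta>)) * (1 + (neg_log (sqmod x \<theta>))\<^sup>2) \<partial>\<mu>)"
  shows "0 \<le> log_defect U x" "log_defect U x \<le> Q" "(log_defect U x)\<^sup>2 \<le> Q"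
proof -
  note int = neg_log_integrable[OF x U]
  have e: "0 < exp (- (U * sqmod x \<theta>))" "exp (- (U * sqmod x \<theta>)) \<le> 1" for \<theta> using U by auto
  show "0 \<le> log_defect U x" unfolding log_defect_def by (intro Bochner_Integration.integral_nonneg) simp
  show "log_defect U x \<le> Q"
    unfolding log_defect_def Q_def using int neg_log_le_square by (intro integral_mono mult_left_mono) auto
  define f where "f \<theta> = exp (- (U * sqmod x \<theta>)) * neg_log (sqmod x \<theta>)" for \<theta>
  define m where "m = log_defect U x"
  have m: "m = (\<integral>\<theta>. f \<theta> \<partial>\<mu>)" by (simp add: m_def log_defect_def f_def)
  have if1: "integrable \<mu> f" and if2: "integrable \<mu> (\<lambda>\<theta>. (f \<theta>)\<^sup>2)"
    using int(3,4) by (simp_all add: f_def[abs_def])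
  have "0 \<le> (\<integral>\<theta>. (f \<theta>)\<^sup>2 - 2 * m * f \<theta> + m\<^sup>2 \<partial>\<mu>)"
  proof (rule Bochner_Integration.integral_nonneg)
    show "0 \<le> (f \<theta>)\<^sup>2 - 2 * m * f \<theta> + m\<^sup>2" for \<theta>
      using zero_le_power2[of "f \<theta> - m"] by (simp add: power2_eq_square algebra_simps)
  qed
  also have "\<dots> = (\<integral>\<theta>. (f \<theta>)\<^sup>2 \<partial>\<mu>) - 2 * m * m + m\<^sup>2"
    using if1 if2 circle.prob_space by (simp add: m)
  finally have "m\<^sup>2 \<le> (\<integral>\<theta>. (f \<theta>)\<^sup>2 \<partial>\<mu>)" by (simp add: power2_eq_square)
  also have "\<dots> \<le> Q"
    unfolding Q_def
  proof (rule integral_mono[OF if2 int(2)])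
    fix \<theta>
    have "(exp (- (U * sqmod x \<theta>)))\<^sup>2 \<le> exp (- (U * sqmod x \<theta>))"
      using e[of \<theta>] mult_left_mono[of "exp (- (U * sqmod x \<theta>))" 1 "exp (- (U * sqmod x \<theta>))"] by (simp add: power2_eq_square)
    then show "(f \<theta>)\<^sup>2 \<le> exp (- (U * sqmod x \<theta>)) * (1 + (neg_log (sqmod x \<theta>))\<^sup>2)"
      unfolding f_def power_mult_distrib by (intro mult_mono) auto
  qed
  finally show "(log_defect U x)\<^sup>2 \<le> Q" by (simp add: m_def)
qed

text \<open>
  The term \<open>a * |y - 1|\<close> of \<open>ln_frullani\<close> is harmless since the squared modulus has circle mean exactly \<open>1\<close>
  for every sign vector.
\<close>
lemma log_integral_smoothed:
  assumes x: "x \<in> signs n" and a: "0 < a" "a \<le> U"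
  shows "\<bar>log_integral n x r - smoothed_log a U x\<bar> \<le> a + exp (- U) + log_defect U x / 2"
proof -
  have U: "0 \<le> U" using a by simp
  define e where "e \<theta> = a * (sqmod x \<theta> + 1) + exp (- (U * sqmod x \<theta>)) * neg_log (sqmod x \<theta>) + exp (- U) * sqmod x \<theta>" for \<theta>
  have ie: "integrable \<mu> e"
    unfolding e_def using mean_sqmod(2) neg_log_integrable(3)[OF x U] by simp
  have val_e: "(\<integral>\<theta>. e \<theta> \<partial>\<mu>) = 2 * a + exp (- U) + log_defect U x"
    unfolding e_def log_defect_def using mean_sqmod(2) mean_sqmod(1)[OF x] neg_log_integrable(3)[OF x U] circle.prob_space by simp
  have close: "AE \<theta> in \<mu>. \<bar>ln (sqmod x \<theta>) - frullani a U (sqmod x \<theta>)\<bar> \<le> e \<theta>"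
    using AE_sqmod_pos[OF x]
  proof eventually_elim
    case (elim \<theta>)
    have "a * \<bar>sqmod x \<theta> - 1\<bar> \<le> a * (sqmod x \<theta> + 1)" using a elim by (intro mult_left_mono) auto
    then show ?case using ln_frullani[OF a elim] unfolding e_def neg_log_def by linarith
  qed
  have ifr: "integrable \<mu> (\<lambda>\<theta>. frullani a U (sqmod x \<theta>))"
    using a by (intro circle_integrable_bounded[where B="ln (U / a)"] frullani_bound) auto
  have idiff: "integrable \<mu> (\<lambda>\<theta>. ln (sqmod x \<theta>) - frullani a U (sqmod x \<theta>))"
  proof (rule Bochner_Integration.integrable_bound[OF ie])
    show "AE \<theta> in \<mu>. norm (ln (sqmod x \<theta>) - frullani a U (sqmod x \<theta>)) \<le> norm (e \<theta>)"
      using close by eventually_elim auto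
  qed (use a in measurable)
  have "integrable \<mu> (\<lambda>\<theta>. (ln (sqmod x \<theta>) - frullani a U (sqmod x \<theta>)) + frullani a U (sqmod x \<theta>))"
    using idiff ifr by (rule Bochner_Integration.integrable_add)
  then have iln: "integrable \<mu> (\<lambda>\<theta>. ln (sqmod x \<theta>))" by simp
  have "ln (cmod (normalized_poly n x r \<theta>)) = ln (sqmod x \<theta>) / 2" for \<theta>
    by (cases "normalized_poly n x r \<theta> = 0") (simp_all add: sqmod_def ln_realpow)
  then have "log_integral n x r = (\<integral>\<theta>. ln (sqmod x \<theta>) \<partial>\<mu>) / 2"
    by (simp only: log_integral_def integral_divide_zero)
  then have "log_integral n x r - smoothed_log a U x = (\<integral>\<theta>. ln (sqmod x \<theta>) - frullani a U (sqmod x \<theta>) \<partial>\<mu>) / 2"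
    using iln ifr by (simp add: smoothed_log_def diff_divide_distrib)
  moreover have "\<bar>\<integral>\<theta>. ln (sqmod x \<theta>) - frullani a U (sqmod x \<theta>) \<partial>\<mu>\<bar> \<le> (\<integral>\<theta>. \<bar>ln (sqmod x \<theta>) - frullani a U (sqmod x \<theta>)\<bar> \<partial>\<mu>)"
    by (rule integral_abs_bound)
  moreover have "\<dots> \<le> (\<integral>\<theta>. e \<theta> \<partial>\<mu>)"
    using idiff ie close by (intro integral_mono_AE) auto
  moreover have "0 < exp (- U)" by simp
  ultimately show ?thesis unfolding val_e by linarith
qed

definition tail_error :: "real \<Rightarrow> nat \<Rightarrow> real" where
  "tail_error U m = (1 + (16 * (real m)\<^sup>2 + ln (2 * real n))\<^sup>2) * (2 / U + 16 * exp (- (real n / (64 * U))) + 16 / real n) +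
    (1 + 2 * (ln (2 * real n))\<^sup>2 + 4 * real n ^ 6) * (11 / 2 ^ m) + 163840 / real n"

text \<open>
  For the second moment, \<open>|s\<^sup>2 - t\<^sup>2| \<le> d (2 |t| + d)\<close> with \<open>d = |s - t|\<close>. The truncated integral is bounded by
  \<open>\<nu> / 2\<close>, so the error is governed by the first two moments of \<open>d\<close>.
\<close>
lemma log_integral_moments:
  fixes m :: nat
  assumes a: "0 < a" "a \<le> U" and m: "1 \<le> m" "m \<le> n"
  defines "\<tau> \<equiv> tail_error U m" and "\<nu> \<equiv> ln (U / a)" and "b \<equiv> a + exp (- U)"
  shows "\<bar>sign_mean n (\<lambda>x. log_integral n x r) - (- euler_mascheroni / 2)\<bar> \<le>
      b + \<tau> + comparison_error U * \<nu> / 2 + (a + 1 / U) / 2" (is ?A)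
    and "\<bar>sign_mean n (\<lambda>x. (log_integral n x r)\<^sup>2) - (- euler_mascheroni / 2)\<^sup>2\<bar> \<le>
      \<nu> * (b + \<tau>) + (2 * b\<^sup>2 + \<tau>) + 3 / 4 * comparison_error U * \<nu>\<^sup>2 + (a + 1 / U) * (2 + (a + 1 / U)) / 4" (is ?B)
proof -
  have U: "0 < U" using a by simp
  define Q where "Q x = (\<integral>\<theta>. exp (- (U * sqmod x \<theta>)) * (1 + (neg_log (sqmod x \<theta>))\<^sup>2) \<partial>\<mu>)" for x
  define d where "d x = \<bar>log_integral n x r - smoothed_log a U x\<bar>" for x
  have \<nu>0: "0 \<le> \<nu>" unfolding \<nu>_def using a by simp
  have b0: "0 \<le> b" unfolding b_def using a by simp
  have Q: "sign_mean n Q \<le> \<tau>"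
  proof -
    have "sign_mean n Q = (\<integral>\<theta>. sign_mean n (\<lambda>x. exp (- (U * sqmod x \<theta>)) * (1 + (neg_log (sqmod x \<theta>))\<^sup>2)) \<partial>\<mu>)"
      unfolding Q_def using U by (subst integral_sign_mean) (auto intro!: neg_log_integrable)
    also have "\<dots> \<le> (1 + (16 * (real m)\<^sup>2 + ln (2 * real n))\<^sup>2) * (\<integral>\<theta>. sign_mean n (\<lambda>x. exp (- (U * sqmod x \<theta>))) \<partial>\<mu>) +
       (1 + 2 * (ln (2 * real n))\<^sup>2 + 4 * real n ^ 6) * (11 / 2 ^ m) + 163840 / real n"
      unfolding sqmod_def using n r sigma m U by (intro neg_log_tail_mean) auto
    also have "\<dots> \<le> \<tau>"
      unfolding \<tau>_def tail_error_def using U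
      by (intro add_right_mono mult_left_mono laplace_mean_upper) auto
    finally show ?thesis .
  qed
  have d1: "d x \<le> b + Q x" and d2: "(d x)\<^sup>2 \<le> 2 * b\<^sup>2 + Q x" if x: "x \<in> signs n" for x
  proof -
    have t: "0 \<le> log_defect U x" "log_defect U x \<le> Q x" "(log_defect U x)\<^sup>2 \<le> Q x"
      unfolding Q_def using x U by (auto intro!: log_defect_bounds)
    have dx: "d x \<le> b + log_defect U x / 2" unfolding d_def b_def by (rule log_integral_smoothed[OF x a])
    then show "d x \<le> b + Q x" using t by linarith
    have "(d x)\<^sup>2 \<le> (b + log_defect U x / 2)\<^sup>2" using dx by (intro power_mono) (auto simp: d_def)
    also have "\<dots> \<le> 2 * b\<^sup>2 + (log_defect U x)\<^sup>2 / 2"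
      using zero_le_power2[of "b - log_defect U x / 2"] by (simp add: power2_eq_square field_simps)
    also have "\<dots> \<le> 2 * b\<^sup>2 + Q x" using t(3) zero_le_power2[of "log_defect U x"] by linarith
    finally show "(d x)\<^sup>2 \<le> 2 * b\<^sup>2 + Q x" .
  qed
  have ed: "sign_mean n d \<le> b + \<tau>"
  proof -
    have "sign_mean n d \<le> sign_mean n (\<lambda>x. b + Q x)" by (intro sign_mean_mono d1)
    then show ?thesis using Q by (simp add: sign_mean_add)
  qed
  have ed2: "sign_mean n (\<lambda>x. (d x)\<^sup>2) \<le> 2 * b\<^sup>2 + \<tau>"
  proof -
    have "sign_mean n (\<lambda>x. (d x)\<^sup>2) \<le> sign_mean n (\<lambda>x. 2 * b\<^sup>2 + Q x)" by (intro sign_mean_mono d2)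
    then show ?thesis using Q by (simp add: sign_mean_add)
  qed
  define \<delta> where "\<delta> = gauss_frullani a U + euler_mascheroni"
  have \<delta>: "\<bar>\<delta>\<bar> \<le> a + 1 / U" unfolding \<delta>_def by (rule gauss_frullani_limit[OF a])
  have G: "gauss_frullani a U = \<delta> - euler_mascheroni" by (simp add: \<delta>_def)
  show ?A
  proof -
    have "\<bar>sign_mean n (\<lambda>x. log_integral n x r) - sign_mean n (smoothed_log a U)\<bar> \<le> sign_mean n d"
      unfolding sign_mean_diff[symmetric] d_def[abs_def] by (rule sign_mean_abs_le)
    moreover have "\<bar>sign_mean n (smoothed_log a U) - gauss_frullani a U / 2\<bar> \<le> comparison_error U * \<nu> / 2"
      unfolding \<nu>_def by (rule smoothed_log_mean[OF a])
    moreover have "\<bar>A - (- g / 2)\<bar> \<le> e + c' + f / 2"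
      if "\<bar>A - B\<bar> \<le> s" "\<bar>B - (D - g) / 2\<bar> \<le> c'" "s \<le> e" "\<bar>D\<bar> \<le> f" for A B s D g c' e f :: real
      using that by argo
    ultimately show ?thesis using ed \<delta> unfolding G by blast
  qed
  show ?B
  proof -
    have "\<bar>sign_mean n (\<lambda>x. (log_integral n x r)\<^sup>2) - sign_mean n (\<lambda>x. (smoothed_log a U x)\<^sup>2)\<bar>
        \<le> sign_mean n (\<lambda>x. \<bar>(log_integral n x r)\<^sup>2 - (smoothed_log a U x)\<^sup>2\<bar>)"
      unfolding sign_mean_diff[symmetric] by (rule sign_mean_abs_le)
    also have "\<dots> \<le> sign_mean n (\<lambda>x. \<nu> * d x + (d x)\<^sup>2)"
    proof (rule sign_mean_mono)
      fix x
      have "(log_integral n x r)\<^sup>2 - (smoothed_log a U x)\<^sup>2 =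
         (log_integral n x r - smoothed_log a U x) * (2 * smoothed_log a U x + (log_integral n x r - smoothed_log a U x))"
        by (simp add: power2_eq_square algebra_simps)
      then have "\<bar>(log_integral n x r)\<^sup>2 - (smoothed_log a U x)\<^sup>2\<bar> =
         d x * \<bar>2 * smoothed_log a U x + (log_integral n x r - smoothed_log a U x)\<bar>"
        by (simp add: abs_mult d_def)
      also have "\<dots> \<le> d x * (\<nu> + d x)"
        using smoothed_log_bound[OF a, of x] unfolding \<nu>_def d_def by (intro mult_left_mono) auto
      finally show "\<bar>(log_integral n x r)\<^sup>2 - (smoothed_log a U x)\<^sup>2\<bar> \<le> \<nu> * d x + (d x)\<^sup>2"
        by (simp add: power2_eq_square algebra_simps)
    qed
    also have "\<dots> = \<nu> * sign_mean n d + sign_mean n (\<lambda>x. (d x)\<^sup>2)"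
      by (simp add: sign_mean_add sign_mean_cmult)
    also have "\<dots> \<le> \<nu> * (b + \<tau>) + (2 * b\<^sup>2 + \<tau>)"
      using ed ed2 \<nu>0 by (intro add_mono mult_left_mono)
    finally have 1: "\<bar>sign_mean n (\<lambda>x. (log_integral n x r)\<^sup>2) - sign_mean n (\<lambda>x. (smoothed_log a U x)\<^sup>2)\<bar> \<le> \<nu> * (b + \<tau>) + (2 * b\<^sup>2 + \<tau>)" .
    have 2: "\<bar>sign_mean n (\<lambda>x. (smoothed_log a U x)\<^sup>2) - (gauss_frullani a U / 2)\<^sup>2\<bar> \<le> 3 / 4 * comparison_error U * \<nu>\<^sup>2"
      unfolding \<nu>_def by (rule smoothed_log_square_mean[OF a])
    have "\<bar>\<delta>\<bar> * \<bar>\<delta> - 2 * euler_mascheroni\<bar> \<le> (a + 1 / U) * (2 + (a + 1 / U))"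
      using \<delta> euler_mascheroni_pos euler_mascheroni_less_13_over_22 by (intro mult_mono) auto
    moreover have "(gauss_frullani a U / 2)\<^sup>2 - (- euler_mascheroni / 2)\<^sup>2 = \<delta> * (\<delta> - 2 * euler_mascheroni) / 4"
      unfolding G by (simp add: power2_eq_square field_simps)
    ultimately have 3: "\<bar>(gauss_frullani a U / 2)\<^sup>2 - (- euler_mascheroni / 2)\<^sup>2\<bar> \<le> (a + 1 / U) * (2 + (a + 1 / U)) / 4"
      by (simp only: abs_divide abs_mult abs_numeral) simp
    show ?thesis using 1 2 3 by linarith
  qed
qed

end

text \<open>
  The exponent \<open>11 / 10 > 1\<close> makes \<open>n |r - 1|\<close> small, so all powers \<open>r ^ (2 k)\<close> with \<open>k < n\<close> lie between
  \<open>1 / 2\<close> and \<open>2\<close>.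
\<close>
lemma flat_weights_near_one:
  assumes n: "2 \<le> n" "4 \<le> real n powr (1 / 10)"
    and r: "r \<in> {1 - real n powr (-11/10) .. 1 + real n powr (-11/10)}"
  shows "flat_weights n r"
proof -
  define h where "h = real n powr (-11/10)"
  have h0: "0 < h" using n by (simp add: h_def)
  have nh: "real n * h \<le> 1 / 4"
  proof -
    have "real n * h = real n powr 1 * real n powr (-11/10)" using n by (simp add: h_def)
    also have "\<dots> = real n powr (- (1 / 10))" by (subst powr_add[symmetric]) simp
    also have "\<dots> = 1 / real n powr (1 / 10)" by (rule powr_minus_divide)
    also have "\<dots> \<le> 1 / 4" using n by (intro divide_left_mono) auto
    finally show ?thesis .
  qed
  have "1 * h \<le> real n * h" using n h0 by (intro mult_right_mono) auto
  then have h: "h \<le> 1 / 4" using nh by simp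
  have r: "1 - h \<le> r" "r \<le> 1 + h" using r by (auto simp: h_def)
  \<comment> \<open>Bernoulli's inequality suffices; the upper bound below follows from \<open>(1 + h) (1 - h) \<le> 1\<close>.\<close>
  have low: "1 / 2 \<le> (1 - h) ^ (2 * k)" if "k < n" for k
  proof -
    have "real (2 * k) * h \<le> 2 * (real n * h)" using that h0 by (simp add: mult_right_mono)
    then have "1 / 2 \<le> 1 - real (2 * k) * h" using nh by linarith
    also have "\<dots> \<le> (1 - h) ^ (2 * k)" using Bernoulli_inequality[of "- h" "2 * k"] h by simp
    finally show ?thesis .
  qed
  have rk: "1 / 2 \<le> r ^ (2 * k)" "r ^ (2 * k) \<le> 2" if "k < n" for k
  proof -
    have "(1 - h) ^ (2 * k) \<le> r ^ (2 * k)" using r h by (intro power_mono) auto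
    then show "1 / 2 \<le> r ^ (2 * k)" using low[OF that] by linarith
    have "r ^ (2 * k) \<le> (1 + h) ^ (2 * k)" using r h by (intro power_mono) auto
    also have "\<dots> \<le> (1 / (1 - h)) ^ (2 * k)"
      using h h0 by (intro power_mono) (auto simp: field_simps)
    also have "\<dots> = 1 / (1 - h) ^ (2 * k)" by (simp add: power_divide)
    also have "\<dots> \<le> 1 / (1 / 2)" using low[OF that] by (intro divide_left_mono) auto
    finally show "r ^ (2 * k) \<le> 2" by simp
  qed
  have s2: "(sigma_norm n r)\<^sup>2 = (\<Sum>k<n. r ^ (2 * k))"
    unfolding sigma_norm_def by (intro real_sqrt_pow2 sum_nonneg) (simp add: power_mult)
  have "(\<Sum>k<n. 1 / 2) \<le> (\<Sum>k<n. r ^ (2 * k))" using rk by (intro sum_mono) auto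
  then have s_low: "real n / 2 \<le> (sigma_norm n r)\<^sup>2" using s2 by simp
  have "(\<Sum>k<n. r ^ (2 * k)) \<le> (\<Sum>k<n. 2)" using rk by (intro sum_mono) auto
  then have s_up: "(sigma_norm n r)\<^sup>2 \<le> 2 * real n" using s2 by simp
  have s_nonneg: "0 \<le> sigma_norm n r" unfolding sigma_norm_def by (intro real_sqrt_ge_zero sum_nonneg) (simp add: power_mult)
  show ?thesis
  proof
    show "2 \<le> n" by fact
    show "1 / 2 \<le> r" using r h by simp
    have "1\<^sup>2 \<le> (sigma_norm n r)\<^sup>2" using s_low n by simp
    then show "1 \<le> sigma_norm n r" using s_nonneg by (rule power2_le_imp_le)
    show "(sigma_norm n r)\<^sup>2 \<le> 2 * real n" by (rule s_up)
    show "(r ^ k / sigma_norm n r)\<^sup>2 \<le> 4 / real n" if "k < n" for k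
    proof -
      have "(r ^ k / sigma_norm n r)\<^sup>2 = r ^ (2 * k) / (sigma_norm n r)\<^sup>2"
        by (simp add: power_divide power_mult[symmetric] mult.commute)
      also have "\<dots> \<le> 2 / (real n / 2)"
        using rk[OF that] s_low n by (intro frac_le) auto
      finally show ?thesis by simp
    qed
  qed
qed

section \<open>Choice of parameters and conclusion\<close>

text \<open>
  The following three functions are bounds for \<open>tail_error\<close>, \<open>comparison_error\<close> and \<open>a + exp (- U)\<close> at
  \<open>a = 1 / n\<close>, \<open>U = n powr (3/4)\<close> and \<open>m\<close> the ceiling of \<open>12 ln n\<close>.
\<close>
definition asym_tail :: "nat \<Rightarrow> real" where
  "asym_tail n = (1 + (16 * (12 * ln (real n) + 1)\<^sup>2 + ln (2 * real n))\<^sup>2) *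
      (2 / real n powr (3/4) + 16 * exp (- (real n / (64 * real n powr (3/4)))) + 16 / real n) +
    (1 + 2 * (ln (2 * real n))\<^sup>2 + 4 * real n ^ 6) * (11 / real n ^ 8) + 163840 / real n"

definition asym_error :: "nat \<Rightarrow> real" where
  "asym_error n = 20 / sqrt (real n) + 160 / real n + 32 * exp (- (real n / (64 * real n powr (3/4))))"

definition asym_cut :: "nat \<Rightarrow> real" where
  "asym_cut n = 1 / real n + exp (- (real n powr (3/4)))"

definition rate :: "nat \<Rightarrow> real" where "rate n = (ln (real n))\<^sup>2 / sqrt (real n)"

lemma asym_tail_rate: "(\<lambda>n. ln (real n) * asym_tail n) \<in> O(rate)"
  unfolding asym_tail_def rate_def by real_asymp

lemma asym_error_rate: "(\<lambda>n. (ln (real n))\<^sup>2 * asym_error n) \<in> O(rate)"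
  unfolding asym_error_def rate_def by real_asymp

lemma asym_cut_rate: "(\<lambda>n. ln (real n) * asym_cut n) \<in> O(rate)"
  unfolding asym_cut_def rate_def by real_asymp

lemma asym_gamma_rate: "(\<lambda>n. 1 / real n + 1 / real n powr (3/4)) \<in> O(rate)"
  unfolding rate_def by real_asymp

definition total_error :: "nat \<Rightarrow> real" where
  "total_error n = 8 * (ln (real n) * asym_cut n + ln (real n) * asym_tail n + (ln (real n))\<^sup>2 * asym_error n
     + (1 / real n + 1 / real n powr (3/4)))"

lemma total_error_rate: "total_error \<in> O(rate)"
proof -
  have "(\<lambda>n. ln (real n) * asym_cut n + ln (real n) * asym_tail n + (ln (real n))\<^sup>2 * asym_error n
     + (1 / real n + 1 / real n powr (3/4))) \<in> O(rate)"
    by (intro sum_in_bigo asym_cut_rate asym_tail_rate asym_error_rate asym_gamma_rate)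
  from landau_o.big.cmult_in_iff[THEN iffD2, OF _ this, of 8]
  show ?thesis unfolding total_error_def[abs_def] by (rule; simp)
qed

text \<open>
  \<open>12 ln 2 \<ge> 8\<close>.
\<close>
lemma two_power_ceiling:
  assumes n: "1 \<le> n"
  shows "11 / 2 ^ nat \<lceil>12 * ln (real n)\<rceil> \<le> 11 / real n ^ 8"
proof -
  define m where "m = nat \<lceil>12 * ln (real n)\<rceil>"
  have "12 * ln (real n) \<le> real m" unfolding m_def by linarith
  moreover have "0 \<le> ln (real n)" using n by simp
  ultimately have "8 * ln (real n) \<le> real m * (2 / 3)" by simp
  also have "\<dots> \<le> real m * ln 2" using ln2_ge_two_thirds by (intro mult_left_mono) auto
  finally have "exp (8 * ln (real n)) \<le> exp (real m * ln 2)" by simp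
  also have "exp (real m * ln 2) = 2 ^ m" by (simp add: exp_of_nat_mult)
  also have "exp (8 * ln (real n)) = real n ^ 8"
    using n exp_of_nat_mult[of 8 "ln (real n)"] by simp
  finally show ?thesis unfolding m_def[symmetric] using n by (intro divide_left_mono) auto
qed

lemma (in flat_weights) moments_total_error:
  assumes big: "1 \<le> ln (real n)" "12 * ln (real n) + 1 \<le> real n"
  shows "\<bar>sign_mean n (\<lambda>x. log_integral n x r) - (- euler_mascheroni / 2)\<bar> \<le> total_error n"
    and "\<bar>sign_mean n (\<lambda>x. (log_integral n x r)\<^sup>2) - (- euler_mascheroni / 2)\<^sup>2\<bar> \<le> total_error n"
proof -
  define m where "m = nat \<lceil>12 * ln (real n)\<rceil>"
  define U where "U = real n powr (3/4)"
  define a where "a = 1 / real n"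
  define \<nu> where "\<nu> = ln (U / a)"
  define l where "l = ln (real n)"
  define g where "g = a + 1 / U"
  define B T E where "B = asym_cut n" and "T = asym_tail n" and "E = asym_error n"
  have n1: "1 \<le> real n" using n by simp
  have U1: "1 \<le> U" unfolding U_def using n1 by (intro ge_one_powr_ge_zero) auto
  have a: "0 < a" "a \<le> 1" "a \<le> U" using n U1 by (auto simp: a_def intro: order_trans[OF _ U1])
  have l1: "1 \<le> l" using big by (simp add: l_def)
  have m_bounds: "12 * l \<le> real m" "real m \<le> 12 * l + 1" using l1 unfolding m_def l_def by linarith+
  have m: "1 \<le> m" "m \<le> n" using m_bounds l1 big unfolding l_def[symmetric] by linarith+
  have \<nu>: "\<nu> = 7 / 4 * l"
    unfolding \<nu>_def U_def a_def l_def using n by (simp add: ln_mult ln_powr)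
  have E: "comparison_error U = E" by (simp add: comparison_error_def E_def asym_error_def U_def)
  have Bd: "a + exp (- U) = B" by (simp add: B_def asym_cut_def a_def U_def)
  have T: "tail_error U m \<le> T"
  proof -
    have "16 * (real m)\<^sup>2 + ln (2 * real n) \<le> 16 * (12 * l + 1)\<^sup>2 + ln (2 * real n)"
      using m_bounds by (intro add_right_mono mult_left_mono power_mono) auto
    moreover have "0 \<le> ln (2 * real n)" using n by simp
    ultimately have "(16 * (real m)\<^sup>2 + ln (2 * real n))\<^sup>2 \<le> (16 * (12 * l + 1)\<^sup>2 + ln (2 * real n))\<^sup>2"
      by (intro power_mono) auto
    moreover have "11 / 2 ^ m \<le> 11 / real n ^ 8" unfolding m_def using n by (intro two_power_ceiling) auto
    ultimately show ?thesis
      unfolding tail_error_def T_def asym_tail_def U_def[symmetric] l_def[symmetric] using U1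
      by (intro add_mono mult_mono order_refl) (auto intro!: add_nonneg_nonneg)
  qed
  have B0: "0 \<le> B" "B \<le> 2"
  proof -
    have "exp (- U) \<le> 1" using U1 by simp
    then show "B \<le> 2" using a unfolding Bd[symmetric] by linarith
    show "0 \<le> B" using a unfolding Bd[symmetric] by simp
  qed
  have T0: "0 \<le> T" unfolding T_def asym_tail_def using n by (intro add_nonneg_nonneg mult_nonneg_nonneg divide_nonneg_nonneg) auto
  have E0: "0 \<le> E" unfolding E_def asym_error_def by simp
  have "0 \<le> 1 / U" "1 / U \<le> 1" using U1 by auto
  then have g: "0 \<le> g" "g \<le> 2" using a unfolding g_def by linarith+
  have total: "total_error n = 8 * (l * B + l * T + l\<^sup>2 * E + g)"
    by (simp add: total_error_def l_def B_def T_def E_def g_def a_def U_def)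
  have lB: "B \<le> l * B" and lT: "T \<le> l * T" and lE: "l * E \<le> l\<^sup>2 * E"
    using l1 B0 T0 E0 mult_right_mono[of 1 l B] mult_right_mono[of 1 l T] mult_right_mono[of l "l\<^sup>2" E] self_le_power[of l 2]
    by auto
  have nn: "0 \<le> l * B" "0 \<le> l * T" "0 \<le> l\<^sup>2 * E" using l1 B0 T0 E0 by auto
  note moments = log_integral_moments[OF a(1,3) m, folded \<nu>_def g_def, unfolded E Bd]
  have "\<bar>sign_mean n (\<lambda>x. log_integral n x r) - (- euler_mascheroni / 2)\<bar> \<le> B + T + E * \<nu> / 2 + g / 2"
    using moments(1) T by simp
  also have "\<dots> = B + T + 7 / 8 * (l * E) + g / 2" by (simp add: \<nu>)
  also have "\<dots> \<le> total_error n"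
    unfolding total distrib_left using lB lT lE nn g by linarith
  finally show "\<bar>sign_mean n (\<lambda>x. log_integral n x r) - (- euler_mascheroni / 2)\<bar> \<le> total_error n" .
  have "\<nu> * (B + tail_error U m) \<le> \<nu> * (B + T)" using T l1 by (intro mult_left_mono) (auto simp: \<nu>)
  then have "\<bar>sign_mean n (\<lambda>x. (log_integral n x r)\<^sup>2) - (- euler_mascheroni / 2)\<^sup>2\<bar> \<le>
      \<nu> * (B + T) + (2 * B\<^sup>2 + T) + 3 / 4 * E * \<nu>\<^sup>2 + g * (2 + g) / 4"
    using moments(2) T by linarith
  also have "\<nu> * (B + T) = 7 / 4 * (l * B) + 7 / 4 * (l * T)" by (simp add: \<nu> algebra_simps)
  also have "3 / 4 * E * \<nu>\<^sup>2 = 147 / 64 * (l\<^sup>2 * E)" by (simp add: \<nu> power2_eq_square)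
  also have "7 / 4 * (l * B) + 7 / 4 * (l * T) + (2 * B\<^sup>2 + T) + 147 / 64 * (l\<^sup>2 * E) + g * (2 + g) / 4 \<le> total_error n"
  proof -
    have "2 * B\<^sup>2 \<le> 4 * B" using B0 mult_right_mono[of B 2 B] by (simp add: power2_eq_square)
    moreover have "g * (2 + g) \<le> g * 4" using g by (intro mult_left_mono) auto
    moreover have "total_error n = 8 * (l * B) + 8 * (l * T) + 8 * (l\<^sup>2 * E) + 8 * g" by (simp add: total)
    ultimately show ?thesis using lB lT nn g by linarith
  qed
  finally show "\<bar>sign_mean n (\<lambda>x. (log_integral n x r)\<^sup>2) - (- euler_mascheroni / 2)\<^sup>2\<bar> \<le> total_error n" .
qed

lemma log_integral_expectation:
  assumes rad: "rademacher_family M n X" and n: "0 < n"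
  shows "(LINT \<omega>|M. log_integral n (\<lambda>k. X k \<omega>) r ^ l) = sign_mean n (\<lambda>x. log_integral n x r ^ l)"
proof (rule rademacher_expectation[OF rad n])
  fix x y :: "nat \<Rightarrow> real" assume "\<And>k. k < n \<Longrightarrow> x k = y k"
  then have "normalized_poly n x r = normalized_poly n y r"
    by (simp add: fun_eq_iff normalized_poly_def littlewood_poly_def)
  then show "log_integral n x r ^ l = log_integral n y r ^ l" by (simp add: log_integral_def)
next
  from rad interpret prob_space M by (simp add: rademacher_family_def)
  have [measurable]: "X k \<in> borel_measurable M" if "k < n" for k
    using rad that by (auto simp: rademacher_family_def indep_vars_def)
  have "(\<lambda>(\<omega>, \<theta>). normalized_poly n (\<lambda>k. X k \<omega>) r \<theta>) \<in> borel_measurable (M \<Otimes>\<^sub>M \<mu>)"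
    unfolding normalized_poly_trig_sum trig_sum_def split_beta
    by (intro borel_measurable_sum borel_measurable_times borel_measurable_of_real
        measurable_compose[OF _ borel_measurable_continuous_onI[of cis]] continuous_intros) measurable
  then have "(\<lambda>(\<omega>, \<theta>). ln (cmod (normalized_poly n (\<lambda>k. X k \<omega>) r \<theta>))) \<in> borel_measurable (M \<Otimes>\<^sub>M \<mu>)"
    by (simp add: split_beta)
  then have "(\<lambda>\<omega>. log_integral n (\<lambda>k. X k \<omega>) r) \<in> borel_measurable M"
    unfolding log_integral_def by (rule circle.borel_measurable_lebesgue_integral)
  then show "(\<lambda>\<omega>. log_integral n (\<lambda>k. X k \<omega>) r ^ l) \<in> borel_measurable M" by simp
qed

theorem lemma1p3:
  "\<exists>C>0. \<exists>N\<ge>2. \<forall>n\<ge>N. \<forall>(M :: 'a measure) (X :: nat \<Rightarrow> 'a \<Rightarrow> real).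
     rademacher_family M n X \<longrightarrow>
     (\<forall>l\<in>{1, 2 :: nat}.
      \<forall>r\<in>{1 - real n powr (-11/10) .. 1 + real n powr (-11/10)}.
        \<bar>(LINT \<omega>|M. log_integral n (\<lambda>k. X k \<omega>) r ^ l) - (- euler_mascheroni / 2 :: real) ^ l\<bar>
          \<le> C * (ln (real n))\<^sup>2 / sqrt (real n))"
proof -
  obtain C where C: "C > 0" and bound: "eventually (\<lambda>n. norm (total_error n) \<le> C * norm (rate n)) sequentially"
    using total_error_rate by (rule landau_o.bigE)
  have "eventually (\<lambda>n. 4 \<le> real n powr (1 / 10)) sequentially" by real_asymp
  moreover have "eventually (\<lambda>n. 1 \<le> ln (real n)) sequentially" by real_asymp
  moreover have "eventually (\<lambda>n. 12 * ln (real n) + 1 \<le> real n) sequentially" by real_asymp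
  ultimately have "eventually (\<lambda>n. 2 \<le> n \<and> norm (total_error n) \<le> C * norm (rate n) \<and> 4 \<le> real n powr (1 / 10)
      \<and> 1 \<le> ln (real n) \<and> 12 * ln (real n) + 1 \<le> real n) sequentially"
    using bound eventually_ge_at_top[of 2] by eventually_elim simp
  then obtain N where N: "2 \<le> n \<and> norm (total_error n) \<le> C * norm (rate n) \<and> 4 \<le> real n powr (1 / 10)
      \<and> 1 \<le> ln (real n) \<and> 12 * ln (real n) + 1 \<le> real n" if "N \<le> n" for n
    unfolding eventually_sequentially by blast
  show ?thesis
  proof (intro exI[of _ C] exI[of _ "max N 2"] conjI allI impI ballI C)
    fix n :: nat and M :: "'a measure" and X :: "nat \<Rightarrow> 'a \<Rightarrow> real" and l :: nat and r :: real
    assume n: "max N 2 \<le> n" and rad: "rademacher_family M n X" and l: "l \<in> {1, 2}"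
      and r: "r \<in> {1 - real n powr (-11/10) .. 1 + real n powr (-11/10)}"
    have big: "2 \<le> n" "norm (total_error n) \<le> C * norm (rate n)" "4 \<le> real n powr (1 / 10)"
        "1 \<le> ln (real n)" "12 * ln (real n) + 1 \<le> real n"
      using N[of n] n by auto
    interpret flat_weights n r using big(1,3) r by (rule flat_weights_near_one)
    have "\<bar>sign_mean n (\<lambda>x. log_integral n x r ^ l) - (- euler_mascheroni / 2) ^ l\<bar> \<le> total_error n"
      using l moments_total_error[OF big(4,5)] by auto
    also have "\<dots> \<le> C * rate n" using big(2) by (simp add: rate_def)
    also have "\<dots> = C * (ln (real n))\<^sup>2 / sqrt (real n)" by (simp add: rate_def)
    finally show "\<bar>(LINT \<omega>|M. log_integral n (\<lambda>k. X k \<omega>) r ^ l) - (- euler_mascheroni / 2 :: real) ^ l\<bar>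
          \<le> C * (ln (real n))\<^sup>2 / sqrt (real n)"
      using big(1) by (subst log_integral_expectation[OF rad]) auto
  qed auto
qed

end
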